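(* Let $w$ be a Lévy white noise in $\mathcal{S}'(\mathbb{R}^d)$ with finite moments (satisfying the sector condition) and let $m\ge1$ be an integer. Assume that the moment index of $w$ satisfies $p_{\max}>2m$. Then there exists a constant $C>0$ such that, for every $j\in\mathbb{N}$, $G\in\mathcal{G}^j$ and $k\in\mathbb{Z}^d$, $$\mathbb{E}\big[\langle w,\psi_{j,G,k}\rangle^{2m}\big]\le C\,2^{jd(m-1)}.$$
   Context: Fix $d\ge1$ and a complete probability space; $\mathbb{N}=\{0,1,2,\dots\}$. $\mathcal{S}(\mathbb{R}^d)$ is the space of rapidly decaying smooth functions $\mathbb{R}^d\to\mathbb{R}$, and $\mathcal{S}'(\mathbb{R}^d)$ its dual with the strong topology and its Borel $\sigma$-field; a generalized random process is a measurable map from the probability space to $\mathcal{S}'(\mathbb{R}^d)$. A characteristic exponent is a function $\Psi(\xi)=\mathrm{i}\mu\xi-\frac{\sigma^2\xi^2}{2}+\int_{\mathbb{R}}(e^{\mathrm{i}\xi t}-1-\mathrm{i}\xi t\mathbf{1}_{|t|\le1})\,d\nu(t)$ with $\mu\in\mathbb{R}$, $\sigma^2\ge0$, and $\nu$ a Lévy measure (positive, $\nu(\{0\})=0$, $\int\min(1,t^2)d\nu(t)<\infty$). A Lévy white noise is a generalized random process $w$ with $\mathbb{E}[e^{\mathrm{i}\langle w,\varphi\rangle}]=\exp(\int_{\mathbb{R}^d}\Psi(\varphi(x))dx)$ for all $\varphi\in\mathcal{S}(\mathbb{R}^d)$, where $\Psi$ is a characteristic exponent satisfying the $\epsilon$-condition: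 $\int\min(|t|^\epsilon,t^2)d\nu(t)<\infty$ for some $\epsilon>0$. For compactly supported $\varphi\in L_2(\mathbb{R}^d)$, $\langle w,\varphi\rangle$ is defined as the limit in probability of $\langle w,\varphi_n\rangle$ for $\varphi_n\in\mathcal{S}(\mathbb{R}^d)$ approximating $\varphi$. $w$ has finite moments if $\mathbb{E}[|\langle w,\varphi\rangle|^p]<\infty$ for all $\varphi\in\mathcal{S}(\mathbb{R}^d)$ and $p>0$. Moment index: $p_{\max}=\sup\{p>0:\mathbb{E}[|\langle w,\mathbf{1}_{[0,1]^d}\rangle|^p]<\infty\}\in(0,\infty]$. Sector condition: there is $M>0$ with $|\Im\Psi(\xi)|\le M|\Re\Psi(\xi)|$ for all $\xi\in\mathbb{R}$. Wavelets: $\psi_M,\psi_F\in L_2(\mathbb{R})$ are fixed compactly supported (mother, father) Daubechies wavelets (continuous, with at least $r_0\ge1$ continuous derivatives); $\mathcal{G}^0=\{M,F\}^d$ and $\mathcal{G}^j=\{M,F\}^d\setminus\{(F,\dots,F)\}$ for $j\ge1$; $\psi_G(x)=\prod_{i=1}^d\psi_{G_i}(x_i)$ and $\psi_{j,G,k}=2^{jd/2}\psi_G(2^j\cdot-k)$. *)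

theory Defs
  imports "HOL-Probability.Probability"
begin

section \<open>Rapidly decaying smooth functions\<close>

definition partial_deriv :: "'n \<Rightarrow> (real^'n \<Rightarrow> real) \<Rightarrow> real^'n \<Rightarrow> real" where
  "partial_deriv i f x = frechet_derivative f (at x) (axis i 1)"

primrec iter_partial :: "'n list \<Rightarrow> (real^'n \<Rightarrow> real) \<Rightarrow> real^'n \<Rightarrow> real" where
  "iter_partial [] f = f"
| "iter_partial (i # is) f = partial_deriv i (iter_partial is f)"

definition smooth_fun :: "(real^'n \<Rightarrow> real) \<Rightarrow> bool" where
  "smooth_fun f \<longleftrightarrow> (\<forall>is x. iter_partial is f differentiable (at x))"

definition rapidly_decaying :: "(real^'n \<Rightarrow> real) \<Rightarrow> bool" where
  "rapidly_decaying f \<longleftrightarrow>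
     (\<forall>N is. bounded (range (\<lambda>x. (1 + norm x) ^ N * iter_partial is f x)))"

lemma iter_partial_zero: "iter_partial is (\<lambda>x. 0) = (\<lambda>x. 0)"
  by (induction "is") (auto simp: partial_deriv_def fun_eq_iff[of "partial_deriv _ _"])

lemma iter_partial_add:
  assumes "smooth_fun f" "smooth_fun g"
  shows "iter_partial is (\<lambda>x. f x + g x) = (\<lambda>x. iter_partial is f x + iter_partial is g x)"
proof (induction "is")
  case (Cons i "is")
  have "frechet_derivative (\<lambda>x. iter_partial is f x + iter_partial is g x) (at x)
      = (\<lambda>v. frechet_derivative (iter_partial is f) (at x) v
             + frechet_derivative (iter_partial is g) (at x) v)" for x
    using assms unfolding smooth_fun_def
    by (intro frechet_derivative_at[symmetric] has_derivative_add)
       (auto simp: frechet_derivative_works[symmetric])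
  then show ?case
    by (intro ext) (simp add: Cons partial_deriv_def)
qed simp

lemma iter_partial_scale:
  assumes "smooth_fun f"
  shows "iter_partial is (\<lambda>x. c * f x) = (\<lambda>x. c * iter_partial is f x)"
proof (induction "is")
  case (Cons i "is")
  have "frechet_derivative (\<lambda>x. c * iter_partial is f x) (at x)
      = (\<lambda>v. c * frechet_derivative (iter_partial is f) (at x) v)" for x
    using assms unfolding smooth_fun_def
    by (intro frechet_derivative_at[symmetric] has_derivative_mult_right)
       (auto simp: frechet_derivative_works[symmetric])
  then show ?case
    by (intro ext) (simp add: Cons partial_deriv_def)
qed simp

lemma smooth_fun_add: "smooth_fun f \<Longrightarrow> smooth_fun g \<Longrightarrow> smooth_fun (\<lambda>x. f x + g x)"
  unfolding smooth_fun_def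
  by (subst iter_partial_add) (auto simp: smooth_fun_def)

lemma smooth_fun_scale: "smooth_fun f \<Longrightarrow> smooth_fun (\<lambda>x. c * f x)"
  unfolding smooth_fun_def
  by (subst iter_partial_scale) (auto simp: smooth_fun_def)

lemma rapidly_decaying_add:
  assumes "smooth_fun f" "smooth_fun g" "rapidly_decaying f" "rapidly_decaying g"
  shows "rapidly_decaying (\<lambda>x. f x + g x)"
  using assms(3,4) unfolding rapidly_decaying_def iter_partial_add[OF assms(1,2)] distrib_left
  by (auto intro!: bounded_plus_comp)

lemma rapidly_decaying_scale:
  assumes "smooth_fun f" "rapidly_decaying f"
  shows "rapidly_decaying (\<lambda>x. c * f x)"
proof -
  have "bounded ((\<lambda>y. c *\<^sub>R y) ` range (\<lambda>x. (1 + norm x) ^ N * iter_partial is f x))" for N "is"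
    using assms(2) by (intro bounded_scaling) (simp add: rapidly_decaying_def)
  then show ?thesis
    unfolding rapidly_decaying_def iter_partial_scale[OF assms(1)]
    by (simp add: image_image mult.left_commute)
qed

typedef (overloaded) 'n schwartz = "{f :: real^'n::finite \<Rightarrow> real. smooth_fun f \<and> rapidly_decaying f}"
  morphisms schwartz_fun Schwartz
  by (intro exI[of _ "\<lambda>x. 0"])
     (simp add: smooth_fun_def rapidly_decaying_def iter_partial_zero)

setup_lifting type_definition_schwartz

instantiation schwartz :: (finite) real_vector
begin

lift_definition zero_schwartz :: "'a schwartz" is "\<lambda>x. 0"
  by (simp add: smooth_fun_def rapidly_decaying_def iter_partial_zero)

lift_definition plus_schwartz :: "'a schwartz \<Rightarrow> 'a schwartz \<Rightarrow> 'a schwartz"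
  is "\<lambda>f g x. f x + g x"
  by (simp add: smooth_fun_add rapidly_decaying_add)

lift_definition scaleR_schwartz :: "real \<Rightarrow> 'a schwartz \<Rightarrow> 'a schwartz"
  is "\<lambda>c f x. c * f x"
  by (simp add: smooth_fun_scale rapidly_decaying_scale)

lift_definition uminus_schwartz :: "'a schwartz \<Rightarrow> 'a schwartz" is "\<lambda>f x. - f x"
  by (auto dest: smooth_fun_scale[of _ "-1"] rapidly_decaying_scale[of _ "-1"])

definition minus_schwartz :: "'a schwartz \<Rightarrow> 'a schwartz \<Rightarrow> 'a schwartz" where
  "minus_schwartz f g = f + - g"

instance
  by standard ((simp add: minus_schwartz_def; fail) | (transfer; simp add: algebra_simps))+

end

definition schwartz_seminorm :: "nat \<Rightarrow> 'n list \<Rightarrow> 'n::finite schwartz \<Rightarrow> real" where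
  "schwartz_seminorm N is f = (SUP x. (1 + norm x) ^ N * \<bar>iter_partial is (schwartz_fun f) x\<bar>)"

text \<open>The locally convex topology generated by the seminorms.\<close>

instantiation schwartz :: (finite) topological_space
begin

definition open_schwartz :: "'a schwartz set \<Rightarrow> bool" where
  "open_schwartz U \<longleftrightarrow> (\<forall>f\<in>U. \<exists>A e. finite A \<and> 0 < e \<and>
     {g. \<forall>(N, is)\<in>A. schwartz_seminorm N is (g - f) < e} \<subseteq> U)"

instance
proof
  show "open (UNIV :: 'a schwartz set)"
    by (auto simp: open_schwartz_def intro!: exI[of _ "{}"] exI[of _ "1::real"])
next
  fix S T :: "'a schwartz set"
  assume S: "open S" and T: "open T"
  show "open (S \<inter> T)"
    unfolding open_schwartz_def
  proof
    fix f assume f: "f \<in> S \<inter> T"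
    obtain A a where A: "finite A" "0 < a"
      "{g. \<forall>(N, is)\<in>A. schwartz_seminorm N is (g - f) < a} \<subseteq> S"
      using S f unfolding open_schwartz_def by blast
    obtain B b where B: "finite B" "0 < b"
      "{g. \<forall>(N, is)\<in>B. schwartz_seminorm N is (g - f) < b} \<subseteq> T"
      using T f unfolding open_schwartz_def by blast
    show "\<exists>A e. finite A \<and> 0 < e \<and>
        {g. \<forall>(N, is)\<in>A. schwartz_seminorm N is (g - f) < e} \<subseteq> S \<inter> T"
      using A B by (intro exI[of _ "A \<union> B"] exI[of _ "min a b"]) fastforce
  qed
next
  fix K :: "'a schwartz set set"
  assume "\<forall>S\<in>K. open S"
  then show "open (\<Union>K)"
    unfolding open_schwartz_def by (meson UnionE Union_upper order_trans)
qed

end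

definition schwartz_bounded :: "'n::finite schwartz set \<Rightarrow> bool" where
  "schwartz_bounded B \<longleftrightarrow> (\<forall>N is. bdd_above (schwartz_seminorm N is ` B))"


section \<open>Tempered distributions with the strong topology\<close>

typedef (overloaded) 'n tempered = "{T :: 'n::finite schwartz \<Rightarrow> real. linear T \<and> continuous_on UNIV T}"
  morphisms dual_pair Tempered
  by (intro exI[of _ "\<lambda>f. 0"]) (simp add: linear_iff)

text \<open>Uniform convergence on bounded sets. A single bounded set \<open>B\<close> suffices for a
  neighbourhood base because finite unions of bounded sets are bounded.\<close>

instantiation tempered :: (finite) topological_space
begin

definition open_tempered :: "'a tempered set \<Rightarrow> bool" where
  "open_tempered U \<longleftrightarrow> (\<forall>T\<in>U. \<exists>B e. schwartz_bounded B \<and> 0 < e \<and>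
     {S. \<forall>f\<in>B. \<bar>dual_pair S f - dual_pair T f\<bar> < e} \<subseteq> U)"

instance
proof
  show "open (UNIV :: 'a tempered set)"
    by (auto simp: open_tempered_def schwartz_bounded_def intro!: exI[of _ "{}"] exI[of _ "1::real"])
next
  fix U V :: "'a tempered set"
  assume U: "open U" and V: "open V"
  show "open (U \<inter> V)"
    unfolding open_tempered_def
  proof
    fix T assume T: "T \<in> U \<inter> V"
    obtain A a where A: "schwartz_bounded A" "0 < a"
      "{S. \<forall>f\<in>A. \<bar>dual_pair S f - dual_pair T f\<bar> < a} \<subseteq> U"
      using U T unfolding open_tempered_def by blast
    obtain B b where B: "schwartz_bounded B" "0 < b"
      "{S. \<forall>f\<in>B. \<bar>dual_pair S f - dual_pair T f\<bar> < b} \<subseteq> V"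
      using V T unfolding open_tempered_def by blast
    have "schwartz_bounded (A \<union> B)"
      using A(1) B(1) by (simp add: schwartz_bounded_def image_Un)
    moreover have "{S. \<forall>f\<in>A \<union> B. \<bar>dual_pair S f - dual_pair T f\<bar> < min a b} \<subseteq> U \<inter> V"
      using A(3) B(3) by auto
    ultimately show "\<exists>B e. schwartz_bounded B \<and> 0 < e \<and>
        {S. \<forall>f\<in>B. \<bar>dual_pair S f - dual_pair T f\<bar> < e} \<subseteq> U \<inter> V"
      using A(2) B(2) by (intro exI[of _ "A \<union> B"] exI[of _ "min a b"]) simp
  qed
next
  fix K :: "'a tempered set set"
  assume "\<forall>U\<in>K. open U"
  then show "open (\<Union>K)"
    unfolding open_tempered_def by (meson UnionE Union_upper order_trans)
qed

end


section \<open>Levy white noise\<close>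

definition levy_measure :: "real measure \<Rightarrow> bool" where
  "levy_measure \<nu> \<longleftrightarrow> sets \<nu> = sets borel \<and> emeasure \<nu> {0} = 0 \<and>
     (\<integral>\<^sup>+t. ennreal (min 1 (t\<^sup>2)) \<partial>\<nu>) < \<infinity>"

definition eps_condition :: "real measure \<Rightarrow> bool" where
  "eps_condition \<nu> \<longleftrightarrow>
     (\<exists>\<epsilon>>0. (\<integral>\<^sup>+t. ennreal (min (\<bar>t\<bar> powr \<epsilon>) (t\<^sup>2)) \<partial>\<nu>) < \<infinity>)"

text \<open>The second parameter is the variance, the \<open>\<sigma>\<^sup>2\<close> of the Levy triplet.\<close>

definition levy_exponent :: "real \<Rightarrow> real \<Rightarrow> real measure \<Rightarrow> real \<Rightarrow> complex" where
  "levy_exponent \<mu> v \<nu> \<xi> =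
     \<i> * of_real (\<mu> * \<xi>) - of_real (v * \<xi>\<^sup>2 / 2) +
     (LINT t|\<nu>. cis (\<xi> * t) - 1 - \<i> * of_real (\<xi> * t * indicator {-1..1} t))"

definition sector_condition :: "(real \<Rightarrow> complex) \<Rightarrow> bool" where
  "sector_condition \<Psi> \<longleftrightarrow> (\<exists>K>0. \<forall>\<xi>. \<bar>Im (\<Psi> \<xi>)\<bar> \<le> K * \<bar>Re (\<Psi> \<xi>)\<bar>)"

definition levy_white_noise ::
    "'a measure \<Rightarrow> (real \<Rightarrow> complex) \<Rightarrow> ('a \<Rightarrow> 'n::finite tempered) \<Rightarrow> bool" where
  "levy_white_noise M \<Psi> w \<longleftrightarrow>
     w \<in> borel_measurable M \<and>
     (\<exists>\<mu> v \<nu>. 0 \<le> v \<and> levy_measure \<nu> \<and> eps_condition \<nu> \<and> \<Psi> = levy_exponent \<mu> v \<nu>) \<and>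
     (\<forall>\<phi>. (LINT \<omega>|M. cis (dual_pair (w \<omega>) \<phi>)) = exp (LINT x|lborel. \<Psi> (schwartz_fun \<phi> x)))"

definition tendsto_in_prob :: "'a measure \<Rightarrow> (nat \<Rightarrow> 'a \<Rightarrow> real) \<Rightarrow> ('a \<Rightarrow> real) \<Rightarrow> bool" where
  "tendsto_in_prob M X Y \<longleftrightarrow>
     (\<forall>e>0. (\<lambda>n. measure M {\<omega>\<in>space M. e < \<bar>X n \<omega> - Y \<omega>\<bar>}) \<longlonglongrightarrow> 0)"

text \<open>Approximation of a compactly supported \<open>L\<^sub>2\<close> function by test functions:
  convergence in \<open>L\<^sub>2\<close> with supports in a common compact set.\<close>

definition approximates :: "(nat \<Rightarrow> 'n::finite schwartz) \<Rightarrow> (real^'n \<Rightarrow> real) \<Rightarrow> bool" where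
  "approximates \<phi> f \<longleftrightarrow>
     (\<exists>K. compact K \<and> (\<forall>n x. x \<notin> K \<longrightarrow> schwartz_fun (\<phi> n) x = 0)) \<and>
     (\<lambda>n. \<integral>\<^sup>+x. ennreal ((schwartz_fun (\<phi> n) x - f x)\<^sup>2) \<partial>lborel) \<longlonglongrightarrow> 0"

text \<open>For \<open>f\<close> in \<open>L\<^sub>2\<close> with compact support, the following is \<open>\<langle>w, f\<rangle>\<close>, a random variable that
  is determined up to almost sure equality. For all other \<open>f\<close> its value is irrelevant.\<close>

definition noise_pair ::
    "'a measure \<Rightarrow> ('a \<Rightarrow> 'n::finite tempered) \<Rightarrow> (real^'n \<Rightarrow> real) \<Rightarrow> 'a \<Rightarrow> real" where
  "noise_pair M w f = (SOME X. X \<in> borel_measurable M \<and>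
     (\<forall>\<phi>. approximates \<phi> f \<longrightarrow> tendsto_in_prob M (\<lambda>n \<omega>. dual_pair (w \<omega>) (\<phi> n)) X))"

definition abs_moment :: "'a measure \<Rightarrow> real \<Rightarrow> ('a \<Rightarrow> real) \<Rightarrow> ennreal" where
  "abs_moment M p X = (\<integral>\<^sup>+\<omega>. ennreal (\<bar>X \<omega>\<bar> powr p) \<partial>M)"

definition finite_moments :: "'a measure \<Rightarrow> ('a \<Rightarrow> 'n::finite tempered) \<Rightarrow> bool" where
  "finite_moments M w \<longleftrightarrow> (\<forall>\<phi> p. 0 < p \<longrightarrow> abs_moment M p (\<lambda>\<omega>. dual_pair (w \<omega>) \<phi>) < \<infinity>)"

definition moment_index :: "'a measure \<Rightarrow> ('a \<Rightarrow> 'n::finite tempered) \<Rightarrow> ereal" where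
  "moment_index M w =
     Sup {ereal p | p. 0 < p \<and> abs_moment M p (noise_pair M w (indicator (cbox 0 1))) < \<infinity>}"


section \<open>Daubechies wavelets\<close>

definition C_k :: "nat \<Rightarrow> (real \<Rightarrow> real) \<Rightarrow> bool" where
  "C_k r f \<longleftrightarrow> (\<forall>i\<le>r. continuous_on UNIV ((deriv ^^ i) f)) \<and>
     (\<forall>i<r. \<forall>x. (deriv ^^ i) f differentiable (at x))"

text \<open>The real quadrature mirror filters of length \<open>2 * N\<close> with the maximal number \<open>N\<close> of
  vanishing moments. All spectral factors are admitted, so both the extremal phase and the
  least asymmetric Daubechies filters are included.\<close>

definition daubechies_filter :: "nat \<Rightarrow> (int \<Rightarrow> real) \<Rightarrow> bool" where
  "daubechies_filter N h \<longleftrightarrow> 1 \<le> N \<and>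
     (\<forall>k. k \<notin> {0..<2 * int N} \<longrightarrow> h k = 0) \<and>
     (\<Sum>k\<in>{0..<2 * int N}. h k) = sqrt 2 \<and>
     (\<forall>l. (\<Sum>k\<in>{0..<2 * int N}. h k * h (k + 2 * l)) = (if l = 0 then 1 else 0)) \<and>
     (\<forall>p<N. (\<Sum>k\<in>{0..<2 * int N}. (if even k then 1 else - 1) * of_int k ^ p * h k) = 0)"

text \<open>The father wavelet solves the refinement equation with mask \<open>h\<close>, normalised to integral 1;
  the mother wavelet is obtained from the conjugate mirror filter
  \<open>g k = (-1)^k * h (2 * N - 1 - k)\<close>. Other conventions for \<open>g\<close> change the mother wavelet
  by a sign and an integer translation only.\<close>

definition daubechies_wavelets :: "nat \<Rightarrow> (real \<Rightarrow> real) \<Rightarrow> (real \<Rightarrow> real) \<Rightarrow> bool" where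
  "daubechies_wavelets r \<psi>M \<psi>F \<longleftrightarrow>
     C_k r \<psi>M \<and> C_k r \<psi>F \<and>
     (\<exists>K. compact K \<and> (\<forall>x. x \<notin> K \<longrightarrow> \<psi>M x = 0 \<and> \<psi>F x = 0)) \<and>
     (LINT x|lborel. \<psi>F x) = 1 \<and>
     (\<exists>N h. daubechies_filter N h \<and>
        (\<forall>x. \<psi>F x = sqrt 2 * (\<Sum>k\<in>{0..<2 * int N}. h k * \<psi>F (2 * x - of_int k))) \<and>
        (\<forall>x. \<psi>M x = sqrt 2 * (\<Sum>k\<in>{0..<2 * int N}.
           (if even k then 1 else - 1) * h (2 * int N - 1 - k) * \<psi>F (2 * x - of_int k))))"

datatype gender = Mother | Father

definition gender_set :: "nat \<Rightarrow> (gender^'n) set" where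
  "gender_set j = (if j = 0 then UNIV else UNIV - {\<chi> i. Father})"

definition tensor_wavelet ::
    "(real \<Rightarrow> real) \<Rightarrow> (real \<Rightarrow> real) \<Rightarrow> gender^'n \<Rightarrow> real^'n \<Rightarrow> real" where
  "tensor_wavelet \<psi>M \<psi>F G x =
     (\<Prod>i\<in>UNIV. (case G $ i of Mother \<Rightarrow> \<psi>M | Father \<Rightarrow> \<psi>F) (x $ i))"

definition wavelet ::
    "(real \<Rightarrow> real) \<Rightarrow> (real \<Rightarrow> real) \<Rightarrow> nat \<Rightarrow> gender^'n \<Rightarrow> int^'n \<Rightarrow> real^'n \<Rightarrow> real" where
  "wavelet \<psi>M \<psi>F j G k x =
     2 powr (real (j * CARD('n)) / 2) *
     tensor_wavelet \<psi>M \<psi>F G (2 ^ j *\<^sub>R x - (\<chi> i. of_int (k $ i)))"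

end

theory Submission
  imports Defs
begin

text \<open>
  Write \<open>\<langle>w, \<phi>\<rangle>\<close> for the noise tested against \<open>\<phi>\<close>. Testing against a smooth bump \<open>\<chi>\<close> and against its
  rescaling \<open>\<chi>(2\<^sup>p x)\<close> gives laws whose Levy exponents differ by the factor \<open>N = 2\<^bsup>p d\<^esup>\<close>, so the first law is
  the \<open>N\<close>-fold convolution power of the second. For the symmetrised variable \<open>X - X'\<close> all moments are
  nonnegative and the odd ones vanish, so the exponential moment generating series is multiplicative
  with nonnegative coefficients. Its coefficients are therefore superadditive under convolution
  powers, which bounds the \<open>2m\<close>-th moment at scale \<open>p\<close> by \<open>O(1 / N)\<close>; means are additive and scale
  alike. Since the integer translates of \<open>\<chi>\<close> form a partition of unity, a wavelet at scale \<open>j\<close> is an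
  \<open>L\<^sub>2\<close> limit of combinations of \<open>O(2\<^bsup>n d\<^esup>)\<close> bumps at scale \<open>n + j\<close>, which split into \<open>2\<^sup>d\<close> classes of bumps with
  disjoint supports, hence into independent summands. This gives the moment bound for the
  approximations, and Fatou's lemma transfers it to the limit. No moments of the Levy measure are
  needed: its only role is to make the Levy exponent continuous with quadratic growth, so that the
  limit in probability exists.
\<close>

section \<open>Smooth bumps and partitions of unity\<close>

text \<open>Fatou's lemma is applied as the refinement level \<open>n\<close> tends to infinity, so
  the bound must be uniform in \<open>n\<close>. Estimating bumps one at a time would leave the
  mixed products of their moments uncontrolled, so a sum over \<open>A\<close> is treated as a
  whole. Take J = 2^(j d) independent copies of a combination of \<open>card A\<close> independent
  bumps at scale p = n + j, with coefficients in [-1,1]. Its symmetrised series is dominated,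
  coefficient by coefficient, by a fixed power K of the series at scale 0, because card A * J \<le>
  K * 2^(p d). Superadditivity then divides the coefficient of index 2m by J, and n has disappeared.
  The amplitude 2^(j d / 2) of a wavelet contributes 2^(j d m) to the moment of order 2m, and the
  gain 1 / J leaves the exponent j d (m - 1). Bumps are used because finiteness of moments is
  assumed for test functions, which wavelets are not, and because all bumps of one scale share one
  law. Dyadic scales make the ratio N of the Levy exponents an integer.\<close>

primrec times_diff :: "nat \<Rightarrow> (real \<Rightarrow> real) \<Rightarrow> bool" where
  "times_diff 0 f \<longleftrightarrow> True"
| "times_diff (Suc n) f \<longleftrightarrow> (\<exists>f'. (\<forall>x. (f has_real_derivative f' x) (at x)) \<and> times_diff n f')"

lemma times_diff_SucI:
  "(\<And>x. (f has_real_derivative f' x) (at x)) \<Longrightarrow> times_diff n f' \<Longrightarrow> times_diff (Suc n) f"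
  by auto

text \<open>The derivatives of a product and of a reciprocal contain undifferentiated factors, so
  the inductions below also need the lower order for the functions themselves.\<close>

lemma times_diff_Suc_imp: "times_diff (Suc n) f \<Longrightarrow> times_diff n f"
proof (induction n arbitrary: f)
  case (Suc n)
  then obtain f' where f': "\<And>x. (f has_real_derivative f' x) (at x)" "times_diff (Suc n) f'"
    by auto
  then show ?case using Suc.IH[of f'] by auto
qed simp

lemma times_diff_const: "times_diff n (\<lambda>x. c)"
proof (induction n arbitrary: c)
  case (Suc n)
  show ?case by (rule times_diff_SucI[where f' = "\<lambda>x. 0"]) (use Suc in auto)
qed simp

lemma times_diff_add:
  "times_diff n f \<Longrightarrow> times_diff n g \<Longrightarrow> times_diff n (\<lambda>x. f x + g x)"
proof (induction n arbitrary: f g)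
  case (Suc n)
  then obtain f' g' where "\<And>x. (f has_real_derivative f' x) (at x)" "times_diff n f'"
    "\<And>x. (g has_real_derivative g' x) (at x)" "times_diff n g'" by auto
  then show ?case
    using Suc.IH by (intro times_diff_SucI[where f' = "\<lambda>x. f' x + g' x"]) (auto intro: DERIV_add)
qed simp

lemma times_diff_mult:
  "times_diff n f \<Longrightarrow> times_diff n g \<Longrightarrow> times_diff n (\<lambda>x. f x * g x)"
proof (induction n arbitrary: f g)
  case (Suc n)
  then obtain f' g' where *: "\<And>x. (f has_real_derivative f' x) (at x)" "times_diff n f'"
    "\<And>x. (g has_real_derivative g' x) (at x)" "times_diff n g'" by auto
  have "times_diff n f" "times_diff n g" using Suc.prems by (blast intro: times_diff_Suc_imp)+
  with * show ?case
    using Suc.IH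
    by (intro times_diff_SucI[where f' = "\<lambda>x. f' x * g x + f x * g' x"] times_diff_add)
       (auto intro!: derivative_eq_intros)
qed simp

lemma times_diff_inverse:
  "times_diff n f \<Longrightarrow> (\<And>x. f x \<noteq> 0) \<Longrightarrow> times_diff n (\<lambda>x. inverse (f x))"
proof (induction n)
  case (Suc n)
  then obtain f' where *: "\<And>x. (f has_real_derivative f' x) (at x)" "times_diff n f'" by auto
  have i: "times_diff n (\<lambda>x. inverse (f x))" using Suc by (blast intro: times_diff_Suc_imp)
  have "times_diff n (\<lambda>x. (- 1) * (inverse (f x) * f' x * inverse (f x)))"
    by (intro times_diff_mult times_diff_const i *)
  moreover have "((\<lambda>x. inverse (f x)) has_real_derivative (- 1) * (inverse (f x) * f' x * inverse (f x))) (at x)" for x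
    using *(1) Suc.prems(2) by (auto intro!: derivative_eq_intros)
  ultimately show ?case by (rule times_diff_SucI[rotated])
qed simp

lemma times_diff_affine: "times_diff n f \<Longrightarrow> times_diff n (\<lambda>x. f (a * x + b))"
proof (induction n arbitrary: f)
  case (Suc n)
  then obtain f' where *: "\<And>x. (f has_real_derivative f' x) (at x)" "times_diff n f'" by auto
  have d: "((\<lambda>x. f (a * x + b)) has_real_derivative a * f' (a * x + b)) (at x)" for x
  proof -
    have "((\<lambda>x. a * x + b) has_real_derivative a) (at x)"
      by (auto intro!: derivative_eq_intros)
    from DERIV_chain2[OF *(1) this] show ?thesis by (simp add: mult.commute)
  qed
  show ?case
    by (rule times_diff_SucI[OF d]) (use * Suc.IH in \<open>auto intro!: times_diff_mult times_diff_const\<close>)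
qed simp

text \<open>The powers of \<open>1 / x\<close> make the family closed under differentiation, up to linear
  combinations.\<close>

definition flat_exp :: "nat \<Rightarrow> real \<Rightarrow> real" where
  "flat_exp k x = (if 0 < x then (1 / x) ^ k * exp (- (1 / x)) else 0)"

lemma flat_exp_tendsto_0: "(flat_exp k \<longlongrightarrow> 0) (at 0)"
proof -
  have "((\<lambda>x::real. (1 / x) ^ k / exp (1 / x)) \<longlongrightarrow> 0) (at_right 0)"
    using filterlim_compose[OF tendsto_power_div_exp_0[of k] filterlim_inverse_at_top_right]
    by (simp add: inverse_eq_divide)
  then have "(flat_exp k \<longlongrightarrow> 0) (at_right 0)"
    by (rule Lim_transform_eventually)
       (auto simp: flat_exp_def exp_minus field_simps eventually_at_filter)
  moreover have "(flat_exp k \<longlongrightarrow> 0) (at_left 0)"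
    by (rule Lim_transform_eventually[where f = "\<lambda>_. 0"])
       (auto simp: flat_exp_def eventually_at_filter)
  ultimately show ?thesis by (simp add: filterlim_split_at)
qed

lemma flat_exp_deriv:
  "(flat_exp k has_real_derivative (flat_exp (k + 2) x - real k * flat_exp (k + 1) x)) (at x)"
proof (cases "x = 0")
  case True
  \<comment> \<open>Dividing by \<open>h\<close> raises the index: off 0 the difference quotient at
    0 is \<open>flat_exp (Suc k)\<close>, which tends to 0.\<close>
  have "((\<lambda>h. (flat_exp k (0 + h) - flat_exp k 0) / h) \<longlongrightarrow> 0) (at 0)"
    by (rule Lim_transform_eventually[OF flat_exp_tendsto_0[of "Suc k"]])
       (auto simp: flat_exp_def eventually_at_filter)
  then show ?thesis using True by (simp add: DERIV_def flat_exp_def)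
next
  case False
  show ?thesis
  proof (cases "0 < x")
    case True
    have "((\<lambda>x. (1 / x) ^ k * exp (- (1 / x))) has_real_derivative
       (1 / x) ^ k * (exp (- (1 / x)) * (1 / x\<^sup>2)) + (real k * (1 / x) ^ (k - 1) * (- (1 / x\<^sup>2))) * exp (- (1 / x))) (at x)"
      using True by (auto intro!: derivative_eq_intros simp: power2_eq_square)
    also have "(1 / x) ^ k * (exp (- (1 / x)) * (1 / x\<^sup>2)) + (real k * (1 / x) ^ (k - 1) * (- (1 / x\<^sup>2))) * exp (- (1 / x))
      = flat_exp (k + 2) x - real k * flat_exp (k + 1) x"
      using True by (cases k) (auto simp: flat_exp_def power2_eq_square)
    finally show ?thesis
      by (rule has_field_derivative_transform_within_open[where S = "{0<..}"])
         (use True in \<open>auto simp: flat_exp_def\<close>)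
  next
    case f: False
    have "((\<lambda>x. 0) has_real_derivative (flat_exp (k + 2) x - real k * flat_exp (k + 1) x)) (at x)"
      using f by (auto simp: flat_exp_def)
    then show ?thesis
      by (rule has_field_derivative_transform_within_open[where S = "{..<0}"])
         (use f \<open>x \<noteq> 0\<close> in \<open>auto simp: flat_exp_def\<close>)
  qed
qed

lemma times_diff_flat_exp: "times_diff n (flat_exp k)"
proof (induction n arbitrary: k)
  case (Suc n)
  have "times_diff n (\<lambda>x. flat_exp (k + 2) x + (- real k) * flat_exp (k + 1) x)"
    by (intro times_diff_add times_diff_mult times_diff_const Suc)
  then show ?case
    by (intro times_diff_SucI[OF flat_exp_deriv]) simp
qed simp

section \<open>A smooth transition function and a telescoping partition of unity\<close>

definition smooth_step :: "real \<Rightarrow> real" where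
  "smooth_step x = flat_exp 0 x * inverse (flat_exp 0 x + flat_exp 0 (1 - x))"

lemma flat_exp_nonneg: "0 \<le> flat_exp k x"
  by (simp add: flat_exp_def)

lemma smooth_step_denominator_pos: "0 < flat_exp 0 x + flat_exp 0 (1 - x)"
  by (cases "0 < x") (auto simp: flat_exp_def intro: add_pos_nonneg)

lemma smooth_step_bounds: "0 \<le> smooth_step x" "smooth_step x \<le> 1"
  using flat_exp_nonneg[of 0 x] flat_exp_nonneg[of 0 "1 - x"] smooth_step_denominator_pos[of x]
  by (auto simp: smooth_step_def field_simps)

lemma smooth_step_le_0: "x \<le> 0 \<Longrightarrow> smooth_step x = 0"
  by (simp add: smooth_step_def flat_exp_def)

lemma smooth_step_ge_1: "1 \<le> x \<Longrightarrow> smooth_step x = 1"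
  by (simp add: smooth_step_def flat_exp_def)

lemma times_diff_smooth_step: "times_diff n smooth_step"
proof -
  have "times_diff n (\<lambda>x. flat_exp 0 (1 - x))"
    using times_diff_affine[OF times_diff_flat_exp[of n 0], of "-1" 1] by simp
  then show ?thesis
    unfolding smooth_step_def
    by (intro times_diff_mult times_diff_inverse times_diff_add times_diff_flat_exp)
       (use smooth_step_denominator_pos in \<open>auto simp: less_imp_neq[symmetric]\<close>)
qed

text \<open>A difference of two consecutive translates of the step, so that sums over integer
  translates telescope.\<close>

definition hat :: "real \<Rightarrow> real" where
  "hat x = smooth_step (x + 1) - smooth_step x"

text \<open>At every point one of the two steps has an extreme value: the subtracted one is 0 for x
  \<le> 0, the other is 1 for x > 0.\<close>

lemma hat_nonneg: "0 \<le> hat x"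
proof (cases "x \<le> 0")
  case True
  then show ?thesis by (simp add: hat_def smooth_step_le_0 smooth_step_bounds)
next
  case False
  then show ?thesis by (simp add: hat_def smooth_step_ge_1 smooth_step_bounds)
qed

lemma hat_eq_0: "1 \<le> \<bar>x\<bar> \<Longrightarrow> hat x = 0"
  by (cases "0 \<le> x") (auto simp: hat_def smooth_step_ge_1 smooth_step_le_0)

lemma times_diff_hat: "times_diff n hat"
  using times_diff_add[OF times_diff_affine[OF times_diff_smooth_step[of n], of 1 1]
      times_diff_mult[OF times_diff_const[of n "-1"] times_diff_smooth_step]]
  by (simp add: hat_def[abs_def])

text \<open>Telescoping over the finite range leaves
  \<open>smooth_step (t + L + 1) - smooth_step (t - L)\<close>, which is 1 - 0 for \<bar>t\<bar>
  \<le> L.\<close>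

lemma hat_partition_of_unity:
  fixes L :: int and t :: real
  assumes "\<bar>t\<bar> \<le> L"
  shows "(\<Sum>l\<in>{-L..L}. hat (t - of_int l)) = 1"
proof -
  have *: "(\<Sum>l\<in>{-L..-L + int n}. hat (t - of_int l)) = smooth_step (t + L + 1) - smooth_step (t + L - real n)" for n
  proof (induction n)
    case (Suc n)
    have "{-L..-L + int (Suc n)} = insert (-L + int (Suc n)) {-L..-L + int n}" by auto
    then show ?case using Suc by (simp add: hat_def algebra_simps)
  qed (simp add: hat_def algebra_simps)
  have "L \<ge> 0" using assms by linarith
  then show ?thesis
    using *[of "nat (2 * L)"] assms by (simp add: smooth_step_le_0 smooth_step_ge_1)
qed

section \<open>Tensor products of smooth functions as test functions\<close>

lemma times_diff_deriv: "times_diff (Suc n) f \<Longrightarrow> times_diff n (deriv f)"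
  by (metis DERIV_imp_deriv ext times_diff.simps(2))

lemma times_diff_has_derivative:
  assumes "\<And>n. times_diff n f"
  shows "((deriv ^^ k) f has_real_derivative (deriv ^^ Suc k) f x) (at x)"
proof -
  have "times_diff n ((deriv ^^ k) f)" for n k
    by (induction k arbitrary: n) (auto intro: assms times_diff_deriv simp del: times_diff.simps)
  from this[of "Suc 0" k] obtain f' where "\<And>x. ((deriv ^^ k) f has_real_derivative f' x) (at x)"
    by auto
  then show ?thesis by (metis DERIV_imp_deriv funpow.simps(2) o_apply)
qed

text \<open>A partial derivative acts on a single factor, so only the number of occurrences of each
  index in the list matters. In the direction \<open>axis k 1\<close> the product rule keeps just
  the summand of coordinate k.\<close>

lemma iter_partial_tensor:
  fixes g :: "'n::finite \<Rightarrow> real \<Rightarrow> real"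
  assumes g: "\<And>i n. times_diff n (g i)"
  shows "iter_partial is (\<lambda>x. \<Prod>i\<in>UNIV. g i (x $ i)) =
    (\<lambda>x. \<Prod>i\<in>UNIV. (deriv ^^ count_list is i) (g i) (x $ i))"
    and tensor_differentiable:
      "iter_partial is (\<lambda>x. \<Prod>i\<in>UNIV. g i (x $ i)) differentiable (at x)"
proof -
  have D: "((\<lambda>x. \<Prod>i\<in>UNIV. (deriv ^^ c i) (g i) (x $ i)) has_derivative
     (\<lambda>y. \<Sum>i\<in>UNIV. ((deriv ^^ Suc (c i)) (g i) (x $ i) * y $ i) * (\<Prod>j\<in>UNIV - {i}. (deriv ^^ c j) (g j) (x $ j)))) (at x)"
    for c :: "'n \<Rightarrow> nat" and x
  proof (rule has_derivative_prod)
    fix i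
    have "((deriv ^^ c i) (g i) has_derivative (\<lambda>y. (deriv ^^ Suc (c i)) (g i) (x $ i) * y)) (at (x $ i))"
      using times_diff_has_derivative[of "g i" "c i" "x $ i"] g by (auto simp: has_field_derivative_def)
    from has_derivative_compose[of "\<lambda>x. x $ i" "\<lambda>x. x $ i" x UNIV, OF _ this]
    show "((\<lambda>x. (deriv ^^ c i) (g i) (x $ i)) has_derivative (\<lambda>y. (deriv ^^ Suc (c i)) (g i) (x $ i) * y $ i)) (at x)"
      by (simp add: bounded_linear_imp_has_derivative bounded_linear_vec_nth)
  qed
  show *: "iter_partial is (\<lambda>x. \<Prod>i\<in>UNIV. g i (x $ i)) =
    (\<lambda>x. \<Prod>i\<in>UNIV. (deriv ^^ count_list is i) (g i) (x $ i))" for "is"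
  proof (induction "is")
    case (Cons k "is")
    show ?case
    proof
      fix x
      have "iter_partial (k # is) (\<lambda>x. \<Prod>i\<in>UNIV. g i (x $ i)) x =
        (\<Sum>i\<in>UNIV. ((deriv ^^ Suc (count_list is i)) (g i) (x $ i) * axis k 1 $ i)
          * (\<Prod>j\<in>UNIV - {i}. (deriv ^^ count_list is j) (g j) (x $ j)))"
        by (simp only: iter_partial.simps Cons partial_deriv_def frechet_derivative_at[OF D, symmetric])
      also have "\<dots> = (\<Sum>i\<in>{k}. (deriv ^^ Suc (count_list is i)) (g i) (x $ i)
          * (\<Prod>j\<in>UNIV - {i}. (deriv ^^ count_list is j) (g j) (x $ j)))"
        by (rule sum.mono_neutral_cong_right) (auto simp: axis_def)
      also have "\<dots> = (deriv ^^ count_list (k # is) k) (g k) (x $ k) *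
          (\<Prod>j\<in>UNIV - {k}. (deriv ^^ count_list (k # is) j) (g j) (x $ j))"
        by (auto intro!: prod.cong)
      also have "\<dots> = (\<Prod>i\<in>UNIV. (deriv ^^ count_list (k # is) i) (g i) (x $ i))"
        by (subst prod.remove[of UNIV k]) auto
      finally show "iter_partial (k # is) (\<lambda>x. \<Prod>i\<in>UNIV. g i (x $ i)) x = \<dots>" .
    qed
  qed simp
  show "iter_partial is (\<lambda>x. \<Prod>i\<in>UNIV. g i (x $ i)) differentiable (at x)"
    unfolding * using D by (auto simp: differentiable_def)
qed

lemma deriv_eq_0_outside:
  fixes f :: "real \<Rightarrow> real"
  assumes "\<And>x. R < \<bar>x\<bar> \<Longrightarrow> f x = 0" "R < \<bar>x\<bar>"
  shows "(deriv ^^ k) f x = 0"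
  using assms(2)
proof (induction k arbitrary: x)
  case (Suc k)
  have "((deriv ^^ k) f has_real_derivative 0) (at x)"
    by (rule has_field_derivative_transform_within_open[where f = "\<lambda>_. 0" and S = "- {-R..R}"])
       (use Suc in \<open>auto simp: abs_real_def split: if_splits\<close>)
  then show ?case by (simp add: DERIV_imp_deriv)
qed (use assms in auto)

lemma tensor_schwartz:
  fixes g :: "'n::finite \<Rightarrow> real \<Rightarrow> real"
  assumes g: "\<And>i n. times_diff n (g i)" and R: "\<And>i x. R < \<bar>x\<bar> \<Longrightarrow> g i x = 0"
  shows "smooth_fun (\<lambda>x. \<Prod>i\<in>UNIV. g i (x $ i))" "rapidly_decaying (\<lambda>x. \<Prod>i\<in>UNIV. g i (x $ i))"
proof -
  let ?f = "\<lambda>x. \<Prod>i\<in>UNIV. g i (x $ i)"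
  show "smooth_fun ?f" using tensor_differentiable[of g] g by (auto simp: smooth_fun_def)
  show "rapidly_decaying ?f"
    unfolding rapidly_decaying_def
  proof (intro allI)
    fix N "is"
    let ?h = "\<lambda>x::real^'n. (1 + norm x) ^ N * iter_partial is ?f x"
    let ?K = "cbox (\<chi> i. -R) (\<chi> i. R) :: (real^'n) set"
    have z: "?h x = 0" if "x \<notin> ?K" for x
    proof -
      have "\<exists>i. \<not> (- R \<le> x $ i \<and> x $ i \<le> R)"
        using that by (auto simp: mem_box_cart)
      then obtain i where "\<not> (- R \<le> x $ i \<and> x $ i \<le> R)" by blast
      then have "R < \<bar>x $ i\<bar>" by linarith
      then have "(deriv ^^ count_list is i) (g i) (x $ i) = 0"
        using deriv_eq_0_outside[of R "g i"] R by auto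
      then show ?thesis by (auto simp: iter_partial_tensor[of g, OF g] intro!: bexI[of _ i])
    qed
    have "iter_partial is ?f differentiable (at x)" for x
      using tensor_differentiable[of g, OF g] by auto
    then have "continuous_on ?K (iter_partial is ?f)"
      by (intro continuous_at_imp_continuous_on ballI differentiable_imp_continuous_within)
    then have "continuous_on ?K ?h"
      by (intro continuous_intros)
    then have "bounded (?h ` ?K)" by (intro compact_imp_bounded compact_continuous_image compact_cbox)
    moreover have "range ?h \<subseteq> insert 0 (?h ` ?K)" using z by blast
    ultimately show "bounded (range ?h)" by (meson bounded_insert bounded_subset)
  qed
qed

section \<open>Moment generating series\<close>

definition has_all_moments :: "real measure \<Rightarrow> bool" where
  "has_all_moments \<mu> \<longleftrightarrow> real_distribution \<mu> \<and> (\<forall>j. integrable \<mu> (\<lambda>x. x ^ j))"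

text \<open>The moment generating function as a formal series: all moments are finite, but the
  series need not converge anywhere except at 0.\<close>

definition moment_fps :: "real measure \<Rightarrow> real fps" where
  "moment_fps \<mu> = Abs_fps (\<lambda>j. (\<integral>x. x ^ j \<partial>\<mu>) / fact j)"

section \<open>Moment series of convolutions\<close>

lemma integral_pair_product:
  fixes f :: "'a \<Rightarrow> 'c::{real_normed_field, banach, second_countable_topology}"
  assumes "sigma_finite_measure M" "sigma_finite_measure N" and f: "integrable M f" and g: "integrable N g"
  shows "integrable (M \<Otimes>\<^sub>M N) (\<lambda>(x, y). f x * g y)"
    and "(\<integral>(x, y). f x * g y \<partial>(M \<Otimes>\<^sub>M N)) = (\<integral>x. f x \<partial>M) * (\<integral>y. g y \<partial>N)"
proof -
  interpret M: sigma_finite_measure M by fact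
  interpret N: sigma_finite_measure N by fact
  interpret pair_sigma_finite M N ..
  have [measurable]: "f \<in> borel_measurable M" "g \<in> borel_measurable N" using f g by auto
  show *: "integrable (M \<Otimes>\<^sub>M N) (\<lambda>(x, y). f x * g y)"
  proof (rule Fubini_integrable)
    show "integrable M (\<lambda>x. \<integral>y. norm (case (x, y) of (x, y) \<Rightarrow> f x * g y) \<partial>N)"
      using f g by (simp add: norm_mult)
    show "AE x in M. integrable N (\<lambda>y. case (x, y) of (x, y) \<Rightarrow> f x * g y)"
      using g by auto
  qed measurable
  show "(\<integral>(x, y). f x * g y \<partial>(M \<Otimes>\<^sub>M N)) = (\<integral>x. f x \<partial>M) * (\<integral>y. g y \<partial>N)"
    using integral_fst'[OF *] f g by simp
qed

lemma real_distribution_convolution: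
  assumes "real_distribution \<mu>" "real_distribution \<nu>"
  shows "real_distribution (\<mu> \<star> \<nu>)"
proof -
  interpret \<mu>: real_distribution \<mu> by fact
  interpret \<nu>: real_distribution \<nu> by fact
  interpret pair_prob_space \<mu> \<nu> ..
  show ?thesis
    unfolding real_distribution_def real_distribution_axioms_def convolution_def
    by (auto intro!: P.prob_space_distr)
qed

lemma integral_convolution:
  fixes f :: "real \<Rightarrow> 'c::{banach, second_countable_topology}"
  assumes "real_distribution \<mu>" "real_distribution \<nu>" and [measurable]: "f \<in> borel_measurable borel"
  shows "(\<integral>x. f x \<partial>(\<mu> \<star> \<nu>)) = (\<integral>(x, y). f (x + y) \<partial>(\<mu> \<Otimes>\<^sub>M \<nu>))"
    and "integrable (\<mu> \<star> \<nu>) f \<longleftrightarrow> integrable (\<mu> \<Otimes>\<^sub>M \<nu>) (\<lambda>(x, y). f (x + y))"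
proof -
  interpret \<mu>: real_distribution \<mu> by fact
  interpret \<nu>: real_distribution \<nu> by fact
  show "(\<integral>x. f x \<partial>(\<mu> \<star> \<nu>)) = (\<integral>(x, y). f (x + y) \<partial>(\<mu> \<Otimes>\<^sub>M \<nu>))"
    unfolding convolution_def by (subst integral_distr) (auto simp: case_prod_beta')
  show "integrable (\<mu> \<star> \<nu>) f \<longleftrightarrow> integrable (\<mu> \<Otimes>\<^sub>M \<nu>) (\<lambda>(x, y). f (x + y))"
    unfolding convolution_def by (subst integrable_distr_eq) (auto simp: case_prod_beta')
qed

lemma char_convolution:
  assumes "real_distribution \<mu>" "real_distribution \<nu>"
  shows "char (\<mu> \<star> \<nu>) t = char \<mu> t * char \<nu> t"
proof -
  interpret \<mu>: real_distribution \<mu> by fact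
  interpret \<nu>: real_distribution \<nu> by fact
  have "integrable \<mu> (\<lambda>x. iexp (t * x))" "integrable \<nu> (\<lambda>x. iexp (t * x))"
    by (auto intro!: \<mu>.integrable_iexp \<nu>.integrable_iexp)
  from integral_pair_product(2)[OF \<mu>.sigma_finite_measure \<nu>.sigma_finite_measure this]
  show ?thesis
    unfolding char_def
    by (subst integral_convolution[OF assms]) (simp_all add: distrib_left exp_add)
qed

text \<open>Two values of \<open>c\<close> are used: 1 for convolutions and -1 for the difference of
  independent copies.\<close>

lemma integral_pair_binomial:
  assumes "has_all_moments \<mu>" "has_all_moments \<nu>"
  shows "integrable (\<mu> \<Otimes>\<^sub>M \<nu>) (\<lambda>(x, y). (x + c * y) ^ j)"
    and "(\<integral>(x, y). (x + c * y) ^ j \<partial>(\<mu> \<Otimes>\<^sub>M \<nu>)) =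
      (\<Sum>i\<le>j. real (j choose i) * ((\<integral>x. x ^ i \<partial>\<mu>) * (c ^ (j - i) * (\<integral>y. y ^ (j - i) \<partial>\<nu>))))"
proof -
  interpret \<mu>: real_distribution \<mu> using assms by (simp add: has_all_moments_def)
  interpret \<nu>: real_distribution \<nu> using assms by (simp add: has_all_moments_def)
  note * = integral_pair_product[OF \<mu>.sigma_finite_measure \<nu>.sigma_finite_measure,
    of "\<lambda>x. x ^ i" "\<lambda>y. c ^ k * y ^ k" for i k]
  have int: "integrable \<mu> (\<lambda>x. x ^ i)" "integrable \<nu> (\<lambda>x. c ^ i * x ^ i)" for i
    using assms by (auto simp: has_all_moments_def)
  have eq: "(\<lambda>(x, y). (x + c * y) ^ j) = (\<lambda>z. \<Sum>i\<le>j. real (j choose i) * (case z of (x, y) \<Rightarrow> x ^ i * (c ^ (j - i) * y ^ (j - i))))"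
    by (auto simp: binomial_ring power_mult_distrib mult_ac)
  show "integrable (\<mu> \<Otimes>\<^sub>M \<nu>) (\<lambda>(x, y). (x + c * y) ^ j)"
    unfolding eq by (intro Bochner_Integration.integrable_sum integrable_mult_right *(1) int)
  show "(\<integral>(x, y). (x + c * y) ^ j \<partial>(\<mu> \<Otimes>\<^sub>M \<nu>)) =
      (\<Sum>i\<le>j. real (j choose i) * ((\<integral>x. x ^ i \<partial>\<mu>) * (c ^ (j - i) * (\<integral>y. y ^ (j - i) \<partial>\<nu>))))"
    unfolding eq
    by (subst Bochner_Integration.integral_sum)
       (auto intro!: sum.cong integrable_mult_right *(1) int simp: *(2)[OF int])
qed

text \<open>Division by factorials turns the binomial formula for the moments of a sum into a Cauchy
  product.\<close>

lemma moment_fps_convolution: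
  assumes "has_all_moments \<mu>" "has_all_moments \<nu>"
  shows "has_all_moments (\<mu> \<star> \<nu>)" "moment_fps (\<mu> \<star> \<nu>) = moment_fps \<mu> * moment_fps \<nu>"
proof -
  have rd: "real_distribution \<mu>" "real_distribution \<nu>" using assms by (simp_all add: has_all_moments_def)
  show "has_all_moments (\<mu> \<star> \<nu>)"
    using integral_pair_binomial(1)[OF assms, of 1]
    by (simp add: has_all_moments_def real_distribution_convolution rd integral_convolution(2)[OF rd])
  show "moment_fps (\<mu> \<star> \<nu>) = moment_fps \<mu> * moment_fps \<nu>"
  proof (rule fps_ext)
    fix j
    have "(\<integral>x. x ^ j \<partial>(\<mu> \<star> \<nu>)) / fact j =
       (\<Sum>i\<le>j. real (j choose i) * ((\<integral>x. x ^ i \<partial>\<mu>) * (\<integral>y. y ^ (j - i) \<partial>\<nu>)) / fact j)"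
      using integral_pair_binomial(2)[OF assms, of 1 j]
      by (simp add: integral_convolution(1)[OF rd] sum_divide_distrib)
    also have "\<dots> = (\<Sum>i\<le>j. (\<integral>x. x ^ i \<partial>\<mu>) / fact i * ((\<integral>y. y ^ (j - i) \<partial>\<nu>) / fact (j - i)))"
      by (rule sum.cong) (auto simp: binomial_fact)
    finally show "fps_nth (moment_fps (\<mu> \<star> \<nu>)) j = fps_nth (moment_fps \<mu> * moment_fps \<nu>) j"
      by (simp add: moment_fps_def fps_mult_nth atLeast0AtMost)
  qed
qed

text \<open>Independence is expressed by a product of characteristic functions. An iterated
  convolution has this product as its characteristic function, so it equals \<mu> by Levy
  uniqueness, and joint laws never have to be considered.\<close>

lemma moment_fps_char_prod:
  assumes \<mu>: "real_distribution \<mu>" and fin: "finite I" and \<nu>: "\<And>k. k \<in> I \<Longrightarrow> has_all_moments (\<nu> k)"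
    and char: "\<And>t. char \<mu> t = (\<Prod>k\<in>I. char (\<nu> k) t)"
  shows "has_all_moments \<mu>" "moment_fps \<mu> = (\<Prod>k\<in>I. moment_fps (\<nu> k))"
proof -
  have "\<exists>\<rho>. has_all_moments \<rho> \<and> (\<forall>t. char \<rho> t = (\<Prod>k\<in>I. char (\<nu> k) t)) \<and>
      moment_fps \<rho> = (\<Prod>k\<in>I. moment_fps (\<nu> k))"
    using fin \<nu>
  proof (induction I)
    case empty
    \<comment> \<open>The unit mass at 0 is the neutral element of convolution.\<close>
    interpret prob_space "return borel (0::real)" by (rule prob_space_return) simp
    have "real_distribution (return borel (0::real))"
      by (intro real_distribution.intro real_distribution_axioms.intro) (auto intro: prob_space_axioms)
    moreover have "integrable (return borel (0::real)) (\<lambda>x. x ^ j)" for j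
      by (intro integrableI_bounded) (auto simp: nn_integral_return)
    moreover have "moment_fps (return borel 0) = 1"
      by (rule fps_ext) (auto simp: moment_fps_def integral_return power_0_left)
    ultimately show ?case
      by (intro exI[of _ "return borel 0"]) (auto simp: has_all_moments_def char_def integral_return)
  next
    case (insert k I)
    then obtain \<rho> where \<rho>: "has_all_moments \<rho>" "\<And>t. char \<rho> t = (\<Prod>k\<in>I. char (\<nu> k) t)"
      "moment_fps \<rho> = (\<Prod>k\<in>I. moment_fps (\<nu> k))" by auto
    have k: "has_all_moments (\<nu> k)" using insert by simp
    have "char (\<nu> k \<star> \<rho>) t = (\<Prod>k\<in>insert k I. char (\<nu> k) t)" for t
      using \<rho> k insert by (subst char_convolution) (auto simp: has_all_moments_def)
    moreover have "moment_fps (\<nu> k \<star> \<rho>) = (\<Prod>k\<in>insert k I. moment_fps (\<nu> k))"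
      using \<rho> k insert by (simp add: moment_fps_convolution)
    ultimately show ?case using moment_fps_convolution(1)[OF k \<rho>(1)] by blast
  qed
  then obtain \<rho> where \<rho>: "has_all_moments \<rho>" "\<And>t. char \<rho> t = (\<Prod>k\<in>I. char (\<nu> k) t)"
      "moment_fps \<rho> = (\<Prod>k\<in>I. moment_fps (\<nu> k))" by auto
  have "\<mu> = \<rho>"
    using \<mu> \<rho> char by (intro Levy_uniqueness) (auto simp: has_all_moments_def)
  with \<rho> show "has_all_moments \<mu>" "moment_fps \<mu> = (\<Prod>k\<in>I. moment_fps (\<nu> k))" by auto
qed

section \<open>Symmetrised moment series\<close>

abbreviation fps_reflect :: "real fps \<Rightarrow> real fps" where
  "fps_reflect f \<equiv> fps_compose f (fps_const (- 1) * fps_X)"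

text \<open>The exponential generating series of the moments of \<open>X - X'\<close>, for independent copies
  \<open>X\<close>, \<open>X'\<close> of a variable with law \<open>\<mu>\<close>.\<close>

definition sym_fps :: "real measure \<Rightarrow> real fps" where
  "sym_fps \<mu> = moment_fps \<mu> * fps_reflect (moment_fps \<mu>)"

lemma fps_reflect_nth: "fps_nth (fps_reflect f) n = (- 1) ^ n * fps_nth f n"
  by (simp only: fps_nth_compose_linear)

lemma sym_fps_nth:
  assumes "has_all_moments \<mu>"
  shows "fps_nth (sym_fps \<mu>) j = (\<integral>(x, y). (x - y) ^ j \<partial>(\<mu> \<Otimes>\<^sub>M \<mu>)) / fact j"
proof -
  have "(\<integral>(x, y). (x - y) ^ j \<partial>(\<mu> \<Otimes>\<^sub>M \<mu>)) / fact j =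
     (\<Sum>i\<le>j. real (j choose i) * ((\<integral>x. x ^ i \<partial>\<mu>) * ((- 1) ^ (j - i) * (\<integral>y. y ^ (j - i) \<partial>\<mu>))) / fact j)"
    using integral_pair_binomial(2)[OF assms assms, of "- 1" j] by (simp add: sum_divide_distrib)
  also have "\<dots> = (\<Sum>i\<le>j. (\<integral>x. x ^ i \<partial>\<mu>) / fact i * ((- 1) ^ (j - i) * ((\<integral>y. y ^ (j - i) \<partial>\<mu>) / fact (j - i))))"
    by (rule sum.cong) (auto simp: binomial_fact)
  finally show ?thesis
    by (simp add: sym_fps_def moment_fps_def fps_mult_nth fps_reflect_nth atLeast0AtMost del: mult_minus_left)
qed

text \<open>Reflection is an involution and multiplicative, so it merely swaps the two factors of
  the symmetrised series.\<close>

lemma sym_fps_nth_odd: "odd j \<Longrightarrow> fps_nth (sym_fps \<mu>) j = 0"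
proof -
  assume j: "odd j"
  have "fps_reflect (sym_fps \<mu>) = sym_fps \<mu>"
  proof -
    have "fps_reflect (fps_reflect f) = f" for f :: "real fps"
      by (rule fps_ext) (simp only: fps_reflect_nth mult.assoc[symmetric] power_mult_distrib[symmetric], simp)
    then show ?thesis
      unfolding sym_fps_def by (subst fps_compose_mult_distrib) (simp_all add: mult.commute)
  qed
  then have "(- 1) ^ j * fps_nth (sym_fps \<mu>) j = fps_nth (sym_fps \<mu>) j"
    by (metis fps_reflect_nth)
  then show ?thesis using j by simp
qed

lemma sym_fps_nonneg: "has_all_moments \<mu> \<Longrightarrow> 0 \<le> fps_nth (sym_fps \<mu>) j"
  by (cases "even j") (auto simp: sym_fps_nth_odd sym_fps_nth case_prod_beta
      intro!: divide_nonneg_nonneg integral_nonneg)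

lemma sym_fps_0:
  assumes "has_all_moments \<mu>"
  shows "fps_nth (sym_fps \<mu>) 0 = 1"
proof -
  interpret real_distribution \<mu> using assms by (simp add: has_all_moments_def)
  show ?thesis by (simp add: sym_fps_def moment_fps_def prob_space del: space_eq_univ)
qed

lemma sym_fps_char_prod:
  assumes "real_distribution \<mu>" "finite I" "\<And>k. k \<in> I \<Longrightarrow> has_all_moments (\<nu> k)"
    and "\<And>t. char \<mu> t = (\<Prod>k\<in>I. char (\<nu> k) t)"
  shows "sym_fps \<mu> = (\<Prod>k\<in>I. sym_fps (\<nu> k))"
  unfolding sym_fps_def
  by (subst moment_fps_char_prod[OF assms], assumption)+
     (simp add: fps_compose_prod_distrib prod.distrib)

lemma has_all_moments_scale:
  assumes "has_all_moments \<mu>"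
  shows "has_all_moments (distr \<mu> borel (\<lambda>x. c * x))"
    and "fps_nth (moment_fps (distr \<mu> borel (\<lambda>x. c * x))) j = c ^ j * fps_nth (moment_fps \<mu>) j"
    and "fps_nth (sym_fps (distr \<mu> borel (\<lambda>x. c * x))) j = c ^ j * fps_nth (sym_fps \<mu>) j"
proof -
  interpret real_distribution \<mu> using assms by (simp add: has_all_moments_def)
  show "has_all_moments (distr \<mu> borel (\<lambda>x. c * x))"
    using assms by (simp add: has_all_moments_def integrable_distr_eq power_mult_distrib)
  have *: "fps_nth (moment_fps (distr \<mu> borel (\<lambda>x. c * x))) j = c ^ j * fps_nth (moment_fps \<mu>) j" for j
    by (simp add: moment_fps_def integral_distr power_mult_distrib)
  then show "fps_nth (moment_fps (distr \<mu> borel (\<lambda>x. c * x))) j = c ^ j * fps_nth (moment_fps \<mu>) j" .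
  show "fps_nth (sym_fps (distr \<mu> borel (\<lambda>x. c * x))) j = c ^ j * fps_nth (sym_fps \<mu>) j"
    unfolding sym_fps_def fps_mult_nth fps_reflect_nth * sum_distrib_left
  proof (rule sum.cong[OF refl])
    fix i assume "i \<in> {0..j}"
    then have "c ^ j = c ^ i * c ^ (j - i)" by (simp add: power_add[symmetric])
    then show "c ^ i * fps_nth (moment_fps \<mu>) i * ((- 1) ^ (j - i) * (c ^ (j - i) * fps_nth (moment_fps \<mu>) (j - i))) =
      c ^ j * (fps_nth (moment_fps \<mu>) i * ((- 1) ^ (j - i) * fps_nth (moment_fps \<mu>) (j - i)))"
      by (simp only: mult_ac)
  qed
qed

lemma char_scale:
  assumes "real_distribution \<mu>"
  shows "char (distr \<mu> borel (\<lambda>x. c * x)) t = char \<mu> (c * t)"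
proof -
  interpret real_distribution \<mu> by fact
  show ?thesis by (simp add: char_def integral_distr mult_ac)
qed

text \<open>Odd coefficients vanish, and for even \<open>j\<close> the factor \<open>c ^ j\<close>
  lies in [0,1] whatever the sign of \<open>c\<close>. This disposes of the coefficients of a sum of
  bumps.\<close>

lemma sym_fps_scale_le:
  assumes "has_all_moments \<mu>" "\<bar>c\<bar> \<le> 1"
  shows "fps_nth (sym_fps (distr \<mu> borel (\<lambda>x. c * x))) j \<le> fps_nth (sym_fps \<mu>) j"
proof (cases "even j")
  case True
  have "c ^ j \<le> 1" using True assms(2) by (metis power_even_abs abs_ge_zero power_le_one)
  then have "c ^ j * fps_nth (sym_fps \<mu>) j \<le> 1 * fps_nth (sym_fps \<mu>) j"
    using sym_fps_nonneg[OF assms(1)] by (rule mult_right_mono)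
  then show ?thesis using assms by (simp add: has_all_moments_scale)
qed (simp add: sym_fps_nth_odd)

section \<open>Power series with nonnegative coefficients\<close>

lemma fps_mult_mono:
  fixes f g f' g' :: "real fps"
  assumes "\<And>j. 0 \<le> fps_nth f j" "\<And>j. 0 \<le> fps_nth g j"
    "\<And>j. fps_nth f j \<le> fps_nth f' j" "\<And>j. fps_nth g j \<le> fps_nth g' j"
  shows "0 \<le> fps_nth (f * g) j" "fps_nth (f * g) j \<le> fps_nth (f' * g') j"
proof -
  have "0 \<le> fps_nth f' j" for j using assms(1,3) order_trans by blast
  then show "0 \<le> fps_nth (f * g) j" "fps_nth (f * g) j \<le> fps_nth (f' * g') j"
    using assms unfolding fps_mult_nth by (auto intro!: sum_nonneg sum_mono mult_mono mult_nonneg_nonneg)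
qed

lemma fps_prod_le_power:
  fixes f :: "'k \<Rightarrow> real fps"
  assumes "finite I" "\<And>k j. k \<in> I \<Longrightarrow> 0 \<le> fps_nth (f k) j" "\<And>k j. k \<in> I \<Longrightarrow> fps_nth (f k) j \<le> fps_nth g j"
  shows "0 \<le> fps_nth (\<Prod>k\<in>I. f k) j \<and> fps_nth (\<Prod>k\<in>I. f k) j \<le> fps_nth (g ^ card I) j"
  using assms
proof (induction I arbitrary: j)
  case (insert k I)
  have "0 \<le> fps_nth (f k * (\<Prod>k\<in>I. f k)) j" "fps_nth (f k * (\<Prod>k\<in>I. f k)) j \<le> fps_nth (g * g ^ card I) j"
    using fps_mult_mono[of "f k" "\<Prod>k\<in>I. f k" g "g ^ card I" j] insert.IH insert.prems by auto
  then show ?case using insert by simp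
qed auto

text \<open>With constant term 1 and nonnegative coefficients, \<open>f\<close> dominates the series
  1, so a further factor \<open>f\<close> can only enlarge coefficients.\<close>

lemma fps_power_nonneg_mono:
  fixes f :: "real fps"
  assumes "\<And>j. 0 \<le> fps_nth f j" "fps_nth f 0 = 1"
  shows "0 \<le> fps_nth (f ^ n) j" "n \<le> n' \<Longrightarrow> fps_nth (f ^ n) j \<le> fps_nth (f ^ n') j"
proof -
  show nn: "0 \<le> fps_nth (f ^ n) j" for n j
    using fps_prod_le_power[of "{..<n}" "\<lambda>_. f" f j] assms by simp
  show "n \<le> n' \<Longrightarrow> fps_nth (f ^ n) j \<le> fps_nth (f ^ n') j"
  proof (induction n' rule: dec_induct)
    case (step n')
    have "fps_nth (f ^ n') j = fps_nth (1 * f ^ n') j" by simp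
    also have "\<dots> \<le> fps_nth (f * f ^ n') j"
    proof (rule fps_mult_mono(2))
      fix i show "fps_nth (1 :: real fps) i \<le> fps_nth f i" using assms by (cases i) auto
    qed (auto simp: nn)
    finally show ?case using step by simp
  qed simp
qed

text \<open>Only the two extreme terms i = 0 and i = j of the Cauchy product of \<open>f\<close> and
  \<open>f ^ n\<close> are kept; they are distinct because j \<ge> 1, and the rest is
  nonnegative.\<close>

lemma fps_power_superadditive:
  fixes f :: "real fps"
  assumes "\<And>j. 0 \<le> fps_nth f j" "fps_nth f 0 = 1" "1 \<le> j"
  shows "real n * fps_nth f j \<le> fps_nth (f ^ n) j"
proof (induction n)
  case (Suc n)
  have f0: "fps_nth (f ^ n) 0 = 1" using assms by (simp add: fps_nth_power_0)
  have "fps_nth f j + fps_nth (f ^ n) j = (\<Sum>i\<in>{0, j}. fps_nth f i * fps_nth (f ^ n) (j - i))"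
    using assms f0 by simp
  also have "\<dots> \<le> (\<Sum>i=0..j. fps_nth f i * fps_nth (f ^ n) (j - i))"
    using assms by (intro sum_mono2 mult_nonneg_nonneg fps_power_nonneg_mono) auto
  also have "\<dots> = fps_nth (f ^ Suc n) j" by (simp add: fps_mult_nth)
  finally show ?case using Suc by (simp add: algebra_simps)
qed (use assms in simp)

text \<open>A crude power mean inequality, obtained from the largest summand. The factor is
  \<open>card I ^ p\<close> instead of the optimal \<open>card I ^ (p - 1)\<close>, which only
  affects constants.\<close>

lemma power_sum_le:
  fixes a :: "'i \<Rightarrow> real"
  assumes "finite I" and p: "1 \<le> p"
  shows "\<bar>\<Sum>i\<in>I. a i\<bar> ^ p \<le> real (card I) ^ p * (\<Sum>i\<in>I. \<bar>a i\<bar> ^ p)"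
proof (cases "I = {}")
  case False
  define b where "b = Max ((\<lambda>i. \<bar>a i\<bar>) ` I)"
  have b: "\<bar>a i\<bar> \<le> b" if "i \<in> I" for i using that assms by (auto simp: b_def)
  have "b \<in> (\<lambda>i. \<bar>a i\<bar>) ` I" unfolding b_def using False assms by (intro Max_in) auto
  then obtain i where i: "i \<in> I" "b = \<bar>a i\<bar>" by auto
  have "\<bar>\<Sum>i\<in>I. a i\<bar> \<le> real (card I) * b"
    using order_trans[OF sum_abs[of a I] sum_bounded_above[of I "\<lambda>i. \<bar>a i\<bar>" b]] b by simp
  then have "\<bar>\<Sum>i\<in>I. a i\<bar> ^ p \<le> real (card I) ^ p * b ^ p"
    using power_mono[of "\<bar>\<Sum>i\<in>I. a i\<bar>" "real (card I) * b" p] by (simp add: power_mult_distrib)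
  also have "b ^ p \<le> (\<Sum>i\<in>I. \<bar>a i\<bar> ^ p)"
    using member_le_sum[of i I "\<lambda>i. \<bar>a i\<bar> ^ p"] i assms by simp
  finally show ?thesis by (simp add: mult_left_mono)
qed (use p in \<open>simp add: power_0_left\<close>)

text \<open>Centring is undone by Jensen's inequality, applied to the independent copy.\<close>

lemma moment_le_sym_fps:
  assumes \<mu>: "has_all_moments \<mu>" and m: "1 \<le> m"
  shows "(\<integral>x. x ^ (2 * m) \<partial>\<mu>) \<le>
    2 ^ (2 * m) * (fact (2 * m) * fps_nth (sym_fps \<mu>) (2 * m) + fps_nth (moment_fps \<mu>) 1 ^ (2 * m))"
proof -
  interpret real_distribution \<mu> using \<mu> by (simp add: has_all_moments_def)
  interpret P: pair_sigma_finite \<mu> \<mu> ..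
  define e where "e = expectation (\<lambda>x. x)"
  have int: "integrable \<mu> (\<lambda>x. x ^ j)" for j using \<mu> by (simp add: has_all_moments_def)
  have int1: "integrable \<mu> (\<lambda>x. x)" using int[of 1] by simp
  have intc: "integrable \<mu> (\<lambda>y. (x - y) ^ j)" for x j
  proof -
    have "(\<lambda>y. (x - y) ^ j) = (\<lambda>y. \<Sum>i\<le>j. real (j choose i) * x ^ i * ((- 1) ^ (j - i) * y ^ (j - i)))"
    proof
      fix y
      show "(x - y) ^ j = (\<Sum>i\<le>j. real (j choose i) * x ^ i * ((- 1) ^ (j - i) * y ^ (j - i)))"
        using binomial_ring[of x "- y" j] by (simp only: power_minus[of y] diff_conv_add_uminus)
    qed
    then show ?thesis using int by simp
  qed
  have intd: "integrable \<mu> (\<lambda>x. (x - e) ^ (2 * m))"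
    using intc[of e "2 * m"] by (simp add: power_mult power2_commute)
  have pair: "integrable (\<mu> \<Otimes>\<^sub>M \<mu>) (\<lambda>(x, y). (x - y) ^ (2 * m))"
    using integral_pair_binomial(1)[OF \<mu> \<mu>, of "- 1" "2 * m"] by simp
  have J: "(x - e) ^ (2 * m) \<le> (\<integral>y. (x - y) ^ (2 * m) \<partial>\<mu>)" for x
  proof -
    have "convex_on UNIV (\<lambda>y::real. y ^ (2 * m))" by (rule convex_power_even) simp
    then have "(expectation (\<lambda>y. x - y)) ^ (2 * m) \<le> expectation (\<lambda>y. (x - y) ^ (2 * m))"
      using intc[of x 1] intc[of x "2 * m"]
      by (intro jensens_inequality[where I = UNIV and q = "\<lambda>y. y ^ (2 * m)"]) auto
    then show ?thesis using int1 by (simp add: e_def prob_space del: space_eq_univ)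
  qed
  have "expectation (\<lambda>x. (x - e) ^ (2 * m)) \<le> (\<integral>x. (\<integral>y. (x - y) ^ (2 * m) \<partial>\<mu>) \<partial>\<mu>)"
    using P.integrable_fst'[OF pair] by (intro integral_mono intd J) simp
  also have "\<dots> = fact (2 * m) * fps_nth (sym_fps \<mu>) (2 * m)"
    using P.integral_fst'[OF pair] by (simp add: sym_fps_nth[OF \<mu>])
  finally have *: "expectation (\<lambda>x. (x - e) ^ (2 * m)) \<le> fact (2 * m) * fps_nth (sym_fps \<mu>) (2 * m)" .
  have "expectation (\<lambda>x. x ^ (2 * m)) \<le> expectation (\<lambda>x. 2 ^ (2 * m) * ((x - e) ^ (2 * m) + e ^ (2 * m)))"
  proof (intro integral_mono int integrable_mult_right Bochner_Integration.integrable_add intd)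
    fix x
    \<comment> \<open>Splitting x into (x - e) + e as a sum over two indices yields the factor
      2^(2m).\<close>
    have "\<bar>\<Sum>i\<in>{False, True}. if i then x - e else e\<bar> ^ (2 * m) \<le>
      real (card {False, True}) ^ (2 * m) * (\<Sum>i\<in>{False, True}. \<bar>if i then x - e else e\<bar> ^ (2 * m))"
      by (rule power_sum_le) (use m in auto)
    then show "x ^ (2 * m) \<le> 2 ^ (2 * m) * ((x - e) ^ (2 * m) + e ^ (2 * m))"
      by (simp add: power_even_abs add.commute)
  qed auto
  also have "\<dots> = 2 ^ (2 * m) * (expectation (\<lambda>x. (x - e) ^ (2 * m)) + e ^ (2 * m))"
    using intd by (simp add: prob_space del: space_eq_univ)
  also have "\<dots> \<le> 2 ^ (2 * m) * (fact (2 * m) * fps_nth (sym_fps \<mu>) (2 * m) + e ^ (2 * m))"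
    using * by simp
  finally show ?thesis by (simp add: e_def moment_fps_def)
qed

lemma fps_nth_prod_1:
  fixes f :: "'k \<Rightarrow> real fps"
  assumes "finite I" "\<And>k. k \<in> I \<Longrightarrow> fps_nth (f k) 0 = 1"
  shows "fps_nth (\<Prod>k\<in>I. f k) 0 = 1 \<and> fps_nth (\<Prod>k\<in>I. f k) 1 = (\<Sum>k\<in>I. fps_nth (f k) 1)"
  using assms by (induction I) (simp_all add: fps_mult_nth)

text \<open>\<open>\<nu>\<^sub>0\<close> is an \<open>N\<close>-fold convolution power of \<open>\<nu>\<close>, so that the moments of \<open>\<nu>\<close> are at most of
  order \<open>1 / N\<close>, while \<open>\<mu>\<close> is the law of a combination of at most \<open>K N / J\<close> independent copies.\<close>

lemma moment_char_prod_le: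
  fixes c :: "'k \<Rightarrow> real"
  assumes \<mu>: "real_distribution \<mu>" and A: "finite A"
    and char_\<mu>: "\<And>t. char \<mu> t = (\<Prod>k\<in>A. char \<nu> (c k * t))"
    and \<nu>: "has_all_moments \<nu>" and c: "\<And>k. k \<in> A \<Longrightarrow> \<bar>c k\<bar> \<le> 1"
    and \<nu>0: "real_distribution \<nu>0" and char_\<nu>0: "\<And>t. char \<nu>0 t = char \<nu> t ^ N"
    and J: "1 \<le> J" and card: "card A * J \<le> K * N" and m: "1 \<le> m"
  shows "has_all_moments \<mu>"
    and "real J * (\<integral>x. x ^ (2 * m) \<partial>\<mu>) \<le> 2 ^ (2 * m) *
      (fact (2 * m) * fps_nth (sym_fps \<nu>0 ^ K) (2 * m) + (real K * fps_nth (moment_fps \<nu>0) 1) ^ (2 * m))"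
proof -
  let ?\<nu> = "\<lambda>k. distr \<nu> borel (\<lambda>x. c k * x)"
  have \<nu>rd: "real_distribution \<nu>" using \<nu> by (simp add: has_all_moments_def)
  have ch: "char \<mu> t = (\<Prod>k\<in>A. char (?\<nu> k) t)" for t
    by (simp add: char_\<mu> char_scale[OF \<nu>rd])
  note am = has_all_moments_scale[OF \<nu>]
  note \<mu>_prod = moment_fps_char_prod[OF \<mu> A am(1) ch] sym_fps_char_prod[OF \<mu> A am(1) ch]
  show "has_all_moments \<mu>" by (rule \<mu>_prod(1))
  have ch0: "char \<nu>0 t = (\<Prod>k\<in>{..<N}. char \<nu> t)" for t by (simp add: char_\<nu>0)
  have \<nu>0_pow: "moment_fps \<nu>0 = moment_fps \<nu> ^ N" "sym_fps \<nu>0 = sym_fps \<nu> ^ N" "has_all_moments \<nu>0"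
    using moment_fps_char_prod[OF \<nu>0 _ _ ch0] sym_fps_char_prod[OF \<nu>0 _ _ ch0] \<nu> by auto
  note S = sym_fps_nonneg[OF \<nu>] sym_fps_0[OF \<nu>]
  note Sp = fps_power_nonneg_mono[of "sym_fps \<nu>", OF S]
  have E0: "fps_nth (moment_fps \<rho>) 0 = 1" if "has_all_moments \<rho>" for \<rho>
  proof -
    interpret real_distribution \<rho> using that by (simp add: has_all_moments_def)
    show ?thesis by (simp add: moment_fps_def prob_space del: space_eq_univ)
  qed
  have "fps_nth (sym_fps \<mu>) (2 * m) \<le> fps_nth (sym_fps \<nu> ^ card A) (2 * m)"
    unfolding \<mu>_prod(3)
    using fps_prod_le_power[of A "\<lambda>k. sym_fps (?\<nu> k)" "sym_fps \<nu>" "2 * m"] A sym_fps_nonneg[OF am(1)]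
      sym_fps_scale_le[OF \<nu>] c by auto
  then have "real J * fps_nth (sym_fps \<mu>) (2 * m) \<le> real J * fps_nth (sym_fps \<nu> ^ card A) (2 * m)"
    by (rule mult_left_mono) simp
  \<comment> \<open>The gain of J: superadditivity is applied to the series of the whole sum, not of
    a single bump. Enlarging the exponent to K * N then gives a power of the series of
    \<nu>0.\<close>
  also have "\<dots> \<le> fps_nth ((sym_fps \<nu> ^ card A) ^ J) (2 * m)"
    using m S by (intro fps_power_superadditive Sp) (auto simp: fps_nth_power_0)
  also have "\<dots> \<le> fps_nth (sym_fps \<nu> ^ (K * N)) (2 * m)"
    unfolding power_mult[symmetric] by (rule Sp(2)) (rule card)
  also have "\<dots> = fps_nth (sym_fps \<nu>0 ^ K) (2 * m)"
    by (simp add: \<nu>0_pow power_mult[symmetric] mult.commute)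
  finally have 1: "real J * fps_nth (sym_fps \<mu>) (2 * m) \<le> fps_nth (sym_fps \<nu>0 ^ K) (2 * m)" .
  \<comment> \<open>Symmetrisation erases the mean, so it is bounded on its own: means add up over
    \<open>A\<close>, and N times the mean of \<nu> is the mean of \<nu>0.\<close>
  let ?e = "fps_nth (moment_fps \<nu>) 1"
  have "fps_nth (moment_fps \<mu>) 1 = (\<Sum>k\<in>A. c k * ?e)"
    unfolding \<mu>_prod(2)
    by (subst fps_nth_prod_1[THEN conjunct2, OF A]) (simp_all only: E0[OF am(1)], simp only: am(2) power_one_right)
  then have "\<bar>fps_nth (moment_fps \<mu>) 1\<bar> \<le> (\<Sum>k\<in>A. \<bar>c k * ?e\<bar>)" by simp
  also have "\<dots> \<le> (\<Sum>k\<in>A. \<bar>?e\<bar>)"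
    using c by (intro sum_mono) (simp add: abs_mult mult_left_le_one_le)
  finally have "real J * \<bar>fps_nth (moment_fps \<mu>) 1\<bar> \<le> real J * (real (card A) * \<bar>?e\<bar>)"
    by (intro mult_left_mono) simp_all
  also have "\<dots> = real (card A * J) * \<bar>?e\<bar>" by simp
  also have "\<dots> \<le> real (K * N) * \<bar>?e\<bar>"
    using card by (intro mult_right_mono of_nat_mono) auto
  also have "\<dots> = \<bar>real K * fps_nth (moment_fps \<nu>0) 1\<bar>"
    using fps_nth_prod_1[of "{..<N}" "\<lambda>_. moment_fps \<nu>"] by (simp add: \<nu>0_pow E0[OF \<nu>] abs_mult)
  finally have e: "real J * \<bar>fps_nth (moment_fps \<mu>) 1\<bar> \<le> \<bar>real K * fps_nth (moment_fps \<nu>0) 1\<bar>" .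
  \<comment> \<open>Because J \<ge> 1, the single factor J may be raised to the power 2m and then
    taken inside.\<close>
  have "real J * fps_nth (moment_fps \<mu>) 1 ^ (2 * m) \<le> real J ^ (2 * m) * fps_nth (moment_fps \<mu>) 1 ^ (2 * m)"
    using J m self_le_power[of "real J" "2 * m"] by (intro mult_right_mono) auto
  also have "\<dots> = (real J * \<bar>fps_nth (moment_fps \<mu>) 1\<bar>) ^ (2 * m)"
    by (simp add: power_mult_distrib power_even_abs)
  also have "\<dots> \<le> \<bar>real K * fps_nth (moment_fps \<nu>0) 1\<bar> ^ (2 * m)"
    using e by (rule power_mono) simp
  also have "\<dots> = (real K * fps_nth (moment_fps \<nu>0) 1) ^ (2 * m)"
    by (rule power_even_abs) simp
  finally have 2: "real J * fps_nth (moment_fps \<mu>) 1 ^ (2 * m) \<le> (real K * fps_nth (moment_fps \<nu>0) 1) ^ (2 * m)" .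
  have "real J * (\<integral>x. x ^ (2 * m) \<partial>\<mu>) \<le> real J * (2 ^ (2 * m) *
      (fact (2 * m) * fps_nth (sym_fps \<mu>) (2 * m) + fps_nth (moment_fps \<mu>) 1 ^ (2 * m)))"
    by (intro mult_left_mono moment_le_sym_fps \<mu>_prod(1) m) simp
  also have "\<dots> = 2 ^ (2 * m) *
      (fact (2 * m) * (real J * fps_nth (sym_fps \<mu>) (2 * m)) + real J * fps_nth (moment_fps \<mu>) 1 ^ (2 * m))"
    by (simp add: algebra_simps)
  also have "\<dots> \<le> 2 ^ (2 * m) *
      (fact (2 * m) * fps_nth (sym_fps \<nu>0 ^ K) (2 * m) + (real K * fps_nth (moment_fps \<nu>0) 1) ^ (2 * m))"
    using 1 2 by (intro mult_left_mono add_mono) auto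
  finally show "real J * (\<integral>x. x ^ (2 * m) \<partial>\<mu>) \<le> \<dots>" .
qed

section \<open>Convergence in probability\<close>

context prob_space
begin

text \<open>One geometric sequence serves twice: as summable probabilities for the Borel-Cantelli
  lemma, and as summable thresholds, so that increments bounded in this way form a convergent
  series.\<close>

lemma AE_eventually_le_of_summable:
  assumes [measurable]: "\<And>i. Z i \<in> borel_measurable M"
    and le: "\<And>i. measure M {\<omega>\<in>space M. (1 / 2) ^ i < \<bar>Z i \<omega>\<bar>} \<le> (1 / 2 :: real) ^ i"
  shows "AE \<omega> in M. eventually (\<lambda>i. \<bar>Z i \<omega> :: real\<bar> \<le> (1 / 2) ^ i) sequentially"
proof -
  have "summable (\<lambda>i. measure M {\<omega>\<in>space M. (1 / 2) ^ i < \<bar>Z i \<omega>\<bar>})"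
    by (rule summable_comparison_test'[OF summable_geometric[of "1 / 2 :: real"]]) (use le in auto)
  then have "AE \<omega> in M. eventually (\<lambda>i. \<omega> \<in> space M - {\<omega>\<in>space M. (1 / 2) ^ i < \<bar>Z i \<omega>\<bar>}) sequentially"
    by (intro borel_cantelli_AE1) (auto simp: emeasure_eq_measure)
  then show ?thesis
    by eventually_elim (auto elim!: eventually_mono simp: not_less)
qed

text \<open>The selection \<open>r\<close> is not claimed to increase; the Fatou argument that uses
  it has a bound for every index.\<close>

lemma tendsto_in_prob_AE_subseq:
  assumes [measurable]: "\<And>n. X n \<in> borel_measurable M" "Y \<in> borel_measurable M"
    and "tendsto_in_prob M X Y"
  shows "\<exists>r. AE \<omega> in M. (\<lambda>i. X (r i) \<omega>) \<longlonglongrightarrow> Y \<omega>"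
proof -
  have "\<exists>n. measure M {\<omega>\<in>space M. (1 / 2) ^ i < \<bar>X n \<omega> - Y \<omega>\<bar>} \<le> (1 / 2) ^ i" for i :: nat
  proof -
    have "eventually (\<lambda>n. measure M {\<omega>\<in>space M. (1 / 2) ^ i < \<bar>X n \<omega> - Y \<omega>\<bar>} < (1 / 2) ^ i) sequentially"
    proof (rule order_tendstoD(2))
      have "0 < (1 / 2 :: real) ^ i" by simp
      then show "(\<lambda>n. measure M {\<omega>\<in>space M. (1 / 2) ^ i < \<bar>X n \<omega> - Y \<omega>\<bar>}) \<longlonglongrightarrow> 0"
        using assms(3) unfolding tendsto_in_prob_def by blast
    qed simp
    then show ?thesis by (auto simp: eventually_sequentially intro: less_imp_le)
  qed
  then obtain r where "\<And>i. measure M {\<omega>\<in>space M. (1 / 2) ^ i < \<bar>X (r i) \<omega> - Y \<omega>\<bar>} \<le> (1 / 2) ^ i"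
    by metis
  then have "AE \<omega> in M. eventually (\<lambda>i. \<bar>X (r i) \<omega> - Y \<omega>\<bar> \<le> (1 / 2) ^ i) sequentially"
    by (intro AE_eventually_le_of_summable) auto
  then have "AE \<omega> in M. (\<lambda>i. X (r i) \<omega>) \<longlonglongrightarrow> Y \<omega>"
  proof eventually_elim
    case (elim \<omega>)
    then have "(\<lambda>i. X (r i) \<omega> - Y \<omega>) \<longlonglongrightarrow> 0"
      by (intro tendsto_0_le[OF LIMSEQ_realpow_zero[of "1 / 2"], where K = 1]) auto
    then show ?case by (rule LIM_zero_cancel)
  qed
  then show ?thesis by blast
qed

text \<open>Fatou's lemma along an almost surely convergent selection; continuity of
  \<open>f\<close> identifies the pointwise limit.\<close>

lemma nn_integral_le_tendsto_in_prob:
  assumes [measurable]: "\<And>n. X n \<in> borel_measurable M" "Y \<in> borel_measurable M"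
    and "tendsto_in_prob M X Y" and f: "continuous_on UNIV f"
    and le: "\<And>n. (\<integral>\<^sup>+\<omega>. ennreal (f (X n \<omega>)) \<partial>M) \<le> c"
  shows "(\<integral>\<^sup>+\<omega>. ennreal (f (Y \<omega>)) \<partial>M) \<le> c"
proof -
  have [measurable]: "f \<in> borel_measurable borel" using f by (rule borel_measurable_continuous_onI)
  obtain r where "AE \<omega> in M. (\<lambda>i. X (r i) \<omega>) \<longlonglongrightarrow> Y \<omega>"
    using tendsto_in_prob_AE_subseq[OF assms(1-3)] by auto
  then have "AE \<omega> in M. ennreal (f (Y \<omega>)) = liminf (\<lambda>i. ennreal (f (X (r i) \<omega>)))"
  proof eventually_elim
    case (elim \<omega>)
    have "(\<lambda>i. f (X (r i) \<omega>)) \<longlonglongrightarrow> f (Y \<omega>)"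
      using continuous_on_tendsto_compose[OF f elim] by auto
    then show ?case by (intro lim_imp_Liminf[symmetric] tendsto_ennrealI) auto
  qed
  then have "(\<integral>\<^sup>+\<omega>. ennreal (f (Y \<omega>)) \<partial>M) = (\<integral>\<^sup>+\<omega>. liminf (\<lambda>i. ennreal (f (X (r i) \<omega>))) \<partial>M)"
    by (rule nn_integral_cong_AE)
  also have "\<dots> \<le> liminf (\<lambda>i. \<integral>\<^sup>+\<omega>. ennreal (f (X (r i) \<omega>)) \<partial>M)"
    by (rule nn_integral_liminf) measurable
  also have "\<dots> \<le> liminf (\<lambda>i. c)"
    by (intro Liminf_mono always_eventually allI le)
  also have "\<dots> = c" by (simp add: Liminf_const)
  finally show ?thesis .
qed

lemma tendsto_in_prob_triangle:
  assumes [measurable]: "\<And>n. X n \<in> borel_measurable M" "\<And>n. Z n \<in> borel_measurable M" "Y \<in> borel_measurable M"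
    and XZ: "tendsto_in_prob M (\<lambda>n \<omega>. X n \<omega> - Z n \<omega>) (\<lambda>_. 0)" and Z: "tendsto_in_prob M Z Y"
  shows "tendsto_in_prob M X Y"
  unfolding tendsto_in_prob_def
proof (intro allI impI)
  fix e :: real assume "0 < e"
  let ?A = "\<lambda>n. {\<omega>\<in>space M. e / 2 < \<bar>X n \<omega> - Z n \<omega> - 0\<bar>}" and ?B = "\<lambda>n. {\<omega>\<in>space M. e / 2 < \<bar>Z n \<omega> - Y \<omega>\<bar>}"
  have "(\<lambda>n. measure M (?A n) + measure M (?B n)) \<longlonglongrightarrow> 0 + 0"
    using XZ Z half_gt_zero[OF \<open>0 < e\<close>] unfolding tendsto_in_prob_def by (intro tendsto_add) blast+
  moreover have "measure M {\<omega>\<in>space M. e < \<bar>X n \<omega> - Y \<omega>\<bar>} \<le> measure M (?A n) + measure M (?B n)" for n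
  proof -
    have "measure M {\<omega>\<in>space M. e < \<bar>X n \<omega> - Y \<omega>\<bar>} \<le> measure M (?A n \<union> ?B n)"
    proof (intro finite_measure_mono subsetI)
      fix \<omega> assume "\<omega> \<in> {\<omega>\<in>space M. e < \<bar>X n \<omega> - Y \<omega>\<bar>}"
      then have "\<omega> \<in> space M" "e < \<bar>X n \<omega> - Y \<omega>\<bar>" by auto
      moreover have "\<bar>X n \<omega> - Y \<omega>\<bar> \<le> \<bar>X n \<omega> - Z n \<omega>\<bar> + \<bar>Z n \<omega> - Y \<omega>\<bar>"
        using abs_triangle_ineq[of "X n \<omega> - Z n \<omega>" "Z n \<omega> - Y \<omega>"] by simp
      ultimately have "\<omega> \<in> space M" "\<not> (\<bar>X n \<omega> - Z n \<omega>\<bar> \<le> e / 2 \<and> \<bar>Z n \<omega> - Y \<omega>\<bar> \<le> e / 2)"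
        by auto
      then show "\<omega> \<in> ?A n \<union> ?B n" by auto
    qed measurable
    also have "\<dots> \<le> measure M (?A n) + measure M (?B n)"
      by (intro measure_Un_le) measurable
    finally show ?thesis .
  qed
  ultimately show "(\<lambda>n. measure M {\<omega>\<in>space M. e < \<bar>X n \<omega> - Y \<omega>\<bar>}) \<longlonglongrightarrow> 0"
    by (auto intro: Lim_null_comparison[where g = "\<lambda>n. measure M (?A n) + measure M (?B n)"])
qed

lemma tendsto_in_prob_AE:
  assumes [measurable]: "\<And>n. X n \<in> borel_measurable M" "Y \<in> borel_measurable M"
    and lim: "AE \<omega> in M. (\<lambda>i. X i \<omega>) \<longlonglongrightarrow> Y \<omega>"
  shows "tendsto_in_prob M X Y"
  unfolding tendsto_in_prob_def
proof (intro allI impI)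
  fix e :: real assume "0 < e"
  let ?A = "\<lambda>n. {\<omega>\<in>space M. e < \<bar>X n \<omega> - Y \<omega>\<bar>}"
  have "(\<lambda>n. \<integral>\<omega>. indicator (?A n) \<omega> \<partial>M) \<longlonglongrightarrow> (\<integral>\<omega>. 0 \<partial>M :: real)"
  proof (rule integral_dominated_convergence[where w = "\<lambda>_. 1"])
    show "AE \<omega> in M. (\<lambda>n. indicator (?A n) \<omega> :: real) \<longlonglongrightarrow> 0"
      using lim
    proof eventually_elim
      case (elim \<omega>)
      then have "eventually (\<lambda>n. \<bar>X n \<omega> - Y \<omega>\<bar> < e) sequentially"
        using \<open>0 < e\<close> by (auto dest!: tendstoD simp: dist_real_def)
      then show ?case
        by (intro tendsto_eventually) (auto elim!: eventually_mono simp: indicator_def)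
    qed
  qed (auto simp: indicator_def)
  then show "(\<lambda>n. measure M (?A n)) \<longlonglongrightarrow> 0" by simp
qed

lemma cauchy_in_prob_convergent:
  assumes [measurable]: "\<And>n. X n \<in> borel_measurable M"
    and cauchy: "\<And>e d. 0 < e \<Longrightarrow> 0 < d \<Longrightarrow>
      \<exists>N. \<forall>n\<ge>N. \<forall>p\<ge>N. measure M {\<omega>\<in>space M. e < \<bar>X n \<omega> - X p \<omega> :: real\<bar>} \<le> d"
  shows "\<exists>Y. Y \<in> borel_measurable M \<and> tendsto_in_prob M X Y"
proof -
  have "\<exists>N. \<forall>n\<ge>N. \<forall>p\<ge>N. measure M {\<omega>\<in>space M. (1 / 2) ^ i < \<bar>X n \<omega> - X p \<omega>\<bar>} \<le> (1 / 2) ^ i" for i :: nat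
    by (intro cauchy) auto
  then obtain N where N: "\<And>i n p. N i \<le> n \<Longrightarrow> N i \<le> p \<Longrightarrow>
      measure M {\<omega>\<in>space M. (1 / 2) ^ i < \<bar>X n \<omega> - X p \<omega>\<bar>} \<le> (1 / 2) ^ i"
    by metis
  \<comment> \<open>The sum puts both \<open>r i\<close> and \<open>r (Suc i)\<close> above
    \<open>N i\<close>. The summand \<open>i\<close> gives \<open>n \<le> r n\<close>, which is used
    to compare \<open>X n\<close> with \<open>X (r n)\<close> at the end.\<close>
  define r where "r i = i + (\<Sum>k\<le>i. N k)" for i
  have rN: "N i \<le> r i" for i unfolding r_def by (rule trans_le_add2) (rule member_le_sum, auto)
  have "AE \<omega> in M. eventually (\<lambda>i. \<bar>X (r (Suc i)) \<omega> - X (r i) \<omega>\<bar> \<le> (1 / 2) ^ i) sequentially"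
  proof (rule AE_eventually_le_of_summable)
    fix i
    have "N i \<le> r (Suc i)" using rN[of i] by (simp add: r_def)
    then show "measure M {\<omega>\<in>space M. (1 / 2) ^ i < \<bar>X (r (Suc i)) \<omega> - X (r i) \<omega>\<bar>} \<le> (1 / 2) ^ i"
      using rN by (intro N)
  qed measurable
  then have conv: "AE \<omega> in M. (\<lambda>i. X (r i) \<omega>) \<longlonglongrightarrow> lim (\<lambda>i. X (r i) \<omega>)"
  proof eventually_elim
    case (elim \<omega>)
    then have "summable (\<lambda>i. X (r (Suc i)) \<omega> - X (r i) \<omega>)"
      by (intro summable_comparison_test_ev[OF _ summable_geometric[of "1 / 2 :: real"]]) auto
    then have "convergent (\<lambda>n. \<Sum>i<n. X (r (Suc i)) \<omega> - X (r i) \<omega>)"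
      by (simp add: summable_iff_convergent)
    then have "convergent (\<lambda>n. (\<Sum>i<n. X (r (Suc i)) \<omega> - X (r i) \<omega>) + X (r 0) \<omega>)"
      by (intro convergent_add convergent_const)
    moreover have "(\<Sum>i<n. X (r (Suc i)) \<omega> - X (r i) \<omega>) + X (r 0) \<omega> = X (r n) \<omega>" for n
      using sum_lessThan_telescope[of "\<lambda>i. X (r i) \<omega>" n] by simp
    ultimately have "convergent (\<lambda>n. X (r n) \<omega>)" by simp
    then show ?case by (simp add: convergent_LIMSEQ_iff)
  qed
  \<comment> \<open>\<open>lim\<close> is total, so \<open>Y\<close> is measurable; its values on
    the null set without convergence are arbitrary.\<close>
  define Y where "Y \<omega> = lim (\<lambda>i. X (r i) \<omega>)" for \<omega>
  have Y[measurable]: "Y \<in> borel_measurable M" unfolding Y_def by measurable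
  have rY: "tendsto_in_prob M (\<lambda>i. X (r i)) Y"
    using conv by (intro tendsto_in_prob_AE) (auto simp: Y_def)
  have "tendsto_in_prob M (\<lambda>n \<omega>. X n \<omega> - X (r n) \<omega>) (\<lambda>_. 0)"
    unfolding tendsto_in_prob_def
  proof (intro allI impI LIMSEQ_I)
    fix e d :: real assume "0 < e" "0 < d"
    then obtain L where L: "\<And>n p. L \<le> n \<Longrightarrow> L \<le> p \<Longrightarrow> measure M {\<omega>\<in>space M. e < \<bar>X n \<omega> - X p \<omega>\<bar>} \<le> d / 2"
      using cauchy[of e "d / 2"] by auto
    have "measure M {\<omega>\<in>space M. e < \<bar>X n \<omega> - X (r n) \<omega>\<bar>} < d" if "L \<le> n" for n
      using L[of n "r n"] that \<open>0 < d\<close> by (auto simp: r_def)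
    then show "\<exists>n0. \<forall>n\<ge>n0. norm (measure M {\<omega>\<in>space M. e < \<bar>X n \<omega> - X (r n) \<omega> - 0\<bar>} - 0) < d"
      by auto
  qed
  then have "tendsto_in_prob M X Y"
    using rY by (rule tendsto_in_prob_triangle[rotated 3]) auto
  with Y show ?thesis by blast
qed

text \<open>Averaging the characteristic function against a standard Gaussian gives
  \<open>E (exp (- X\<^sup>2 / 2))\<close>.\<close>

lemma char_tendsto_1_imp_tendsto_in_prob:
  assumes [measurable]: "\<And>n. X n \<in> borel_measurable M"
    and ch: "\<And>t. (\<lambda>n. char (distr M borel (X n)) t) \<longlonglongrightarrow> 1"
  shows "tendsto_in_prob M X (\<lambda>_. 0)"
proof -
  interpret N: real_distribution std_normal_distribution by (rule real_dist_normal_dist)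
  interpret pair_sigma_finite M std_normal_distribution ..
  have eq: "complex_of_real (expectation (\<lambda>\<omega>. exp (- (X n \<omega>)\<^sup>2 / 2))) =
      (\<integral>t. char (distr M borel (X n)) t \<partial>std_normal_distribution)" for n
  proof -
    have int: "integrable (M \<Otimes>\<^sub>M std_normal_distribution) (\<lambda>(\<omega>, t). iexp (t * X n \<omega>))"
    proof -
      interpret P: pair_prob_space M std_normal_distribution ..
      have "integrable (M \<Otimes>\<^sub>M std_normal_distribution) (\<lambda>z. exp (\<i> * complex_of_real (snd z * X n (fst z))))"
        by (rule P.P.integrable_iexp) auto
      then show ?thesis by (simp add: case_prod_beta')
    qed
    have "(\<integral>t. char (distr M borel (X n)) t \<partial>std_normal_distribution) =
        (\<integral>t. (\<integral>\<omega>. iexp (t * X n \<omega>) \<partial>M) \<partial>std_normal_distribution)"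
      by (simp add: char_def integral_distr)
    also have "\<dots> = (\<integral>\<omega>. (\<integral>t. iexp (t * X n \<omega>) \<partial>std_normal_distribution) \<partial>M)"
      using int by (rule Fubini_integral)
    also have "\<dots> = (\<integral>\<omega>. char std_normal_distribution (X n \<omega>) \<partial>M)"
      by (simp add: char_def mult.commute)
    also have "\<dots> = (\<integral>\<omega>. complex_of_real (exp (- (X n \<omega>)\<^sup>2 / 2)) \<partial>M)"
      by (simp add: char_std_normal_distribution)
    finally show ?thesis by simp
  qed
  have "(\<lambda>n. \<integral>t. char (distr M borel (X n)) t \<partial>std_normal_distribution) \<longlonglongrightarrow> (\<integral>t. 1 \<partial>std_normal_distribution)"
  proof (rule integral_dominated_convergence[where w = "\<lambda>_. 1"])
    have "real_distribution (distr M borel (X n))" for n by simp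
    then show "AE t in std_normal_distribution. norm (char (distr M borel (X n)) t) \<le> 1" for n
      by (intro AE_I2 real_distribution.cmod_char_le_1)
    show "char (distr M borel (X n)) \<in> borel_measurable std_normal_distribution" for n
      using real_distribution.char_measurable[of "distr M borel (X n)"] by simp
  qed (use ch in auto)
  then have "(\<lambda>n. complex_of_real (expectation (\<lambda>\<omega>. exp (- (X n \<omega>)\<^sup>2 / 2)))) \<longlonglongrightarrow> complex_of_real 1"
    unfolding eq using N.prob_space by simp
  then have E: "(\<lambda>n. expectation (\<lambda>\<omega>. exp (- (X n \<omega>)\<^sup>2 / 2))) \<longlonglongrightarrow> 1"
    by (simp only: tendsto_of_real_iff)
  show ?thesis
    unfolding tendsto_in_prob_def
  proof (intro allI impI)
    fix e :: real assume "0 < e"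
    let ?A = "\<lambda>n. {\<omega>\<in>space M. e < \<bar>X n \<omega> - 0\<bar>}"
    \<comment> \<open>Markov's inequality for 1 - exp (- X^2 / 2), which is at least
      \<open>q\<close> wherever \<bar>X\<bar> exceeds \<open>e\<close>.\<close>
    define q where "q = 1 - exp (- e\<^sup>2 / 2)"
    have q: "0 < q" using \<open>0 < e\<close> by (simp add: q_def)
    have intE: "integrable M (\<lambda>\<omega>. exp (- (X n \<omega>)\<^sup>2 / 2))" for n
      by (rule integrable_const_bound[of _ 1]) auto
    have "q * measure M (?A n) \<le> 1 - expectation (\<lambda>\<omega>. exp (- (X n \<omega>)\<^sup>2 / 2))" for n
    proof -
      have "q * measure M (?A n) = expectation (\<lambda>\<omega>. q * indicator (?A n) \<omega>)" by simp
      also have "\<dots> \<le> expectation (\<lambda>\<omega>. 1 - exp (- (X n \<omega>)\<^sup>2 / 2))"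
      proof (rule integral_mono)
        fix \<omega> assume "\<omega> \<in> space M"
        show "q * indicator (?A n) \<omega> \<le> 1 - exp (- (X n \<omega>)\<^sup>2 / 2)"
          using \<open>0 < e\<close> abs_le_square_iff[of e "X n \<omega>"] by (auto simp: indicator_def q_def)
      qed (use intE in \<open>auto intro!: integrable_real_indicator simp: emeasure_eq_measure\<close>)
      also have "\<dots> = 1 - expectation (\<lambda>\<omega>. exp (- (X n \<omega>)\<^sup>2 / 2))"
        using intE by (simp add: prob_space)
      finally show ?thesis .
    qed
    then have le: "measure M (?A n) \<le> (1 - expectation (\<lambda>\<omega>. exp (- (X n \<omega>)\<^sup>2 / 2))) / q" for n
      using q by (simp add: field_simps)
    have "(\<lambda>n. (1 - expectation (\<lambda>\<omega>. exp (- (X n \<omega>)\<^sup>2 / 2))) / q) \<longlonglongrightarrow> (1 - 1) / q"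
      by (intro tendsto_intros E) (use q in simp)
    then have "(\<lambda>n. (1 - expectation (\<lambda>\<omega>. exp (- (X n \<omega>)\<^sup>2 / 2))) / q) \<longlonglongrightarrow> 0" by simp
    then show "(\<lambda>n. measure M (?A n)) \<longlonglongrightarrow> 0"
      by (rule Lim_null_comparison[rotated]) (use le in auto)
  qed
qed

end

section \<open>Levy exponents\<close>

text \<open>For \<bar>t\<bar> \<le> 1 this is the Taylor remainder of order two; for larger t the
  compensator vanishes and the trivial bound 2 remains. The product form separates an integrable
  majorant in t from quadratic growth in \<xi>.\<close>

lemma levy_integrand_bound:
  "cmod (cis (\<xi> * t) - 1 - \<i> * of_real (\<xi> * t * indicator {-1..1} t)) \<le> (2 + \<xi>\<^sup>2) * min 1 (t\<^sup>2)"
proof (cases "\<bar>t\<bar> \<le> 1")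
  case True
  have "cmod (iexp (\<xi> * t) - (\<Sum>k\<le>1. (\<i> * (\<xi> * t)) ^ k / fact k)) \<le> \<bar>\<xi> * t\<bar> ^ Suc 1 / fact (Suc 1)"
    by (rule iexp_approx1)
  then have "cmod (cis (\<xi> * t) - 1 - \<i> * of_real (\<xi> * t)) \<le> \<xi>\<^sup>2 * t\<^sup>2 / 2"
    by (simp add: cis_conv_exp power_mult_distrib algebra_simps power2_eq_square)
  also have "\<dots> \<le> (2 + \<xi>\<^sup>2) * t\<^sup>2" by (simp add: algebra_simps)
  finally show ?thesis using True by (simp add: abs_le_iff min_absorb2 abs_square_le_1)
next
  case False
  then have "1 \<le> t\<^sup>2" using abs_le_square_iff[of 1 t] by simp
  then have "min 1 (t\<^sup>2) = 1" by simp
  moreover have "cmod (cis (\<xi> * t) - 1) \<le> 2" by (rule norm_triangle_ineq4[THEN order_trans]) simp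
  ultimately show ?thesis using False
    by (auto simp: indicator_def abs_le_iff intro: order_trans)
qed

lemma
  assumes \<nu>: "levy_measure \<nu>"
  shows levy_exponent_continuous: "continuous_on UNIV (levy_exponent \<mu> v \<nu>)"
    and levy_exponent_quadratic_growth: "\<exists>C\<ge>0. \<forall>\<xi>. cmod (levy_exponent \<mu> v \<nu> \<xi>) \<le> C * (1 + \<xi>\<^sup>2)"
proof -
  let ?h = "\<lambda>\<xi> t. cis (\<xi> * t) - 1 - \<i> * of_real (\<xi> * t * indicator {-1..1} t)"
  have [measurable_cong]: "sets \<nu> = sets borel" using \<nu> by (simp add: levy_measure_def)
  have cis: "continuous_on UNIV cis" unfolding cis_conv_exp by (intro continuous_intros)
  have [measurable]: "cis \<in> borel_measurable borel" using cis by (rule borel_measurable_continuous_onI)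
  have m[measurable]: "?h \<xi> \<in> borel_measurable \<nu>" for \<xi> by measurable
  have int: "integrable \<nu> (\<lambda>t. min 1 (t\<^sup>2))"
    using \<nu> by (intro integrableI_bounded) (auto simp: levy_measure_def abs_of_nonneg)
  have inth: "integrable \<nu> (?h \<xi>)" for \<xi>
    by (rule Bochner_Integration.integrable_bound[OF integrable_mult_right[OF int, of "2 + \<xi>\<^sup>2"]])
       (use levy_integrand_bound in \<open>auto intro!: AE_I2 simp: abs_of_nonneg simp del: of_real_mult\<close>)
  have "isCont (\<lambda>\<xi>. \<integral>t. ?h \<xi> t \<partial>\<nu>) \<xi>" for \<xi>
    unfolding continuous_at_sequentially
  proof safe
    fix x assume x: "x \<longlonglongrightarrow> \<xi>"
    \<comment> \<open>A convergent sequence is bounded, which makes the majorant for dominated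
      convergence independent of n.\<close>
    then obtain R where R: "\<And>n. \<bar>x n\<bar> \<le> R"
      by (metis Bseq_def convergentI convergent_imp_Bseq real_norm_def)
    show "((\<lambda>\<xi>. \<integral>t. ?h \<xi> t \<partial>\<nu>) \<circ> x) \<longlonglongrightarrow> (\<integral>t. ?h \<xi> t \<partial>\<nu>)"
      unfolding comp_def
    proof (rule integral_dominated_convergence[where w = "\<lambda>t. (2 + R\<^sup>2) * min 1 (t\<^sup>2)"])
      show "AE t in \<nu>. (\<lambda>n. ?h (x n) t) \<longlonglongrightarrow> ?h \<xi> t"
      proof (rule AE_I2)
        fix t
        have "(\<lambda>n. cis (x n * t)) \<longlonglongrightarrow> cis (\<xi> * t)"
          by (rule continuous_on_tendsto_compose[OF cis]) (auto intro!: tendsto_intros x)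
        then show "(\<lambda>n. ?h (x n) t) \<longlonglongrightarrow> ?h \<xi> t"
          by (intro tendsto_intros x)
      qed
      show "AE t in \<nu>. cmod (?h (x n) t) \<le> (2 + R\<^sup>2) * min 1 (t\<^sup>2)" for n
      proof (rule AE_I2)
        fix t
        have "(x n)\<^sup>2 \<le> R\<^sup>2" using power_mono[OF R[of n], of 2] by simp
        then show "cmod (?h (x n) t) \<le> (2 + R\<^sup>2) * min 1 (t\<^sup>2)"
          by (intro order_trans[OF levy_integrand_bound] mult_right_mono) auto
      qed
    qed (use int in auto)
  qed
  then have "continuous_on UNIV (\<lambda>\<xi>. \<integral>t. ?h \<xi> t \<partial>\<nu>)"
    by (simp add: continuous_at_imp_continuous_on)
  then show "continuous_on UNIV (levy_exponent \<mu> v \<nu>)"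
    unfolding levy_exponent_def by (intro continuous_intros) auto
  define c where "c = (\<integral>t. min 1 (t\<^sup>2) \<partial>\<nu>)"
  have c: "0 \<le> c" unfolding c_def by (intro Bochner_Integration.integral_nonneg) auto
  have "cmod (levy_exponent \<mu> v \<nu> \<xi>) \<le> (\<bar>\<mu>\<bar> + \<bar>v\<bar> + 2 * c) * (1 + \<xi>\<^sup>2)" for \<xi>
  proof -
    have 1: "cmod (\<integral>t. ?h \<xi> t \<partial>\<nu>) \<le> (2 + \<xi>\<^sup>2) * c"
    proof -
      have "cmod (\<integral>t. ?h \<xi> t \<partial>\<nu>) \<le> (\<integral>t. cmod (?h \<xi> t) \<partial>\<nu>)" by (rule integral_norm_bound)
      also have "\<dots> \<le> (\<integral>t. (2 + \<xi>\<^sup>2) * min 1 (t\<^sup>2) \<partial>\<nu>)"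
        using inth int by (intro integral_mono levy_integrand_bound) auto
      finally show ?thesis by (simp add: c_def)
    qed
    have 2: "\<bar>\<mu> * \<xi>\<bar> \<le> \<bar>\<mu>\<bar> * (1 + \<xi>\<^sup>2)"
    proof -
      have "\<bar>\<xi>\<bar> \<le> 1 + \<xi>\<^sup>2"
        using zero_le_power2[of "\<bar>\<xi>\<bar> - 1"] zero_le_power2[of \<xi>] unfolding power2_diff by simp
      then show ?thesis by (simp add: abs_mult mult_left_mono)
    qed
    have 3: "\<bar>v * \<xi>\<^sup>2 / 2\<bar> \<le> \<bar>v\<bar> * (1 + \<xi>\<^sup>2)"
      by (simp add: abs_mult algebra_simps)
    have "cmod (levy_exponent \<mu> v \<nu> \<xi>) \<le> \<bar>\<mu> * \<xi>\<bar> + \<bar>v * \<xi>\<^sup>2 / 2\<bar> + cmod (\<integral>t. ?h \<xi> t \<partial>\<nu>)"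
    proof -
      have "cmod (\<i> * of_real (\<mu> * \<xi>) - of_real (v * \<xi>\<^sup>2 / 2) + (\<integral>t. ?h \<xi> t \<partial>\<nu>)) \<le>
        cmod (\<i> * of_real (\<mu> * \<xi>)) + cmod (of_real (v * \<xi>\<^sup>2 / 2)) + cmod (\<integral>t. ?h \<xi> t \<partial>\<nu>)"
        by (intro norm_triangle_le norm_triangle_ineq4 add_right_mono)
      then show ?thesis unfolding levy_exponent_def norm_mult norm_of_real by simp
    qed
    also have "\<dots> \<le> \<bar>\<mu>\<bar> * (1 + \<xi>\<^sup>2) + \<bar>v\<bar> * (1 + \<xi>\<^sup>2) + (2 + \<xi>\<^sup>2) * c"
      by (intro add_mono 1 2 3)
    also have "\<dots> \<le> (\<bar>\<mu>\<bar> + \<bar>v\<bar> + 2 * c) * (1 + \<xi>\<^sup>2)"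
      using c by (simp add: algebra_simps)
    finally show ?thesis .
  qed
  then show "\<exists>C\<ge>0. \<forall>\<xi>. cmod (levy_exponent \<mu> v \<nu> \<xi>) \<le> C * (1 + \<xi>\<^sup>2)"
    using c by (intro exI[of _ "\<bar>\<mu>\<bar> + \<bar>v\<bar> + 2 * c"]) auto
qed

lemma levy_exponent_0: "levy_exponent \<mu> v \<nu> 0 = 0"
  by (simp add: levy_exponent_def)

section \<open>Pairing of the noise with test functions\<close>

lemma schwartz_fun_simps [simp]:
  "schwartz_fun (f + g) x = schwartz_fun f x + schwartz_fun g x"
  "schwartz_fun (f - g) x = schwartz_fun f x - schwartz_fun g x"
  "schwartz_fun (c *\<^sub>R f) x = c * schwartz_fun f x"
  "schwartz_fun 0 x = 0"
  by (simp_all only: plus_schwartz.rep_eq minus_schwartz_def uminus_schwartz.rep_eq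
      scaleR_schwartz.rep_eq zero_schwartz.rep_eq diff_conv_add_uminus)

lemma schwartz_fun_sum: "schwartz_fun (\<Sum>i\<in>A. f i) x = (\<Sum>i\<in>A. schwartz_fun (f i) x)"
  by (induction A rule: infinite_finite_induct) auto

lemma continuous_schwartz_fun: "continuous_on S (schwartz_fun f)"
proof -
  have "iter_partial [] (schwartz_fun f) differentiable (at x)" for x
    using schwartz_fun[of f] unfolding smooth_fun_def by blast
  then show ?thesis
    by (intro continuous_at_imp_continuous_on ballI differentiable_imp_continuous_within) simp
qed

lemma measurable_schwartz_fun [measurable]: "schwartz_fun f \<in> borel_measurable borel"
  by (intro borel_measurable_continuous_onI continuous_schwartz_fun)

lemma linear_dual_pair: "linear (dual_pair T)"
  using dual_pair[of T] by blast

lemmas dual_pair_simps = linear_add[OF linear_dual_pair] linear_diff[OF linear_dual_pair]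
  linear_cmul[OF linear_dual_pair] linear_sum[OF linear_dual_pair]

text \<open>A singleton is a bounded set of test functions, so evaluation is continuous for the
  strong topology. Hence pairings with a measurable process are random variables.\<close>

lemma continuous_dual_pair: "continuous_on UNIV (\<lambda>T. dual_pair T f)"
proof (subst continuous_on_open_vimage, simp, intro allI impI)
  fix V :: "real set" assume V: "open V"
  show "open ((\<lambda>T. dual_pair T f) -` V \<inter> UNIV)"
    unfolding open_tempered_def
  proof
    fix T assume "T \<in> (\<lambda>T. dual_pair T f) -` V \<inter> UNIV"
    then obtain e where "0 < e" "ball (dual_pair T f) e \<subseteq> V"
      using V open_contains_ball[of V] by auto
    then show "\<exists>B e. schwartz_bounded B \<and> 0 < e \<and>
        {S. \<forall>f\<in>B. \<bar>dual_pair S f - dual_pair T f\<bar> < e} \<subseteq> (\<lambda>T. dual_pair T f) -` V \<inter> UNIV"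
      by (intro exI[of _ "{f}"] exI[of _ e])
         (auto simp: schwartz_bounded_def dist_real_def abs_minus_commute subset_eq)
  qed
qed

lemma approximates_subseq:
  assumes "approximates \<phi> f" "filterlim r at_top sequentially"
  shows "approximates (\<lambda>n. \<phi> (r n)) f"
proof -
  have "(\<lambda>n. \<integral>\<^sup>+x. ennreal ((schwartz_fun (\<phi> (r n)) x - f x)\<^sup>2) \<partial>lborel) \<longlonglongrightarrow> 0"
    using assms by (intro filterlim_compose[OF _ assms(2)]) (auto simp: approximates_def)
  then show ?thesis using assms(1) by (auto simp: approximates_def)
qed

text \<open>Reduces both the Cauchy property and the independence of the approximating sequence to
  sequences approximating 0.\<close>

lemma approximates_diff:
  assumes f[measurable]: "f \<in> borel_measurable borel"
    and \<phi>: "approximates \<phi> f" and \<psi>: "approximates \<psi> f"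
  shows "approximates (\<lambda>n. \<phi> n - \<psi> n) (\<lambda>x. 0)"
proof -
  obtain K where K: "compact K" "\<And>n x. x \<notin> K \<Longrightarrow> schwartz_fun (\<phi> n) x = 0"
    using \<phi> by (auto simp: approximates_def)
  obtain L where L: "compact L" "\<And>n x. x \<notin> L \<Longrightarrow> schwartz_fun (\<psi> n) x = 0"
    using \<psi> by (auto simp: approximates_def)
  let ?a = "\<lambda>n. \<integral>\<^sup>+x. ennreal ((schwartz_fun (\<phi> n) x - f x)\<^sup>2) \<partial>lborel"
  let ?b = "\<lambda>n. \<integral>\<^sup>+x. ennreal ((schwartz_fun (\<psi> n) x - f x)\<^sup>2) \<partial>lborel"
  let ?c = "\<lambda>n. \<integral>\<^sup>+x. ennreal ((schwartz_fun (\<phi> n - \<psi> n) x - 0)\<^sup>2) \<partial>lborel"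
  have le: "?c n \<le> 2 * (?a n + ?b n)" for n
  proof -
    have "?c n \<le> (\<integral>\<^sup>+x. 2 * (ennreal ((schwartz_fun (\<phi> n) x - f x)\<^sup>2) + ennreal ((schwartz_fun (\<psi> n) x - f x)\<^sup>2)) \<partial>lborel)"
    proof (rule nn_integral_mono)
      fix x
      let ?u = "schwartz_fun (\<phi> n) x - f x" and ?v = "schwartz_fun (\<psi> n) x - f x"
      have "(?u - ?v)\<^sup>2 \<le> 2 * (?u\<^sup>2 + ?v\<^sup>2)"
        using zero_le_power2[of "?u + ?v"] by (simp add: power2_eq_square algebra_simps)
      then have "ennreal ((?u - ?v)\<^sup>2) \<le> ennreal (2 * (?u\<^sup>2 + ?v\<^sup>2))" by (rule ennreal_leI)
      also have "\<dots> = 2 * (ennreal (?u\<^sup>2) + ennreal (?v\<^sup>2))"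
        by (simp add: ennreal_mult)
      finally show "ennreal ((schwartz_fun (\<phi> n - \<psi> n) x - 0)\<^sup>2) \<le> 2 * (ennreal (?u\<^sup>2) + ennreal (?v\<^sup>2))"
        by simp
    qed
    also have "\<dots> = 2 * (?a n + ?b n)"
      by (simp add: nn_integral_cmult nn_integral_add)
    finally show ?thesis .
  qed
  have "(\<lambda>n. ?a n + ?b n) \<longlonglongrightarrow> 0 + 0"
    using \<phi> \<psi> unfolding approximates_def by (intro tendsto_add) blast+
  then have lim: "(\<lambda>n. 2 * (?a n + ?b n)) \<longlonglongrightarrow> 0"
    using ennreal_tendsto_cmult[of 2 "\<lambda>n. ?a n + ?b n" 0 sequentially] by simp
  have "?c \<longlonglongrightarrow> 0"
    by (rule tendsto_sandwich[OF _ _ tendsto_const lim]) (use le in auto)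
  moreover have "\<forall>n x. x \<notin> K \<union> L \<longrightarrow> schwartz_fun (\<phi> n - \<psi> n) x = 0"
    using K L by auto
  ultimately show ?thesis
    using K(1) L(1) unfolding approximates_def by blast
qed

text \<open>The Levy triplet enters only through three facts on \<Psi>. Its vanishing at 0 makes
  \<Psi> composed with a test function vanish off the support, and makes \<Psi> additive over
  disjoint supports.\<close>

locale levy_noise = prob_space M for M :: "'a measure" +
  fixes w :: "'a \<Rightarrow> 'n::finite tempered" and \<Psi> :: "real \<Rightarrow> complex"
  assumes w_measurable [measurable]: "w \<in> borel_measurable M"
    and char_functional: "\<And>\<phi>. (\<integral>\<omega>. cis (dual_pair (w \<omega>) \<phi>) \<partial>M) = exp (\<integral>x. \<Psi> (schwartz_fun \<phi> x) \<partial>lborel)"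
    and \<Psi>_continuous: "continuous_on UNIV \<Psi>"
    and \<Psi>_0: "\<Psi> 0 = 0"
    and \<Psi>_growth: "\<exists>C\<ge>0. \<forall>\<xi>. cmod (\<Psi> \<xi>) \<le> C * (1 + \<xi>\<^sup>2)"
begin

definition law :: "'n schwartz \<Rightarrow> real measure" where
  "law \<phi> = distr M borel (\<lambda>\<omega>. dual_pair (w \<omega>) \<phi>)"

lemma measurable_pairing [measurable]: "(\<lambda>\<omega>. dual_pair (w \<omega>) \<phi>) \<in> borel_measurable M"
  using measurable_compose[OF w_measurable borel_measurable_continuous_onI[OF continuous_dual_pair]] .

lemma real_distribution_law: "real_distribution (law \<phi>)"
  unfolding law_def by simp

lemma char_law: "char (law \<phi>) t = exp (\<integral>x. \<Psi> (t * schwartz_fun \<phi> x) \<partial>lborel)"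
proof -
  have "char (law \<phi>) t = (\<integral>\<omega>. cis (dual_pair (w \<omega>) (t *\<^sub>R \<phi>)) \<partial>M)"
    by (simp add: char_def law_def integral_distr cis_conv_exp dual_pair_simps)
  then show ?thesis by (simp add: char_functional)
qed

lemma measurable_\<Psi> [measurable]: "\<Psi> \<in> borel_measurable borel"
  by (rule borel_measurable_continuous_onI[OF \<Psi>_continuous])

lemma integrable_\<Psi>:
  fixes g :: "'m::euclidean_space \<Rightarrow> real"
  assumes g: "continuous_on UNIV g" and K: "compact K" "\<And>x. x \<notin> K \<Longrightarrow> g x = 0"
  shows "integrable lborel (\<lambda>x. \<Psi> (g x))"
proof -
  have "continuous_on K (\<lambda>x. \<Psi> (g x))"
    by (rule continuous_on_compose2[OF \<Psi>_continuous continuous_on_subset[OF g]]) auto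
  from borel_integrable_compact[OF K(1) this]
  have "integrable lborel (\<lambda>x. indicator K x *\<^sub>R \<Psi> (g x))" .
  moreover have "(\<lambda>x. indicator K x *\<^sub>R \<Psi> (g x)) = (\<lambda>x. \<Psi> (g x))"
    using K(2) \<Psi>_0 by (auto simp: indicator_def fun_eq_iff)
  ultimately show ?thesis by simp
qed

text \<open>Near 0 continuity gives \<epsilon>; for \<bar>\<xi>\<bar> \<ge> \<delta> the constant
  term of the growth bound is absorbed since 1 \<le> \<xi>^2 / \<delta>^2. Integrated over a fixed
  compact set, the first term is small and the second is a squared L2 norm.\<close>

lemma \<Psi>_bound:
  assumes "0 < \<epsilon>"
  shows "\<exists>D\<ge>0. \<forall>\<xi>. cmod (\<Psi> \<xi>) \<le> \<epsilon> + D * \<xi>\<^sup>2"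
proof -
  obtain C where C: "0 \<le> C" "\<And>\<xi>. cmod (\<Psi> \<xi>) \<le> C * (1 + \<xi>\<^sup>2)" using \<Psi>_growth by auto
  have "\<exists>\<delta>>0. \<forall>\<xi>\<in>UNIV. dist \<xi> 0 < \<delta> \<longrightarrow> dist (\<Psi> \<xi>) (\<Psi> 0) < \<epsilon>"
    using \<Psi>_continuous assms unfolding continuous_on_iff by blast
  then obtain \<delta> where \<delta>: "0 < \<delta>" "\<And>\<xi>. \<bar>\<xi>\<bar> < \<delta> \<Longrightarrow> cmod (\<Psi> \<xi>) < \<epsilon>"
    using \<Psi>_0 by auto
  have "cmod (\<Psi> \<xi>) \<le> \<epsilon> + C * (1 / \<delta>\<^sup>2 + 1) * \<xi>\<^sup>2" for \<xi>
  proof (cases "\<bar>\<xi>\<bar> < \<delta>")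
    case True
    have "0 \<le> C * (1 / \<delta>\<^sup>2 + 1) * \<xi>\<^sup>2" using C(1) by simp
    with \<delta>(2)[OF True] show ?thesis by linarith
  next
    case False
    then have "\<delta>\<^sup>2 \<le> \<xi>\<^sup>2" using \<delta>(1) power_mono[of \<delta> "\<bar>\<xi>\<bar>" 2] by simp
    then have "1 \<le> \<xi>\<^sup>2 / \<delta>\<^sup>2" using \<delta>(1) by (simp add: field_simps)
    then have "C * (1 + \<xi>\<^sup>2) \<le> C * (\<xi>\<^sup>2 / \<delta>\<^sup>2 + \<xi>\<^sup>2)" using C(1) by (intro mult_left_mono) auto
    with C(2)[of \<xi>] assms show ?thesis by (simp add: algebra_simps)
  qed
  then show ?thesis using C(1) by (intro exI[of _ "C * (1 / \<delta>\<^sup>2 + 1)"]) auto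
qed

lemma pairing_tendsto_0:
  assumes h: "approximates h (\<lambda>x. 0)"
  shows "tendsto_in_prob M (\<lambda>n \<omega>. dual_pair (w \<omega>) (h n)) (\<lambda>_. 0)"
proof (rule char_tendsto_1_imp_tendsto_in_prob)
  fix t
  obtain K where K: "compact K" "\<And>n x. x \<notin> K \<Longrightarrow> schwartz_fun (h n) x = 0"
    using h by (auto simp: approximates_def)
  define a where "a n = (\<integral>x. (schwartz_fun (h n) x)\<^sup>2 \<partial>lborel)" for n
  have int: "integrable lborel (\<lambda>x. (schwartz_fun (h n) x)\<^sup>2)" for n
  proof -
    have "integrable lborel (\<lambda>x. indicator K x *\<^sub>R (schwartz_fun (h n) x)\<^sup>2)"
      by (intro borel_integrable_compact K continuous_intros continuous_schwartz_fun)
    moreover have "(\<lambda>x. indicator K x *\<^sub>R (schwartz_fun (h n) x)\<^sup>2) = (\<lambda>x. (schwartz_fun (h n) x)\<^sup>2)"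
      using K(2) by (auto simp: indicator_def fun_eq_iff)
    ultimately show ?thesis by simp
  qed
  have "(\<integral>\<^sup>+x. ennreal ((schwartz_fun (h n) x - 0)\<^sup>2) \<partial>lborel) = ennreal (a n)" for n
    using int by (simp add: a_def nn_integral_eq_integral)
  then have "(\<lambda>n. ennreal (a n)) \<longlonglongrightarrow> ennreal 0" using h by (simp add: approximates_def)
  then have a: "a \<longlonglongrightarrow> 0"
    by (subst (asm) tendsto_ennreal_iff) (auto simp: a_def intro!: always_eventually Bochner_Integration.integral_nonneg)
  define \<kappa> where "\<kappa> = measure lborel K"
  have \<kappa>: "0 \<le> \<kappa>" by (simp add: \<kappa>_def)
  have Kfin: "emeasure lborel K < \<infinity>" "K \<in> sets lborel"
    using emeasure_compact_finite[OF K(1)] K(1) by (auto simp: compact_imp_closed)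
  let ?I = "\<lambda>n. \<integral>x. \<Psi> (t * schwartz_fun (h n) x) \<partial>lborel"
  have "?I \<longlonglongrightarrow> 0"
  proof (rule LIMSEQ_I)
    fix r :: real assume r: "0 < r"
    \<comment> \<open>Chosen so that \<epsilon> * \<kappa> \<le> r / 2; the added 1 avoids division
      by zero when \<open>K\<close> is a null set.\<close>
    define \<epsilon> where "\<epsilon> = r / (2 * (\<kappa> + 1))"
    have \<epsilon>: "0 < \<epsilon>" using r \<kappa> by (simp add: \<epsilon>_def)
    obtain D where D: "0 \<le> D" "\<And>\<xi>. cmod (\<Psi> \<xi>) \<le> \<epsilon> + D * \<xi>\<^sup>2" using \<Psi>_bound[OF \<epsilon>] by auto
    have le: "norm (?I n) \<le> \<epsilon> * \<kappa> + D * t\<^sup>2 * a n" for n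
    proof -
      have i1: "integrable lborel (\<lambda>x. \<Psi> (t * schwartz_fun (h n) x))"
        by (rule integrable_\<Psi>[OF _ K(1)]) (auto intro!: continuous_intros continuous_schwartz_fun simp: K(2))
      have i2: "integrable lborel (\<lambda>x. \<epsilon> * indicator K x + D * t\<^sup>2 * (schwartz_fun (h n) x)\<^sup>2)"
        using Kfin by (intro Bochner_Integration.integrable_add integrable_mult_right int integrable_real_indicator) auto
      have "norm (?I n) \<le> (\<integral>x. norm (\<Psi> (t * schwartz_fun (h n) x)) \<partial>lborel)"
        by (rule integral_norm_bound)
      also have "\<dots> \<le> (\<integral>x. \<epsilon> * indicator K x + D * t\<^sup>2 * (schwartz_fun (h n) x)\<^sup>2 \<partial>lborel)"
      proof (rule integral_mono)
        fix x
        show "norm (\<Psi> (t * schwartz_fun (h n) x)) \<le> \<epsilon> * indicator K x + D * t\<^sup>2 * (schwartz_fun (h n) x)\<^sup>2"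
          using D(2)[of "t * schwartz_fun (h n) x"] K(2)[of x n] \<Psi>_0
          by (cases "x \<in> K") (auto simp: power_mult_distrib)
      qed (use i1 i2 in auto)
      also have "\<dots> = \<epsilon> * \<kappa> + D * t\<^sup>2 * a n"
        using Kfin int by (subst Bochner_Integration.integral_add)
          (auto simp: a_def \<kappa>_def intro!: integrable_real_indicator)
      finally show ?thesis .
    qed
    have "\<epsilon> * \<kappa> < r"
    proof -
      have "\<epsilon> * \<kappa> \<le> \<epsilon> * (\<kappa> + 1)" using \<epsilon> by simp
      also have "\<dots> = r / 2" using \<kappa> by (simp add: \<epsilon>_def field_simps)
      finally show ?thesis using r by simp
    qed
    moreover have "(\<lambda>n. \<epsilon> * \<kappa> + D * t\<^sup>2 * a n) \<longlonglongrightarrow> \<epsilon> * \<kappa> + D * t\<^sup>2 * 0"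
      by (intro tendsto_add tendsto_mult tendsto_const a)
    ultimately have "eventually (\<lambda>n. \<epsilon> * \<kappa> + D * t\<^sup>2 * a n < r) sequentially"
      using order_tendstoD(2)[of "\<lambda>n. \<epsilon> * \<kappa> + D * t\<^sup>2 * a n" "\<epsilon> * \<kappa>" sequentially r] by simp
    then obtain n0 where n0: "\<And>n. n0 \<le> n \<Longrightarrow> \<epsilon> * \<kappa> + D * t\<^sup>2 * a n < r"
      by (auto simp: eventually_sequentially)
    show "\<exists>n0. \<forall>n\<ge>n0. norm (?I n - 0) < r"
    proof (intro exI[of _ n0] allI impI)
      fix n assume "n0 \<le> n"
      from le_less_trans[OF le n0[OF this]] show "norm (?I n - 0) < r" by simp
    qed
  qed
  then have "(\<lambda>n. exp (?I n)) \<longlonglongrightarrow> exp 0" by (intro tendsto_intros)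
  then show "(\<lambda>n. char (distr M borel (\<lambda>\<omega>. dual_pair (w \<omega>) (h n))) t) \<longlonglongrightarrow> 1"
    by (simp add: char_law flip: law_def)
qed measurable

text \<open>Supplies the witness behind the choice operator in \<open>noise_pair\<close>: one
  approximating sequence is Cauchy in probability, and every other one has the same limit.\<close>

lemma noise_pair_tendsto:
  assumes f[measurable]: "f \<in> borel_measurable borel" and \<phi>0: "approximates \<phi>0 f"
  shows "noise_pair M w f \<in> borel_measurable M"
    and "approximates \<phi> f \<Longrightarrow> tendsto_in_prob M (\<lambda>n \<omega>. dual_pair (w \<omega>) (\<phi> n)) (noise_pair M w f)"
proof -
  have diff: "tendsto_in_prob M (\<lambda>n \<omega>. dual_pair (w \<omega>) (\<phi> n) - dual_pair (w \<omega>) (\<psi> n)) (\<lambda>_. 0)"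
    if "approximates \<phi> f" "approximates \<psi> f" for \<phi> \<psi>
    using pairing_tendsto_0[OF approximates_diff[OF f that]]
    by (simp only: linear_diff[OF linear_dual_pair])
  have "\<exists>Y. Y \<in> borel_measurable M \<and> tendsto_in_prob M (\<lambda>n \<omega>. dual_pair (w \<omega>) (\<phi>0 n)) Y"
  proof (rule cauchy_in_prob_convergent)
    fix e d :: real assume "0 < e" "0 < d"
    show "\<exists>N. \<forall>n\<ge>N. \<forall>p\<ge>N. measure M {\<omega>\<in>space M. e < \<bar>dual_pair (w \<omega>) (\<phi>0 n) - dual_pair (w \<omega>) (\<phi>0 p)\<bar>} \<le> d"
    proof (rule ccontr)
      \<comment> \<open>Failure of the Cauchy property gives two index sequences tending to infinity
        along which the differences stay large. Both subsequences approximate \<open>f\<close>, so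
        the differences tend to 0 in probability.\<close>
      assume "\<not> ?thesis"
      then have "\<forall>N. \<exists>n p. N \<le> n \<and> N \<le> p \<and>
        d < measure M {\<omega>\<in>space M. e < \<bar>dual_pair (w \<omega>) (\<phi>0 n) - dual_pair (w \<omega>) (\<phi>0 p)\<bar>}"
        by (simp add: not_le)
      then obtain n p where np: "\<And>N. N \<le> n N" "\<And>N. N \<le> p N"
        "\<And>N. d < measure M {\<omega>\<in>space M. e < \<bar>dual_pair (w \<omega>) (\<phi>0 (n N)) - dual_pair (w \<omega>) (\<phi>0 (p N))\<bar>}"
        unfolding choice_iff by blast
      have "filterlim n at_top sequentially" "filterlim p at_top sequentially"
        using np(1,2) by (auto intro: filterlim_at_top_mono[OF filterlim_ident])
      then have "tendsto_in_prob M (\<lambda>N \<omega>. dual_pair (w \<omega>) (\<phi>0 (n N)) - dual_pair (w \<omega>) (\<phi>0 (p N))) (\<lambda>_. 0)"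
        by (intro diff[of "\<lambda>N. \<phi>0 (n N)" "\<lambda>N. \<phi>0 (p N)"] approximates_subseq[OF \<phi>0])
      then have "(\<lambda>N. measure M {\<omega>\<in>space M. e < \<bar>dual_pair (w \<omega>) (\<phi>0 (n N)) - dual_pair (w \<omega>) (\<phi>0 (p N))\<bar>}) \<longlonglongrightarrow> 0"
        using \<open>0 < e\<close> unfolding tendsto_in_prob_def by simp
      from order_tendstoD(2)[OF this \<open>0 < d\<close>] show False
        using np(3) by (auto simp: eventually_sequentially dest: less_asym)
    qed
  qed measurable
  then obtain Y where Y: "Y \<in> borel_measurable M" "tendsto_in_prob M (\<lambda>n \<omega>. dual_pair (w \<omega>) (\<phi>0 n)) Y" by auto
  have "Y \<in> borel_measurable M \<and> (\<forall>\<phi>. approximates \<phi> f \<longrightarrow> tendsto_in_prob M (\<lambda>n \<omega>. dual_pair (w \<omega>) (\<phi> n)) Y)"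
  proof (intro conjI allI impI)
    fix \<phi> assume "approximates \<phi> f"
    from diff[OF this \<phi>0] show "tendsto_in_prob M (\<lambda>n \<omega>. dual_pair (w \<omega>) (\<phi> n)) Y"
      by (rule tendsto_in_prob_triangle[rotated 3]) (use Y in auto)
  qed (rule Y)
  then have "noise_pair M w f \<in> borel_measurable M \<and>
    (\<forall>\<phi>. approximates \<phi> f \<longrightarrow> tendsto_in_prob M (\<lambda>n \<omega>. dual_pair (w \<omega>) (\<phi> n)) (noise_pair M w f))"
    unfolding noise_pair_def
    by (rule someI[where P = "\<lambda>X. X \<in> borel_measurable M \<and>
      (\<forall>\<phi>. approximates \<phi> f \<longrightarrow> tendsto_in_prob M (\<lambda>n \<omega>. dual_pair (w \<omega>) (\<phi> n)) X)"])
  then show "noise_pair M w f \<in> borel_measurable M"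
    and "approximates \<phi> f \<Longrightarrow> tendsto_in_prob M (\<lambda>n \<omega>. dual_pair (w \<omega>) (\<phi> n)) (noise_pair M w f)"
    by blast+
qed

end

section \<open>Moments of sums of bumps\<close>

text \<open>The location is a function instead of a vector, so that a grid of locations is a
  \<open>PiE\<close> set and products of sums over coordinates expand over it.\<close>

definition bump_fun :: "nat \<Rightarrow> ('n::finite \<Rightarrow> int) \<Rightarrow> real^'n \<Rightarrow> real" where
  "bump_fun p a x = (\<Prod>i\<in>UNIV. hat (2 ^ p * x $ i - of_int (a i)))"

definition bump :: "nat \<Rightarrow> ('n::finite \<Rightarrow> int) \<Rightarrow> 'n schwartz" where
  "bump p a = Schwartz (bump_fun p a)"

lemma bump_fun_eq_0: "1 \<le> \<bar>2 ^ p * x $ i - of_int (a i)\<bar> \<Longrightarrow> bump_fun p a x = 0"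
  by (auto simp: bump_fun_def intro!: bexI[of _ i] hat_eq_0)

lemma schwartz_fun_bump: "schwartz_fun (bump p a) = bump_fun p a"
proof -
  define g where "g i t = hat (2 ^ p * t - of_int (a i))" for i t
  define R where "R = 1 + (\<Sum>i\<in>UNIV. \<bar>real_of_int (a i)\<bar>)"
  have g: "times_diff n (g i)" for i n
    using times_diff_affine[OF times_diff_hat, of n "2 ^ p" "- of_int (a i)"] by (simp add: g_def[abs_def])
  have "g i x = 0" if "R < \<bar>x\<bar>" for i x
  proof -
    have "\<bar>x\<bar> \<le> \<bar>2 ^ p * x\<bar>" by (simp add: abs_mult mult_le_cancel_right1)
    moreover have "\<bar>real_of_int (a i)\<bar> \<le> (\<Sum>i\<in>UNIV. \<bar>real_of_int (a i)\<bar>)"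
      by (rule member_le_sum) auto
    ultimately show ?thesis using that unfolding g_def R_def by (intro hat_eq_0) linarith
  qed
  from tensor_schwartz[of g R, OF g this] show ?thesis
    unfolding bump_def by (intro Schwartz_inverse) (simp add: g_def bump_fun_def[abs_def])
qed

lemma bump_fun_compact_support: "\<exists>K. compact K \<and> (\<forall>x. x \<notin> K \<longrightarrow> bump_fun p a x = 0)"
proof (intro exI conjI allI impI)
  define R where "R = 1 + (\<Sum>i\<in>UNIV. \<bar>real_of_int (a i)\<bar>)"
  show "compact (cbox (\<chi> i. - R) (\<chi> i. R) :: (real^'a) set)" by (rule compact_cbox)
  fix x :: "real^'a" assume "x \<notin> cbox (\<chi> i. - R) (\<chi> i. R)"
  then have "\<exists>i. \<not> (- R \<le> x $ i \<and> x $ i \<le> R)" by (auto simp: mem_box_cart)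
  then obtain i where "R < \<bar>x $ i\<bar>" by (metis abs_le_iff minus_le_iff not_le)
  moreover have "\<bar>x $ i\<bar> \<le> \<bar>2 ^ p * x $ i\<bar>" by (simp add: abs_mult mult_le_cancel_right1)
  moreover have "\<bar>real_of_int (a i)\<bar> \<le> (\<Sum>i\<in>UNIV. \<bar>real_of_int (a i)\<bar>)"
    by (rule member_le_sum) auto
  ultimately show "bump_fun p a x = 0" unfolding R_def by (intro bump_fun_eq_0[where i = i]) linarith
qed

lemma bump_fun_disjoint:
  assumes "2 \<le> \<bar>a i - b i\<bar>" "bump_fun p a x \<noteq> 0"
  shows "bump_fun p b x = 0"
proof (rule bump_fun_eq_0[where i = i])
  have "\<bar>2 ^ p * x $ i - of_int (a i)\<bar> < 1" using bump_fun_eq_0[of p x i a] assms(2) by force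
  moreover have "2 \<le> \<bar>real_of_int (a i) - real_of_int (b i)\<bar>" using assms(1) by linarith
  ultimately show "1 \<le> \<bar>2 ^ p * x $ i - of_int (b i)\<bar>" by linarith
qed

text \<open>At most one argument is nonzero, and the others contribute nothing since \<Psi> 0 = 0.
  This is where disjoint supports become independence.\<close>

lemma (in levy_noise) \<Psi>_sum:
  assumes "finite A" and disj: "\<And>a b. a \<in> A \<Longrightarrow> b \<in> A \<Longrightarrow> a \<noteq> b \<Longrightarrow> f a = 0 \<or> f b = 0"
  shows "\<Psi> (\<Sum>a\<in>A. f a) = (\<Sum>a\<in>A. \<Psi> (f a))"
proof (cases "\<exists>a\<in>A. f a \<noteq> 0")
  case True
  then obtain a where a: "a \<in> A" "f a \<noteq> 0" by auto
  then have "f b = 0" if "b \<in> A - {a}" for b using disj that by auto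
  then show ?thesis
    using assms(1) a by (simp add: sum.remove[of A a] \<Psi>_0)
qed (simp add: \<Psi>_0)

text \<open>The substitution y = 2^p x - a has Jacobian 2^(p d). The value does not depend on
  \<open>a\<close>, so translated bumps have the same law, and the denominator is the order of the
  convolution root.\<close>

lemma lborel_integral_bump_fun:
  fixes F :: "real \<Rightarrow> complex" and a :: "'n::finite \<Rightarrow> int"
  assumes [measurable]: "F \<in> borel_measurable borel"
  shows "(\<integral>x. F (bump_fun p a x) \<partial>lborel) = (\<integral>x. F (bump_fun 0 (\<lambda>_. 0) (x :: real^'n)) \<partial>lborel) / 2 ^ (p * CARD('n))"
proof -
  define s :: "real^'n" where "s = (\<chi> i. - of_int (a i))"
  have eq: "bump_fun p a x = bump_fun 0 (\<lambda>_. 0) (s + 2 ^ p *\<^sub>R x)" for x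
    by (simp add: bump_fun_def s_def)
  have [measurable]: "bump_fun 0 (\<lambda>_. 0 :: int) \<in> borel_measurable (borel :: (real^'n) measure)"
    unfolding schwartz_fun_bump[symmetric] by measurable
  let ?I = "\<integral>x. F (bump_fun 0 (\<lambda>_. 0) (x :: real^'n)) \<partial>lborel"
  have "?I = (\<integral>x. F (bump_fun 0 (\<lambda>_. 0) x) \<partial>(density (distr lborel borel (\<lambda>x. s + 2 ^ p *\<^sub>R x)) (\<lambda>_. \<bar>2 ^ p :: real\<bar> ^ DIM((real,'n) vec))))"
    using lborel_affine[of "2 ^ p :: real" s] by simp
  also have "\<dots> = (\<integral>x. (2 ^ p) ^ CARD('n) *\<^sub>R F (bump_fun p a x) \<partial>lborel)"
    unfolding ennreal_power[symmetric]
    by (subst integral_density) (auto simp: integral_distr eq)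
  also have "\<dots> = 2 ^ (p * CARD('n)) * (\<integral>x. F (bump_fun p a x) \<partial>lborel)"
    by (simp add: power_mult scaleR_conv_of_real)
  finally show ?thesis by simp
qed

context levy_noise
begin

lemma char_law_bump_sum:
  assumes "finite A" and disj: "\<And>a b. a \<in> A \<Longrightarrow> b \<in> A \<Longrightarrow> a \<noteq> b \<Longrightarrow> \<exists>i. 2 \<le> \<bar>a i - b i\<bar>"
  shows "char (law (\<Sum>a\<in>A. c a *\<^sub>R bump p a)) t = (\<Prod>a\<in>A. char (law (bump p (\<lambda>_. 0))) (c a * t))"
proof -
  have "(\<integral>x. \<Psi> (t * schwartz_fun (\<Sum>a\<in>A. c a *\<^sub>R bump p a) x) \<partial>lborel) =
      (\<integral>x. (\<Sum>a\<in>A. \<Psi> (t * c a * bump_fun p a x)) \<partial>lborel)"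
  proof (rule Bochner_Integration.integral_cong[OF refl])
    fix x :: "real^'n"
    have "\<Psi> (\<Sum>a\<in>A. t * c a * bump_fun p a x) = (\<Sum>a\<in>A. \<Psi> (t * c a * bump_fun p a x))"
      by (rule \<Psi>_sum[OF assms(1)]) (use disj bump_fun_disjoint in fastforce)
    then show "\<Psi> (t * schwartz_fun (\<Sum>a\<in>A. c a *\<^sub>R bump p a) x) = (\<Sum>a\<in>A. \<Psi> (t * c a * bump_fun p a x))"
      by (simp add: schwartz_fun_sum schwartz_fun_bump sum_distrib_left mult.assoc)
  qed
  also have "\<dots> = (\<Sum>a\<in>A. \<integral>x. \<Psi> (t * c a * bump_fun p a x) \<partial>lborel)"
  proof (rule Bochner_Integration.integral_sum)
    fix a assume "a \<in> A"
    obtain K where K: "compact K" "\<And>x. x \<notin> K \<Longrightarrow> bump_fun p a x = 0"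
      using bump_fun_compact_support[of p a] by auto
    show "integrable lborel (\<lambda>x. \<Psi> (t * c a * bump_fun p a x))"
    proof (rule integrable_\<Psi>[OF _ K(1)])
      show "continuous_on UNIV (\<lambda>x. t * c a * bump_fun p a x)"
        unfolding schwartz_fun_bump[symmetric] by (intro continuous_intros continuous_schwartz_fun)
    qed (simp add: K(2))
  qed
  also have "\<dots> = (\<Sum>a\<in>A. \<integral>x. \<Psi> (t * c a * bump_fun p (\<lambda>_. 0) (x :: real^'n)) \<partial>lborel)"
  proof (rule sum.cong[OF refl])
    fix a assume "a \<in> A"
    have [measurable]: "(\<lambda>y. \<Psi> (t * c a * y)) \<in> borel_measurable borel" by measurable
    show "(\<integral>x. \<Psi> (t * c a * bump_fun p a x) \<partial>lborel) = (\<integral>x. \<Psi> (t * c a * bump_fun p (\<lambda>_. 0) (x :: real^'n)) \<partial>lborel)"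
      using lborel_integral_bump_fun[where F = "\<lambda>y. \<Psi> (t * c a * y)" and p = p and a = a]
        lborel_integral_bump_fun[where F = "\<lambda>y. \<Psi> (t * c a * y)" and p = p and a = "\<lambda>_ :: 'n. 0"] by simp
  qed
  finally show ?thesis
    using assms(1) by (simp add: char_law exp_sum schwartz_fun_bump mult_ac)
qed

lemma char_law_bump_power:
  "char (law (bump 0 (\<lambda>_. 0))) t = char (law (bump p (\<lambda>_. 0))) t ^ (2 ^ (p * CARD('n)))"
proof -
  have "(\<integral>x. \<Psi> (t * bump_fun p (\<lambda>_. 0) (x :: real^'n)) \<partial>lborel) =
      (\<integral>x. \<Psi> (t * bump_fun 0 (\<lambda>_. 0) (x :: real^'n)) \<partial>lborel) / 2 ^ (p * CARD('n))"
    by (rule lborel_integral_bump_fun[where F = "\<lambda>y. \<Psi> (t * y)"]) measurable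
  then show ?thesis
    by (simp add: char_law schwartz_fun_bump flip: exp_of_nat_mult)
qed

lemma has_all_moments_law:
  assumes "finite_moments M w"
  shows "has_all_moments (law \<phi>)"
proof -
  have "integrable M (\<lambda>\<omega>. dual_pair (w \<omega>) \<phi> ^ j)" for j
  proof (cases "j = 0")
    case False
    have "(\<integral>\<^sup>+\<omega>. ennreal (norm (dual_pair (w \<omega>) \<phi> ^ j)) \<partial>M) = abs_moment M (real j) (\<lambda>\<omega>. dual_pair (w \<omega>) \<phi>)"
      unfolding abs_moment_def using False
      by (intro nn_integral_cong) (auto simp: powr_realpow' power_abs)
    also have "\<dots> < \<infinity>" using assms False by (auto simp: finite_moments_def)
    finally show ?thesis by (intro integrableI_bounded) auto
  qed simp
  then show ?thesis
    by (simp add: has_all_moments_def real_distribution_law) (simp add: law_def integrable_distr_eq)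
qed

text \<open>The constant is built from the law of one bump at scale 0, scaled by \<open>B\<close>,
  and is therefore uniform in \<open>p\<close>, \<open>J\<close>, \<open>A\<close> and
  \<open>b\<close>.\<close>

lemma bump_sum_moment_disjoint:
  assumes fm: "finite_moments M w" and m: "1 \<le> m" and B: "0 < B"
  shows "\<exists>C\<ge>0. \<forall>p J A b. finite A \<longrightarrow> (\<forall>a\<in>A. \<forall>a'\<in>A. a \<noteq> a' \<longrightarrow> (\<exists>i. 2 \<le> \<bar>a i - a' i\<bar>)) \<longrightarrow>
      (\<forall>a\<in>A. \<bar>b a\<bar> \<le> B) \<longrightarrow> 1 \<le> J \<longrightarrow> card A * J \<le> K * 2 ^ (p * CARD('n)) \<longrightarrow>
      real J * (\<integral>\<omega>. dual_pair (w \<omega>) (\<Sum>a\<in>A. b a *\<^sub>R bump p a) ^ (2 * m) \<partial>M) \<le> C"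
proof -
  let ?\<nu> = "\<lambda>p. distr (law (bump p (\<lambda>_. 0))) borel (\<lambda>x. B * x)"
  define C where "C = 2 ^ (2 * m) * (fact (2 * m) * fps_nth (sym_fps (?\<nu> 0) ^ K) (2 * m) +
    (real K * fps_nth (moment_fps (?\<nu> 0)) 1) ^ (2 * m))"
  have am: "has_all_moments (?\<nu> p)" for p
    using has_all_moments_scale(1)[OF has_all_moments_law[OF fm]] .
  have rd: "real_distribution (?\<nu> p)" for p using am by (auto simp: has_all_moments_def)
  have "0 \<le> C"
    unfolding C_def using fps_power_nonneg_mono(1)[OF sym_fps_nonneg[OF am] sym_fps_0[OF am]] by simp
  moreover have "real J * (\<integral>\<omega>. dual_pair (w \<omega>) (\<Sum>a\<in>A. b a *\<^sub>R bump p a) ^ (2 * m) \<partial>M) \<le> C"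
    if A: "finite A" "\<forall>a\<in>A. \<forall>a'\<in>A. a \<noteq> a' \<longrightarrow> (\<exists>i. 2 \<le> \<bar>a i - a' i\<bar>)" "\<forall>a\<in>A. \<bar>b a\<bar> \<le> B"
      and J: "1 \<le> J" "card A * J \<le> K * 2 ^ (p * CARD('n))" for p J A b
  proof -
    let ?\<mu> = "law (\<Sum>a\<in>A. b a *\<^sub>R bump p a)"
    have "real J * (\<integral>x. x ^ (2 * m) \<partial>?\<mu>) \<le> C"
      unfolding C_def
    \<comment> \<open>Moving the factor \<open>B\<close> into the laws leaves coefficients
      \<open>b a / B\<close> in [-1,1], as the comparison of series requires.\<close>
    proof (rule moment_char_prod_le(2)[where A = A and \<nu> = "?\<nu> p" and c = "\<lambda>a. b a / B" and N = "2 ^ (p * CARD('n))"])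
      show "real_distribution ?\<mu>" by (rule real_distribution_law)
      show "char ?\<mu> t = (\<Prod>k\<in>A. char (?\<nu> p) (b k / B * t))" for t
        using A B by (simp add: char_law_bump_sum char_scale[OF real_distribution_law])
      show "char (?\<nu> 0) t = char (?\<nu> p) t ^ 2 ^ (p * CARD('n))" for t
        by (simp add: char_scale[OF real_distribution_law] flip: char_law_bump_power)
      show "\<bar>b k / B\<bar> \<le> 1" if "k \<in> A" for k using A(3) B that by (simp add: abs_le_iff field_simps)
    qed (fact A(1) am rd J m)+
    then show ?thesis by (simp add: law_def integral_distr)
  qed
  ultimately show ?thesis by (intro exI[of _ C] conjI allI impI)
qed

text \<open>Two distinct indices with the same parities differ by at least 2 in some coordinate, so
  each of the \<open>Q\<close> parity classes has disjoint supports. In the constant,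
  \<open>Q ^ (2 * m)\<close> comes from the power sum inequality and the extra \<open>Q\<close> from
  the number of classes.\<close>

lemma bump_sum_moment:
  assumes fm: "finite_moments M w" and m: "1 \<le> m" and B: "0 < B"
  shows "\<exists>C\<ge>0. \<forall>p J A b. finite A \<longrightarrow>
      (\<forall>a\<in>A. \<bar>b a\<bar> \<le> B) \<longrightarrow> 1 \<le> J \<longrightarrow> card A * J \<le> K * 2 ^ (p * CARD('n)) \<longrightarrow>
      real J * (\<integral>\<omega>. dual_pair (w \<omega>) (\<Sum>a\<in>A. b a *\<^sub>R bump p a) ^ (2 * m) \<partial>M) \<le> C"
proof -
  from bump_sum_moment_disjoint[OF assms, of K] obtain C where C: "0 \<le> C"
    and C': "\<forall>p J A b. finite A \<longrightarrow> (\<forall>a\<in>A. \<forall>a'\<in>A. a \<noteq> a' \<longrightarrow> (\<exists>i. 2 \<le> \<bar>a i - a' i\<bar>)) \<longrightarrow>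
      (\<forall>a\<in>A. \<bar>b a\<bar> \<le> B) \<longrightarrow> 1 \<le> J \<longrightarrow> card A * J \<le> K * 2 ^ (p * CARD('n)) \<longrightarrow>
      real J * (\<integral>\<omega>. dual_pair (w \<omega>) (\<Sum>a\<in>A. b a *\<^sub>R bump p a) ^ (2 * m) \<partial>M) \<le> C"
    by (elim exE conjE)
  define Q where "Q = real (card (UNIV :: ('n \<Rightarrow> bool) set))"
  have "real J * (\<integral>\<omega>. dual_pair (w \<omega>) (\<Sum>a\<in>A. b a *\<^sub>R bump p a) ^ (2 * m) \<partial>M) \<le> Q ^ (2 * m) * (Q * C)"
    if A: "finite A" "\<forall>a\<in>A. \<bar>b a\<bar> \<le> B"
      and J: "1 \<le> J" "card A * J \<le> K * 2 ^ (p * CARD('n))" for p J A b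
  proof -
    define A' where "A' \<epsilon> = {a\<in>A. (\<lambda>i. even (a i)) = \<epsilon>}" for \<epsilon> :: "'n \<Rightarrow> bool"
    let ?X = "\<lambda>\<epsilon> \<omega>. dual_pair (w \<omega>) (\<Sum>a\<in>A' \<epsilon>. b a *\<^sub>R bump p a)"
    have int: "integrable M (\<lambda>\<omega>. dual_pair (w \<omega>) \<phi> ^ j)" for \<phi> j
      using has_all_moments_law[OF fm, of \<phi>] by (simp add: has_all_moments_def law_def integrable_distr_eq)
    have sum: "(\<Sum>a\<in>A. b a *\<^sub>R bump p a) = (\<Sum>\<epsilon>\<in>UNIV. \<Sum>a\<in>A' \<epsilon>. b a *\<^sub>R bump p a)"
      unfolding A'_def by (rule sum.group[symmetric]) (use A in auto)
    have le: "dual_pair (w \<omega>) (\<Sum>a\<in>A. b a *\<^sub>R bump p a) ^ (2 * m) \<le> Q ^ (2 * m) * (\<Sum>\<epsilon>\<in>UNIV. ?X \<epsilon> \<omega> ^ (2 * m))" for \<omega>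
      using power_sum_le[of UNIV "2 * m" "\<lambda>\<epsilon>. ?X \<epsilon> \<omega>"] m
      by (simp add: sum linear_sum[OF linear_dual_pair] power_even_abs Q_def)
    have part: "real J * (\<integral>\<omega>. ?X \<epsilon> \<omega> ^ (2 * m) \<partial>M) \<le> C" for \<epsilon>
    proof (rule C'[rule_format])
      show "finite (A' \<epsilon>)" using A by (simp add: A'_def)
      show "\<exists>i. 2 \<le> \<bar>a i - a' i\<bar>" if a: "a \<in> A' \<epsilon>" "a' \<in> A' \<epsilon>" "a \<noteq> a'" for a a'
      proof -
        from a obtain i where i: "a i \<noteq> a' i" by auto
        have "even (a i) = even (a' i)" using a by (auto simp: A'_def fun_eq_iff)
        then have "even (a i - a' i)" by simp
        then obtain q where q: "a i - a' i = 2 * q" by (rule evenE)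
        with i have "q \<noteq> 0" by auto
        with q have "2 \<le> \<bar>a i - a' i\<bar>" by arith
        then show "\<exists>i. 2 \<le> \<bar>a i - a' i\<bar>" by blast
      qed
      show "\<bar>b a\<bar> \<le> B" if "a \<in> A' \<epsilon>" for a using A that by (auto simp: A'_def)
      have "card (A' \<epsilon>) \<le> card A" using A by (intro card_mono) (auto simp: A'_def)
      then show "card (A' \<epsilon>) * J \<le> K * 2 ^ (p * CARD('n))"
        using J(2) by (meson le_trans mult_le_mono1)
    qed (rule J)
    have "(\<integral>\<omega>. dual_pair (w \<omega>) (\<Sum>a\<in>A. b a *\<^sub>R bump p a) ^ (2 * m) \<partial>M) \<le>
        (\<integral>\<omega>. Q ^ (2 * m) * (\<Sum>\<epsilon>\<in>UNIV. ?X \<epsilon> \<omega> ^ (2 * m)) \<partial>M)"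
      by (intro integral_mono int integrable_mult_right Bochner_Integration.integrable_sum le)
    also have "\<dots> = Q ^ (2 * m) * (\<Sum>\<epsilon>\<in>UNIV. \<integral>\<omega>. ?X \<epsilon> \<omega> ^ (2 * m) \<partial>M)"
      using int by simp
    finally have "real J * (\<integral>\<omega>. dual_pair (w \<omega>) (\<Sum>a\<in>A. b a *\<^sub>R bump p a) ^ (2 * m) \<partial>M) \<le>
        real J * (Q ^ (2 * m) * (\<Sum>\<epsilon>\<in>UNIV. \<integral>\<omega>. ?X \<epsilon> \<omega> ^ (2 * m) \<partial>M))"
      by (rule mult_left_mono) simp
    also have "\<dots> = Q ^ (2 * m) * (\<Sum>\<epsilon>\<in>UNIV. real J * (\<integral>\<omega>. ?X \<epsilon> \<omega> ^ (2 * m) \<partial>M))"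
      by (simp add: sum_distrib_left mult_ac)
    also have "\<dots> \<le> Q ^ (2 * m) * (\<Sum>\<epsilon>\<in>(UNIV :: ('n \<Rightarrow> bool) set). C)"
      by (intro mult_left_mono sum_mono part) (simp add: Q_def)
    finally show ?thesis by (simp add: Q_def)
  qed
  moreover have "0 \<le> Q ^ (2 * m) * (Q * C)" using C by (simp add: Q_def)
  ultimately show ?thesis by (intro exI[of _ "Q ^ (2 * m) * (Q * C)"] conjI allI impI)
qed

end

section \<open>Approximation of wavelets by sums of bumps\<close>

text \<open>At spacing 2^(-n) the grid covers the box \<bar>y_i\<bar> \<le> R + 1. Functions to be
  sampled live in \<bar>y_i\<bar> \<le> R, and the margin 1 absorbs the radius 2^(-n) of a
  bump.\<close>

definition grid :: "nat \<Rightarrow> nat \<Rightarrow> ('n::finite \<Rightarrow> int) set" where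
  "grid R n = (\<Pi>\<^sub>E i\<in>UNIV. {- ((int R + 2) * 2 ^ n)..(int R + 2) * 2 ^ n})"

definition sample_point :: "nat \<Rightarrow> ('n::finite \<Rightarrow> int) \<Rightarrow> real^'n" where
  "sample_point n l = (\<chi> i. of_int (l i) / 2 ^ n)"

lemma finite_grid: "finite (grid R n)"
  by (auto simp: grid_def intro: finite_PiE)

text \<open>The odd point in 2 (R + 2) 2^n + 1 is absorbed by 2^n, which gives the 5 and a pure
  multiple of 2^(n d).\<close>

lemma card_grid: "card (grid R n :: ('n::finite \<Rightarrow> int) set) \<le> (2 * R + 5) ^ CARD('n) * 2 ^ (n * CARD('n))"
proof -
  have "card (grid R n :: ('n \<Rightarrow> int) set) = nat (2 * ((int R + 2) * 2 ^ n) + 1) ^ CARD('n)"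
    by (simp add: grid_def card_PiE algebra_simps)
  also have "nat (2 * ((int R + 2) * 2 ^ n) + 1) \<le> (2 * R + 5) * 2 ^ n"
    by (simp add: nat_le_iff algebra_simps)
  then have "nat (2 * ((int R + 2) * 2 ^ n) + 1) ^ CARD('n) \<le> ((2 * R + 5) * 2 ^ n) ^ CARD('n)"
    by (rule power_mono) simp
  finally show ?thesis by (simp add: power_mult_distrib power_mult)
qed

lemma bump_fun_nonneg: "0 \<le> bump_fun p a x"
  by (auto simp: bump_fun_def intro: prod_nonneg hat_nonneg)

lemma bump_fun_grid_sum:
  fixes y :: "real^'n::finite"
  assumes "\<And>i. \<bar>y $ i\<bar> \<le> real R + 1"
  shows "(\<Sum>l\<in>grid R n. bump_fun n l y) = 1"
proof -
  have "(\<Sum>l\<in>grid R n. bump_fun n l y) =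
      (\<Prod>i\<in>UNIV. \<Sum>l\<in>{- ((int R + 2) * 2 ^ n)..(int R + 2) * 2 ^ n}. hat (2 ^ n * y $ i - of_int l))"
    unfolding grid_def bump_fun_def by (rule prod_sum_PiE[symmetric]) auto
  also have "\<dots> = (\<Prod>i\<in>(UNIV :: 'n set). 1)"
  proof (rule prod.cong[OF refl])
    fix i
    have "\<bar>2 ^ n * y $ i\<bar> \<le> 2 ^ n * (real R + 1)"
      using assms[of i] by (simp add: abs_mult)
    also have "\<dots> \<le> of_int ((int R + 2) * 2 ^ n)" by (simp add: algebra_simps)
    finally show "(\<Sum>l\<in>{- ((int R + 2) * 2 ^ n)..(int R + 2) * 2 ^ n}. hat (2 ^ n * y $ i - of_int l)) = 1"
      using hat_partition_of_unity[of "2 ^ n * y $ i" "(int R + 2) * 2 ^ n"] by simp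
  qed
  finally show ?thesis by simp
qed

lemma bump_fun_nonzero_near:
  assumes "bump_fun n l y \<noteq> 0"
  shows "\<bar>y $ i - sample_point n l $ i\<bar> \<le> 1 / 2 ^ n"
proof -
  have "\<bar>2 ^ n * y $ i - of_int (l i)\<bar> \<le> 1" using bump_fun_eq_0[of n y i l] assms by force
  moreover have "2 ^ n * y $ i - of_int (l i) = 2 ^ n * (y $ i - sample_point n l $ i)"
    by (simp add: sample_point_def algebra_simps)
  ultimately have "\<bar>2 ^ n * (y $ i - sample_point n l $ i)\<bar> \<le> 1" by (simp only:)
  then have "2 ^ n * \<bar>y $ i - sample_point n l $ i\<bar> \<le> 1" by (simp add: abs_mult)
  then show ?thesis by (simp add: pos_le_divide_eq mult.commute)
qed

lemma grid_sum_outside: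
  assumes supp: "\<And>y i. f y \<noteq> 0 \<Longrightarrow> \<bar>y $ i\<bar> \<le> real R" and y: "real R + 1 < \<bar>y $ i\<bar>"
  shows "(\<Sum>l\<in>grid R n. f (sample_point n l) * bump_fun n l y) = 0" "f y = (0 :: real)"
proof -
  show "f y = 0" using supp[of y i] y by force
  have "f (sample_point n l) * bump_fun n l y = 0" for l
  proof (cases "bump_fun n l y = 0")
    case False
    have "(1 :: real) / 2 ^ n \<le> 1" by simp
    with bump_fun_nonzero_near[OF False, of i] y have "real R < \<bar>sample_point n l $ i\<bar>" by linarith
    then show ?thesis using supp[of "sample_point n l" i] by force
  qed simp
  then show "(\<Sum>l\<in>grid R n. f (sample_point n l) * bump_fun n l y) = 0" by (intro sum.neutral ballI)
qed

text \<open>Inside the box the bumps are nonnegative weights with sum 1, so the sampled sum is an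
  average of values of \<open>f\<close> at points within 2^(-n) of \<open>y\<close> in each
  coordinate.\<close>

lemma grid_sum_close:
  assumes supp: "\<And>y i. f y \<noteq> 0 \<Longrightarrow> \<bar>y $ i\<bar> \<le> real R"
    and osc: "\<And>y z. (\<And>i. \<bar>y $ i - z $ i\<bar> \<le> 1 / 2 ^ n) \<Longrightarrow> \<bar>f y - f z\<bar> \<le> \<epsilon>" and \<epsilon>: "0 \<le> \<epsilon>"
  shows "\<bar>(\<Sum>l\<in>grid R n. f (sample_point n l) * bump_fun n l y) - f y\<bar> \<le> (\<epsilon> :: real)"
proof (cases "\<exists>i. real R + 1 < \<bar>y $ i\<bar>")
  case True
  then obtain i where "real R + 1 < \<bar>y $ i\<bar>" by auto
  from grid_sum_outside[of f, OF supp this] show ?thesis using \<epsilon> by simp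
next
  case False
  then have one: "(\<Sum>l\<in>grid R n. bump_fun n l y) = 1"
    by (intro bump_fun_grid_sum) (auto simp: not_less)
  have "(\<Sum>l\<in>grid R n. f (sample_point n l) * bump_fun n l y) - f y =
      (\<Sum>l\<in>grid R n. f (sample_point n l) * bump_fun n l y) - f y * (\<Sum>l\<in>grid R n. bump_fun n l y)"
    by (simp add: one)
  also have "\<dots> = (\<Sum>l\<in>grid R n. (f (sample_point n l) - f y) * bump_fun n l y)"
    by (simp add: sum_subtractf sum_distrib_left algebra_simps)
  finally have "\<bar>(\<Sum>l\<in>grid R n. f (sample_point n l) * bump_fun n l y) - f y\<bar> \<le>
      (\<Sum>l\<in>grid R n. \<bar>(f (sample_point n l) - f y) * bump_fun n l y\<bar>)"
    by (simp only: sum_abs)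
  also have "\<dots> \<le> (\<Sum>l\<in>grid R n. \<epsilon> * bump_fun n l y)"
  proof (rule sum_mono)
    fix l
    show "\<bar>(f (sample_point n l) - f y) * bump_fun n l y\<bar> \<le> \<epsilon> * bump_fun n l y"
    proof (cases "bump_fun n l y = 0")
      case False
      have "\<bar>f y - f (sample_point n l)\<bar> \<le> \<epsilon>"
        by (rule osc) (rule bump_fun_nonzero_near[OF False])
      then show ?thesis
        using bump_fun_nonneg[of n l y] by (simp add: abs_mult abs_minus_commute mult_right_mono)
    qed simp
  qed
  also have "\<dots> = \<epsilon>" by (simp add: one flip: sum_distrib_left)
  finally show ?thesis .
qed

lemma uniform_oscillation:
  fixes f :: "real^'n::finite \<Rightarrow> real"
  assumes cont: "continuous_on UNIV f" and supp: "\<And>y i. f y \<noteq> 0 \<Longrightarrow> \<bar>y $ i\<bar> \<le> real R" and \<epsilon>: "0 < \<epsilon>"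
  shows "\<exists>n0. \<forall>n\<ge>n0. \<forall>y z. (\<forall>i. \<bar>y $ i - z $ i\<bar> \<le> 1 / 2 ^ n) \<longrightarrow> \<bar>f y - f z\<bar> \<le> \<epsilon>"
proof -
  let ?K = "cbox (\<chi> i. - (real R + 1)) (\<chi> i. real R + 1) :: (real^'n) set"
  have "uniformly_continuous_on ?K f"
    by (intro compact_uniformly_continuous compact_cbox continuous_on_subset[OF cont]) simp
  then have "\<exists>\<delta>>0. \<forall>y\<in>?K. \<forall>z\<in>?K. dist z y < \<delta> \<longrightarrow> dist (f z) (f y) < \<epsilon>"
    using \<epsilon> unfolding uniformly_continuous_on_def by (elim allE impE)
  then obtain \<delta> where \<delta>: "0 < \<delta>" "\<forall>y\<in>?K. \<forall>z\<in>?K. dist z y < \<delta> \<longrightarrow> dist (f z) (f y) < \<epsilon>"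
    by (elim exE conjE)
  have inK: "y \<in> ?K \<longleftrightarrow> (\<forall>i. \<bar>y $ i\<bar> \<le> real R + 1)" for y
  proof -
    have "\<bar>u\<bar> \<le> c \<longleftrightarrow> - c \<le> u \<and> u \<le> c" for u c :: real by linarith
    then show ?thesis by (simp only: mem_box_cart vec_lambda_beta)
  qed
  \<comment> \<open>Closeness 2^(-n) in each coordinate gives Euclidean distance at most d 2^(-n),
    through the l1 norm.\<close>
  have "(\<lambda>n. real CARD('n) * (1 / 2) ^ n) \<longlonglongrightarrow> real CARD('n) * 0"
    by (intro tendsto_mult tendsto_const LIMSEQ_realpow_zero) auto
  then have "eventually (\<lambda>n. real CARD('n) * (1 / 2) ^ n < \<delta>) sequentially"
    using \<delta>(1) order_tendstoD(2)[of _ 0 sequentially \<delta>] by simp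
  then obtain n0 where n0: "\<And>n. n0 \<le> n \<Longrightarrow> real CARD('n) * (1 / 2) ^ n < \<delta>"
    by (auto simp: eventually_sequentially)
  have "\<bar>f y - f z\<bar> \<le> \<epsilon>" if n: "n0 \<le> n" and close: "\<And>i. \<bar>y $ i - z $ i\<bar> \<le> 1 / 2 ^ n" for n y z
  proof (cases "y \<in> ?K \<and> z \<in> ?K")
    case True
    have "dist z y = norm (y - z)" by (simp add: dist_norm norm_minus_commute)
    also have "\<dots> \<le> (\<Sum>i\<in>UNIV. \<bar>(y - z) $ i\<bar>)" by (rule norm_le_l1_cart)
    also have "\<dots> \<le> (\<Sum>i\<in>(UNIV :: 'n set). 1 / 2 ^ n)" using close by (intro sum_mono) simp
    also have "\<dots> < \<delta>" using n0[OF n] by (simp add: power_divide)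
    finally show ?thesis using \<delta>(2)[rule_format, of y z] True by (simp add: dist_real_def abs_minus_commute)
  next
    case False
    \<comment> \<open>Uniform continuity on the box says nothing when a point lies outside it. Then
      the other point is still beyond R in some coordinate, and both values vanish.\<close>
    have "f u = 0 \<and> f v = 0" if u: "u \<notin> ?K" and uv: "\<And>i. \<bar>u $ i - v $ i\<bar> \<le> 1 / 2 ^ n" for u v
    proof -
      obtain i where i: "real R + 1 < \<bar>u $ i\<bar>" using u inK by (auto simp: not_le)
      have "(1 :: real) / 2 ^ n \<le> 1" by simp
      then have "real R < \<bar>v $ i\<bar>" using i uv[of i] by linarith
      then show ?thesis using i supp[of u i] supp[of v i] by force
    qed
    note out = this
    from False have "f y = 0 \<and> f z = 0"
    proof (cases "y \<in> ?K")
      case True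
      with False have "z \<notin> ?K" by simp
      from out[OF this, of y] close show ?thesis by (simp add: abs_minus_commute)
    qed (use out close in blast)
    then show ?thesis using \<epsilon> by simp
  qed
  then show ?thesis by (intro exI[of _ n0] allI impI) simp
qed

text \<open>Samples are taken in the coordinates y = 2^j x - k of the unscaled function. In x the
  bump of level n at index l becomes one of level n + j at index 2^n k + l, so refining by j shrinks
  the bumps without adding any. The amplitude is left out to keep the coefficients bounded in
  j.\<close>

definition sampling ::
    "(real^'n::finite \<Rightarrow> real) \<Rightarrow> nat \<Rightarrow> nat \<Rightarrow> int^'n \<Rightarrow> nat \<Rightarrow> 'n schwartz" where
  "sampling f R j k n = (\<Sum>l\<in>grid R n. f (sample_point n l) *\<^sub>R bump (n + j) (\<lambda>i. 2 ^ n * k $ i + l i))"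

lemma schwartz_fun_sampling:
  "schwartz_fun (sampling f R j k n) x =
    (\<Sum>l\<in>grid R n. f (sample_point n l) * bump_fun n l (2 ^ j *\<^sub>R x - (\<chi> i. of_int (k $ i))))"
  by (auto simp: sampling_def schwartz_fun_sum schwartz_fun_bump bump_fun_def power_add algebra_simps
      intro!: sum.cong)

lemma ennreal_tendsto_0I:
  fixes f :: "nat \<Rightarrow> ennreal"
  assumes "\<And>r. 0 < r \<Longrightarrow> eventually (\<lambda>n. f n \<le> ennreal r) sequentially"
  shows "f \<longlonglongrightarrow> 0"
proof (rule order_tendstoI)
  fix a :: ennreal assume "0 < a"
  then obtain b where b: "0 < b" "b < a" using dense by blast
  then obtain r where "b = ennreal r" "0 < r" by (cases b) (auto simp: top_unique)
  with assms[of r] b show "eventually (\<lambda>n. f n < a) sequentially"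
    by (auto elim!: eventually_mono)
qed simp

lemma approximates_sampling:
  fixes f :: "real^'n::finite \<Rightarrow> real"
  assumes cont: "continuous_on UNIV f" and supp: "\<And>y i. f y \<noteq> 0 \<Longrightarrow> \<bar>y $ i\<bar> \<le> real R"
  shows "approximates (\<lambda>n. s *\<^sub>R sampling f R j k n) (\<lambda>x. s * f (2 ^ j *\<^sub>R x - (\<chi> i. of_int (k $ i))))"
proof -
  let ?k = "(\<chi> i. of_int (k $ i)) :: real^'n"
  let ?B = "cbox (\<chi> i. - (real R + 1)) (\<chi> i. real R + 1) :: (real^'n) set"
  \<comment> \<open>Image of the enlarged box under the inverse of x -> 2^j x - k: one compact set
    for the target and for the samplings of all levels n.\<close>
  define K where "K = (\<lambda>y. (1 / 2 ^ j) *\<^sub>R (y + ?k)) ` ?B"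
  have K: "compact K"
    unfolding K_def by (intro compact_continuous_image compact_cbox continuous_intros)
  have out: "\<exists>i. real R + 1 < \<bar>(2 ^ j *\<^sub>R x - ?k) $ i\<bar>" if "x \<notin> K" for x
  proof (rule ccontr)
    assume "\<not> ?thesis"
    then have "\<bar>(2 ^ j *\<^sub>R x - ?k) $ i\<bar> \<le> real R + 1" for i by (auto simp: not_less)
    then have "- (real R + 1) \<le> (2 ^ j *\<^sub>R x - ?k) $ i" "(2 ^ j *\<^sub>R x - ?k) $ i \<le> real R + 1" for i
      unfolding abs_le_iff by (metis minus_le_iff, metis)
    then have "2 ^ j *\<^sub>R x - ?k \<in> ?B" unfolding mem_box_cart by simp
    moreover have "x = (1 / 2 ^ j) *\<^sub>R ((2 ^ j *\<^sub>R x - ?k) + ?k)" by simp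
    ultimately have "x \<in> K" unfolding K_def by blast
    with that show False by simp
  qed
  have zero: "schwartz_fun (s *\<^sub>R sampling f R j k n) x = 0 \<and> s * f (2 ^ j *\<^sub>R x - ?k) = 0" if x: "x \<notin> K" for n x
  proof -
    obtain i where i: "real R + 1 < \<bar>(2 ^ j *\<^sub>R x - ?k) $ i\<bar>" using out[OF x] by auto
    show ?thesis using grid_sum_outside[of f, OF supp i] by (simp add: schwartz_fun_sampling)
  qed
  have Kfin: "emeasure lborel K = ennreal (measure lborel K)" and Kset[measurable]: "K \<in> sets borel"
    using emeasure_compact_finite[OF K] K by (auto simp: emeasure_eq_ennreal_measure compact_imp_closed)
  have "(\<lambda>n. \<integral>\<^sup>+x. ennreal ((schwartz_fun (s *\<^sub>R sampling f R j k n) x - s * f (2 ^ j *\<^sub>R x - ?k))\<^sup>2) \<partial>lborel) \<longlonglongrightarrow> 0"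
  proof (rule ennreal_tendsto_0I)
    fix r :: real assume r: "0 < r"
    \<comment> \<open>Arranged so that the squared error (\<bar>s\<bar> \<epsilon>)^2 times the
      volume of \<open>K\<close> is at most \<epsilon>^2 * \<kappa> = r; the added ones keep
      \<kappa> positive.\<close>
    define \<kappa> where "\<kappa> = (\<bar>s\<bar> + 1)\<^sup>2 * (measure lborel K + 1)"
    have \<kappa>: "0 < \<kappa>" unfolding \<kappa>_def by (intro mult_pos_pos zero_less_power) (auto intro: add_nonneg_pos)
    define \<epsilon> where "\<epsilon> = sqrt (r / \<kappa>)"
    have \<epsilon>: "0 < \<epsilon>" using r \<kappa> by (simp add: \<epsilon>_def)
    have "\<exists>n0. \<forall>n\<ge>n0. \<forall>y z. (\<forall>i. \<bar>y $ i - z $ i\<bar> \<le> 1 / 2 ^ n) \<longrightarrow> \<bar>f y - f z\<bar> \<le> \<epsilon>"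
      by (rule uniform_oscillation[OF cont _ \<epsilon>]) (rule supp)
    then obtain n0 where n0: "\<forall>n\<ge>n0. \<forall>y z. (\<forall>i. \<bar>y $ i - z $ i\<bar> \<le> 1 / 2 ^ n) \<longrightarrow> \<bar>f y - f z\<bar> \<le> \<epsilon>"
      by (elim exE)
    have "(\<integral>\<^sup>+x. ennreal ((schwartz_fun (s *\<^sub>R sampling f R j k n) x - s * f (2 ^ j *\<^sub>R x - ?k))\<^sup>2) \<partial>lborel) \<le> ennreal r"
      if n: "n0 \<le> n" for n
    proof -
      have "(\<integral>\<^sup>+x. ennreal ((schwartz_fun (s *\<^sub>R sampling f R j k n) x - s * f (2 ^ j *\<^sub>R x - ?k))\<^sup>2) \<partial>lborel)
          \<le> (\<integral>\<^sup>+x. ennreal ((\<bar>s\<bar> * \<epsilon>)\<^sup>2) * indicator K x \<partial>lborel)"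
      proof (rule nn_integral_mono)
        fix x
        show "ennreal ((schwartz_fun (s *\<^sub>R sampling f R j k n) x - s * f (2 ^ j *\<^sub>R x - ?k))\<^sup>2)
            \<le> ennreal ((\<bar>s\<bar> * \<epsilon>)\<^sup>2) * indicator K x"
        proof (cases "x \<in> K")
          case True
          let ?S = "\<Sum>l\<in>grid R n. f (sample_point n l) * bump_fun n l (2 ^ j *\<^sub>R x - ?k)"
          have "\<bar>?S - f (2 ^ j *\<^sub>R x - ?k)\<bar> \<le> \<epsilon>"
            by (rule grid_sum_close[of f, OF supp]) (use n0[rule_format, OF n] \<epsilon> in simp_all)
          then have "\<bar>s * (?S - f (2 ^ j *\<^sub>R x - ?k))\<bar> \<le> \<bar>s\<bar> * \<epsilon>"
            by (simp add: abs_mult mult_left_mono)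
          from power_mono[OF this, of 2] have "(s * (?S - f (2 ^ j *\<^sub>R x - ?k)))\<^sup>2 \<le> (\<bar>s\<bar> * \<epsilon>)\<^sup>2" by simp
          then show ?thesis
            using True by (simp add: schwartz_fun_sampling right_diff_distrib ennreal_leI)
        next
          case False
          then show ?thesis by (simp only: zero[OF False]) simp
        qed
      qed
      also have "\<dots> = ennreal ((\<bar>s\<bar> * \<epsilon>)\<^sup>2 * measure lborel K)"
        by (simp add: nn_integral_cmult Kfin ennreal_mult)
      also have "\<dots> \<le> ennreal r"
      proof (rule ennreal_leI)
        have "(\<bar>s\<bar> * \<epsilon>)\<^sup>2 * measure lborel K = \<epsilon>\<^sup>2 * (\<bar>s\<bar>\<^sup>2 * measure lborel K)"
          by (simp add: power_mult_distrib)
        also have "\<dots> \<le> \<epsilon>\<^sup>2 * \<kappa>"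
          unfolding \<kappa>_def by (intro mult_left_mono mult_mono power_mono) auto
        also have "\<dots> = r" using r \<kappa> by (simp add: \<epsilon>_def)
        finally show "(\<bar>s\<bar> * \<epsilon>)\<^sup>2 * measure lborel K \<le> r" .
      qed
      finally show ?thesis .
    qed
    then show "eventually (\<lambda>n. (\<integral>\<^sup>+x. ennreal ((schwartz_fun (s *\<^sub>R sampling f R j k n) x - s * f (2 ^ j *\<^sub>R x - ?k))\<^sup>2) \<partial>lborel) \<le> ennreal r) sequentially"
      by (auto simp: eventually_sequentially)
  qed
  then show ?thesis
    unfolding approximates_def using K zero by (intro conjI exI[of _ K] allI impI) blast+
qed

context levy_noise begin

text \<open>Here J = 2^(j d), p = n + j and K = (2R + 5)^d. The grid has at most K 2^(n d) points,
  so the cardinality condition holds at every level n. The constant depends on \<open>f\<close> only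
  through \<open>B\<close>.\<close>

lemma sampling_moment:
  assumes fm: "finite_moments M w" and m: "1 \<le> m" and B: "0 < B"
  shows "\<exists>C\<ge>0. \<forall>f j k n. (\<forall>y. \<bar>f y\<bar> \<le> B) \<longrightarrow>
    2 ^ (j * CARD('n)) * (\<integral>\<omega>. dual_pair (w \<omega>) (sampling f R j k n) ^ (2 * m) \<partial>M) \<le> C"
proof -
  from bump_sum_moment[OF assms, of "(2 * R + 5) ^ CARD('n)"] obtain C where C: "0 \<le> C"
    and C': "\<forall>p J A b. finite A \<longrightarrow> (\<forall>a\<in>A. \<bar>b a\<bar> \<le> B) \<longrightarrow> 1 \<le> J \<longrightarrow>
      card A * J \<le> (2 * R + 5) ^ CARD('n) * 2 ^ (p * CARD('n)) \<longrightarrow>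
      real J * (\<integral>\<omega>. dual_pair (w \<omega>) (\<Sum>a\<in>A. b a *\<^sub>R bump p a) ^ (2 * m) \<partial>M) \<le> C"
    by (elim exE conjE)
  have "2 ^ (j * CARD('n)) * (\<integral>\<omega>. dual_pair (w \<omega>) (sampling f R j k n) ^ (2 * m) \<partial>M) \<le> C"
    if f: "\<forall>y. \<bar>f y\<bar> \<le> B" for f j k n
  proof -
    let ?h = "\<lambda>l i. 2 ^ n * k $ i + l i :: int"
    \<comment> \<open>The sum is reindexed by the shifted locations, so the coefficient has to undo
      the shift by 2^n k.\<close>
    let ?b = "\<lambda>a. f (sample_point n (\<lambda>i. a i - 2 ^ n * k $ i))"
    have inj: "inj_on ?h (grid R n)" by (auto simp: inj_on_def fun_eq_iff)
    have "sampling f R j k n = (\<Sum>a\<in>?h ` grid R n. ?b a *\<^sub>R bump (n + j) a)"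
      by (simp add: sampling_def sum.reindex[OF inj])
    moreover have "real (2 ^ (j * CARD('n))) *
        (\<integral>\<omega>. dual_pair (w \<omega>) (\<Sum>a\<in>?h ` grid R n. ?b a *\<^sub>R bump (n + j) a) ^ (2 * m) \<partial>M) \<le> C"
    proof (rule C'[rule_format])
      have "card (?h ` grid R n) * 2 ^ (j * CARD('n)) \<le> (2 * R + 5) ^ CARD('n) * 2 ^ (n * CARD('n)) * 2 ^ (j * CARD('n))"
        unfolding card_image[OF inj] by (intro mult_le_mono1 card_grid)
      then show "card (?h ` grid R n) * 2 ^ (j * CARD('n)) \<le> (2 * R + 5) ^ CARD('n) * 2 ^ ((n + j) * CARD('n))"
        by (simp add: power_add algebra_simps)
    qed (use f in \<open>auto simp: finite_grid\<close>)
    ultimately show ?thesis by simp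
  qed
  with C show ?thesis by (intro exI[of _ C] conjI allI impI)
qed

end

section \<open>Wavelets as bounded functions of compact support, and the final bound\<close>

lemma continuous_compact_support_bounded:
  fixes g :: "real \<Rightarrow> real"
  assumes g: "continuous_on UNIV g" and K: "compact K" "\<And>x. x \<notin> K \<Longrightarrow> g x = 0"
  shows "\<exists>b. \<forall>x. \<bar>g x\<bar> \<le> b"
proof -
  have "bounded (g ` K)"
    by (intro compact_imp_bounded compact_continuous_image K continuous_on_subset[OF g]) simp
  then have "bounded (insert 0 (g ` K))" by simp
  then obtain b where b: "\<forall>y\<in>insert 0 (g ` K). norm y \<le> b" unfolding bounded_iff by blast
  have "g x \<in> insert 0 (g ` K)" for x using K(2)[of x] by (cases "x \<in> K") auto
  with b have "\<bar>g x\<bar> \<le> b" for x by (metis real_norm_def)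
  then show ?thesis by blast
qed

lemma continuous_tensor_wavelet:
  assumes "continuous_on UNIV \<psi>M" "continuous_on UNIV \<psi>F"
  shows "continuous_on S (tensor_wavelet \<psi>M \<psi>F G)"
  unfolding tensor_wavelet_def
proof (rule continuous_on_prod)
  fix i
  show "continuous_on S (\<lambda>x. (case G $ i of Mother \<Rightarrow> \<psi>M | Father \<Rightarrow> \<psi>F) (x $ i))"
    by (cases "G $ i") (auto intro!: continuous_on_compose2[OF assms(1)] continuous_on_compose2[OF assms(2)] continuous_intros)
qed

theorem proposition5p1:
  fixes M :: "'a measure"
    and w :: "'a \<Rightarrow> 'n::finite tempered"
    and \<Psi> :: "real \<Rightarrow> complex"
    and \<psi>M \<psi>F :: "real \<Rightarrow> real"
    and r\<^sub>0 m :: nat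
  assumes "prob_space M" and "complete_measure M"
    and "levy_white_noise M \<Psi> w"
    and "finite_moments M w"
    and "sector_condition \<Psi>"
    and "1 \<le> r\<^sub>0" and "daubechies_wavelets r\<^sub>0 \<psi>M \<psi>F"
    and "1 \<le> m"
    and "ereal (real (2 * m)) < moment_index M w"
  shows "\<exists>C>0. \<forall>j :: nat. \<forall>G \<in> gender_set j. \<forall>k :: int^'n.
    (\<integral>\<^sup>+\<omega>. ennreal (noise_pair M w (wavelet \<psi>M \<psi>F j G k) \<omega> ^ (2 * m)) \<partial>M)
      \<le> ennreal (C * 2 ^ (j * CARD('n) * (m - 1)))"
proof -
  obtain \<mu> v \<nu> where \<nu>: "levy_measure \<nu>" and \<Psi>: "\<Psi> = levy_exponent \<mu> v \<nu>"
    using assms(3) by (auto simp: levy_white_noise_def)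
  interpret prob_space M by fact
  interpret levy_noise M w \<Psi>
  proof unfold_locales
    show "w \<in> borel_measurable M"
      and "(\<integral>\<omega>. cis (dual_pair (w \<omega>) \<phi>) \<partial>M) = exp (\<integral>x. \<Psi> (schwartz_fun \<phi> x) \<partial>lborel)" for \<phi>
      using assms(3) unfolding levy_white_noise_def by blast+
    show "continuous_on UNIV \<Psi>" unfolding \<Psi> by (rule levy_exponent_continuous[OF \<nu>])
    show "\<Psi> 0 = 0" unfolding \<Psi> by (rule levy_exponent_0)
    show "\<exists>C\<ge>0. \<forall>\<xi>. cmod (\<Psi> \<xi>) \<le> C * (1 + \<xi>\<^sup>2)"
      unfolding \<Psi> by (rule levy_exponent_quadratic_growth[OF \<nu>])
  qed
  have C_k_continuous: "continuous_on UNIV g" if "C_k r g" for r g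
  proof -
    have "continuous_on UNIV ((deriv ^^ 0) g)" using that unfolding C_k_def by blast
    then show ?thesis by simp
  qed
  have cM: "continuous_on UNIV \<psi>M" and cF: "continuous_on UNIV \<psi>F"
    using assms(7) unfolding daubechies_wavelets_def by (blast intro: C_k_continuous)+
  obtain K where K: "compact K" "\<And>x. x \<notin> K \<Longrightarrow> \<psi>M x = 0" "\<And>x. x \<notin> K \<Longrightarrow> \<psi>F x = 0"
    using assms(7) unfolding daubechies_wavelets_def by blast
  obtain R0 where R0: "\<And>x. x \<in> K \<Longrightarrow> \<bar>x\<bar> \<le> R0"
    using compact_imp_bounded[OF K(1)] by (auto simp: bounded_iff)
  define R where "R = nat \<lceil>R0\<rceil>"
  have R: "\<bar>x\<bar> \<le> real R" if "x \<in> K" for x using R0[OF that] unfolding R_def by linarith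
  obtain bM bF where b: "\<And>x. \<bar>\<psi>M x\<bar> \<le> bM" "\<And>x. \<bar>\<psi>F x\<bar> \<le> bF"
    using continuous_compact_support_bounded[OF cM K(1,2)] continuous_compact_support_bounded[OF cF K(1,3)]
    by auto
  \<comment> \<open>The 1 ensures \<open>B > 0\<close>, since the moment bound divides by
    \<open>B\<close>.\<close>
  define c where "c = max 1 (max bM bF)"
  define B where "B = c ^ CARD('n)"
  have B: "0 < B" unfolding B_def c_def by (intro zero_less_power) simp
  have bound: "\<bar>tensor_wavelet \<psi>M \<psi>F G y\<bar> \<le> B" for G and y :: "real^'n"
  proof -
    have "\<bar>(case G $ i of Mother \<Rightarrow> \<psi>M | Father \<Rightarrow> \<psi>F) (y $ i)\<bar> \<le> c" for i
      using b(1)[of "y $ i"] b(2)[of "y $ i"] by (cases "G $ i") (auto simp: c_def)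
    then show ?thesis
      unfolding tensor_wavelet_def abs_prod B_def using prod_mono[of UNIV "\<lambda>i. \<bar>(case G $ i of Mother \<Rightarrow> \<psi>M | Father \<Rightarrow> \<psi>F) (y $ i)\<bar>" "\<lambda>_. c"]
      by simp
  qed
  have supp: "\<bar>y $ i\<bar> \<le> real R" if "tensor_wavelet \<psi>M \<psi>F G y \<noteq> 0" for G and y :: "real^'n" and i
  proof (rule R, rule ccontr)
    assume "y $ i \<notin> K"
    then have "(case G $ i of Mother \<Rightarrow> \<psi>M | Father \<Rightarrow> \<psi>F) (y $ i) = 0"
      using K(2,3) by (cases "G $ i") auto
    with that show False unfolding tensor_wavelet_def by (auto simp: prod_zero_iff)
  qed
  from sampling_moment[OF assms(4,8) B, of R] obtain C where C: "0 \<le> C"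
    and C': "\<forall>f j k n. (\<forall>y. \<bar>f y\<bar> \<le> B) \<longrightarrow>
      2 ^ (j * CARD('n)) * (\<integral>\<omega>. dual_pair (w \<omega>) (sampling f R j k n) ^ (2 * m) \<partial>M) \<le> C"
    by (elim exE conjE)
  have "(\<integral>\<^sup>+\<omega>. ennreal (noise_pair M w (wavelet \<psi>M \<psi>F j G k) \<omega> ^ (2 * m)) \<partial>M)
      \<le> ennreal ((C + 1) * 2 ^ (j * CARD('n) * (m - 1)))" for j G and k :: "int^'n"
  proof -
    define s where "s = 2 powr (real (j * CARD('n)) / 2)"
    let ?f = "tensor_wavelet \<psi>M \<psi>F G"
    let ?\<phi> = "\<lambda>n. s *\<^sub>R sampling ?f R j k n"
    have wav: "wavelet \<psi>M \<psi>F j G k = (\<lambda>x. s * ?f (2 ^ j *\<^sub>R x - (\<chi> i. of_int (k $ i))))"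
      by (simp add: wavelet_def[abs_def] s_def)
    have meas: "wavelet \<psi>M \<psi>F j G k \<in> borel_measurable borel"
      unfolding wav
      by (intro borel_measurable_continuous_onI continuous_on_mult_left
          continuous_on_compose2[OF continuous_tensor_wavelet[OF cM cF, of UNIV]] continuous_intros) auto
    have app: "approximates ?\<phi> (wavelet \<psi>M \<psi>F j G k)"
      unfolding wav by (intro approximates_sampling continuous_tensor_wavelet cM cF supp)
    \<comment> \<open>The first factor is absorbed by the sampling bound; the second is the growth
      in the theorem. As m \<ge> 1, the natural subtraction \<open>m - 1\<close> is exact.\<close>
    have s: "s ^ (2 * m) = 2 ^ (j * CARD('n)) * 2 ^ (j * CARD('n) * (m - 1))"
    proof -
      have "s ^ 2 = 2 powr real (j * CARD('n))"
        unfolding s_def power2_eq_square powr_add[symmetric] by simp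
      also have "\<dots> = 2 ^ (j * CARD('n))" by (rule powr_realpow) simp
      finally have "s ^ (2 * m) = 2 ^ (j * CARD('n) * m)" by (simp add: power_mult)
      moreover have "j * CARD('n) * m = j * CARD('n) + j * CARD('n) * (m - 1)"
        using assms(8) by (cases m) auto
      ultimately show ?thesis by (simp only: power_add)
    qed
    have "(\<integral>\<^sup>+\<omega>. ennreal (dual_pair (w \<omega>) (?\<phi> n) ^ (2 * m)) \<partial>M) \<le> ennreal ((C + 1) * 2 ^ (j * CARD('n) * (m - 1)))" for n
    proof -
      let ?E = "\<integral>\<omega>. dual_pair (w \<omega>) (sampling ?f R j k n) ^ (2 * m) \<partial>M"
      have int: "integrable M (\<lambda>\<omega>. dual_pair (w \<omega>) \<phi> ^ i)" for \<phi> i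
        using has_all_moments_law[OF assms(4), of \<phi>] by (simp add: has_all_moments_def law_def integrable_distr_eq)
      have "(\<integral>\<^sup>+\<omega>. ennreal (dual_pair (w \<omega>) (?\<phi> n) ^ (2 * m)) \<partial>M) = ennreal (\<integral>\<omega>. dual_pair (w \<omega>) (?\<phi> n) ^ (2 * m) \<partial>M)"
        using int by (intro nn_integral_eq_integral) auto
      also have "(\<integral>\<omega>. dual_pair (w \<omega>) (?\<phi> n) ^ (2 * m) \<partial>M) = s ^ (2 * m) * ?E"
        by (simp add: linear_cmul[OF linear_dual_pair] power_mult_distrib)
      also have "\<dots> = (2 ^ (j * CARD('n)) * ?E) * 2 ^ (j * CARD('n) * (m - 1))" by (simp add: s)
      also have "\<dots> \<le> (C + 1) * 2 ^ (j * CARD('n) * (m - 1))"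
      proof (rule mult_right_mono)
        have "2 ^ (j * CARD('n)) * ?E \<le> C" by (rule C'[rule_format]) (rule bound)
        then show "2 ^ (j * CARD('n)) * ?E \<le> C + 1" by simp
      qed simp
      finally show ?thesis using ennreal_leI by blast
    qed
    \<comment> \<open>The bound just obtained does not depend on n, so it passes to the limit in
      probability through the continuous even power.\<close>
    then show ?thesis
      by (intro nn_integral_le_tendsto_in_prob[OF _ noise_pair_tendsto(1)[OF meas app]
            noise_pair_tendsto(2)[OF meas app app], where f = "\<lambda>x. x ^ (2 * m)"])
         (auto intro!: continuous_intros)
  qed
  \<comment> \<open>\<open>C\<close> may be 0, while a positive constant is required.\<close>
  then show ?thesis using C by (intro exI[of _ "C + 1"]) auto
qed

end
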